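(* Let $\Gamma$ satisfy volume control with parameter $\alpha$ and the weak Poincaré inequality. Let $A\subset\mathbb V$ be finite and nonempty, and let $\mu_{xy}=\mu_{yx}\in[0,1]$, $V_x\ge 0$ be arbitrary. Then: (i) (Upper bound) There is a constant $C>0$ depending only on $\Gamma$ (in particular independent of $A$, $\mu$, $V$) such that $N(E)\le N_u(CE)$ for all $E>0$. (ii) (Lower bound) There are constants $c_1,c_2,c_3,c_4,c_1',c_2',c_3',c_4',c^*>0$ depending only on $\Gamma$ such that for every $0<\kappa<1/4$: $$N(E)\ge c_1\kappa^{\alpha}N_u(c_3\kappa^{\alpha+2}E)-c_2N_u(c_4\kappa^{\alpha+4}E)\quad\text{for } E\le c^*\kappa^{-4},$$ $$N(E)\ge c_1'N_u(c_3'\kappa^{2}E)-c_2'N_u(c_4'\kappa^{4}E)\quad\text{for } E> c^*\kappa^{-4}.$$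
   Context: Graph: $\Gamma=(\mathbb V,\mathcal E)$ is a connected simple unweighted graph with countably infinite vertex set; $x\sim y$ means $\{x,y\}\in\mathcal E$; $\deg(x)=\#\{y:y\sim x\}$; $d_0$ is the shortest-path metric; for $x\in\mathbb V$ and real $r\ge 0$, $B(x,r)=\{y\in\mathbb V:d_0(x,y)\le r\}$; $|S|$ denotes cardinality. Volume control (Ahlfors $\alpha$-regularity): there are $\alpha\ge 1$ and $C_L,C_U>0$ with $C_Lr^\alpha\le |B(x,r)|\le C_Ur^\alpha$ for all $x\in\mathbb V$, $r\ge 1$ (hence $M_\Gamma:=\sup_x\deg(x)<\infty$). Operator: given symmetric bond strengths $\mu_{xy}=\mu_{yx}\in[0,1]$ ($x\sim y$) and a potential $V_x\ge 0$, for finite nonempty $A\subset\mathbb V$ let $H^A$ act on $\ell^2(A)$ by $H^Af(x)=\deg(x)f(x)-\sum_{y\in A,\,y\sim x}\mu_{xy}f(y)+V_xf(x)$ ($\deg$ being the degree in $\Gamma$). $H^A$ is positive definite; the landscape function $u=u_A:A\to(0,\infty)$ is the unique solution of $H^Au=1$ on $A$. The integrated density of states is $N(E)=N^A(E)=|A|^{-1}\#\{\text{eigenvalues of }H^A\text{ (with multiplicity)}\le E\}$. Coverings: a covering of radius $R$ is a family $\mathcal P=\{B(z_i,R)\}_i$ with countably many centers $z_i\in\mathbb V$ and union $\mathbb V$; it has overlap constant $b$ if $\sup_{y\in\mathbb V}\#\{i:y\in B(z_i,R)\}\le b$. $\mathcal P|_A=\{B\in\mathcal P:B\cap A\neq\emptyset\}$.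 For $E>0$ the landscape counting function is $N_u^{\mathcal P,A}(E)=|A|^{-1}\#\{B\in\mathcal P|_A:\min_{x\in B\cap A}1/u(x)\le E\}$. Under volume control there is a constant $b_\Gamma$ such that for every $R>0$ coverings of radius $R$ with overlap constant $b_\Gamma$ exist; $N_u(E)$ denotes $N_u^{\mathcal P,A}(E)$ for any covering $\mathcal P$ of radius $E^{-1/2}$ with overlap constant $b_\Gamma$ (different such choices change $N_u$ only by a multiplicative constant depending on $\Gamma$, absorbed into the constants of the statement). Weak Poincaré inequality: there exist $C_P>0$, $\lambda\ge1$ such that for all $x\in\mathbb V$, $r\ge1$, with $B=B(x,r)$, $B^*=B(x,\lambda r)$ and every $f:B^*\to\mathbb R$, $\sum_{y\in B}(f(y)-\bar f^B)^2\le C_Pr^2\sum_{y,z\in B^*,\,y\sim z}(f(y)-f(z))^2$, where $\bar f^B=\sum_{y\in B}f(y)\deg(y)/\sum_{y\in B}\deg(y)$. *)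

theory Defs
  imports Complex_Main "HOL-Library.Countable_Set" "Jordan_Normal_Form.Char_Poly"
begin

definition graph_dist :: "('v \<Rightarrow> 'v \<Rightarrow> bool) \<Rightarrow> 'v \<Rightarrow> 'v \<Rightarrow> nat" where
  "graph_dist adj x y = (LEAST n. (adj ^^ n) x y)"

definition gball :: "('v \<Rightarrow> 'v \<Rightarrow> bool) \<Rightarrow> 'v \<Rightarrow> real \<Rightarrow> 'v set" where
  "gball adj x r = {y. real (graph_dist adj x y) \<le> r}"

definition gdeg :: "('v \<Rightarrow> 'v \<Rightarrow> bool) \<Rightarrow> 'v \<Rightarrow> nat" where
  "gdeg adj x = card {y. adj x y}"

definition infinite_connected_simple_graph :: "('v \<Rightarrow> 'v \<Rightarrow> bool) \<Rightarrow> bool" where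
  "infinite_connected_simple_graph adj \<longleftrightarrow>
     infinite (UNIV :: 'v set) \<and> countable (UNIV :: 'v set) \<and>
     (\<forall>x y. adj x y \<longrightarrow> adj y x) \<and> (\<forall>x. \<not> adj x x) \<and>
     (\<forall>x y. \<exists>n. (adj ^^ n) x y)"

definition volume_control :: "('v \<Rightarrow> 'v \<Rightarrow> bool) \<Rightarrow> real \<Rightarrow> real \<Rightarrow> real \<Rightarrow> bool" where
  "volume_control adj \<alpha> CL CU \<longleftrightarrow> \<alpha> \<ge> 1 \<and> CL > 0 \<and> CU > 0 \<and>
     (\<forall>x r. r \<ge> 1 \<longrightarrow> CL * r powr \<alpha> \<le> real (card (gball adj x r)) \<and>
                         real (card (gball adj x r)) \<le> CU * r powr \<alpha>)"

definition deg_mean :: "('v \<Rightarrow> 'v \<Rightarrow> bool) \<Rightarrow> 'v set \<Rightarrow> ('v \<Rightarrow> real) \<Rightarrow> real" where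
  "deg_mean adj B f = (\<Sum>y\<in>B. f y * real (gdeg adj y)) / (\<Sum>y\<in>B. real (gdeg adj y))"

definition weak_poincare :: "('v \<Rightarrow> 'v \<Rightarrow> bool) \<Rightarrow> real \<Rightarrow> real \<Rightarrow> bool" where
  "weak_poincare adj CP lam \<longleftrightarrow> CP > 0 \<and> lam \<ge> 1 \<and>
     (\<forall>x r (f :: 'v \<Rightarrow> real). r \<ge> 1 \<longrightarrow>
        (let B = gball adj x r; Bs = gball adj x (lam * r) in
          (\<Sum>y\<in>B. (f y - deg_mean adj B f)^2)
            \<le> CP * r^2 * (\<Sum>(y,z)\<in>{(y,z). y \<in> Bs \<and> z \<in> Bs \<and> adj y z}. (f y - f z)^2)))"

definition admissible :: "('v \<Rightarrow> 'v \<Rightarrow> bool) \<Rightarrow> ('v \<Rightarrow> 'v \<Rightarrow> real) \<Rightarrow> ('v \<Rightarrow> real) \<Rightarrow> bool" where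
  "admissible adj \<mu> V \<longleftrightarrow>
     (\<forall>x y. adj x y \<longrightarrow> \<mu> x y = \<mu> y x \<and> 0 \<le> \<mu> x y \<and> \<mu> x y \<le> 1) \<and> (\<forall>x. V x \<ge> 0)"

text \<open>The operator H^A acting on functions on A (values outside A are ignored).\<close>
definition HA :: "('v \<Rightarrow> 'v \<Rightarrow> bool) \<Rightarrow> ('v \<Rightarrow> 'v \<Rightarrow> real) \<Rightarrow> ('v \<Rightarrow> real) \<Rightarrow> 'v set
                  \<Rightarrow> ('v \<Rightarrow> real) \<Rightarrow> 'v \<Rightarrow> real" where
  "HA adj \<mu> V A f x = real (gdeg adj x) * f x - (\<Sum>y\<in>{y\<in>A. adj y x}. \<mu> x y * f y) + V x * f x"

definition landscape :: "('v \<Rightarrow> 'v \<Rightarrow> bool) \<Rightarrow> ('v \<Rightarrow> 'v \<Rightarrow> real) \<Rightarrow> ('v \<Rightarrow> real) \<Rightarrow> 'v set \<Rightarrow> 'v \<Rightarrow> real" where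
  "landscape adj \<mu> V A = (THE u. (\<forall>x\<in>A. HA adj \<mu> V A u x = 1) \<and> (\<forall>x. x \<notin> A \<longrightarrow> u x = 0))"

text \<open>Matrix of H^A with respect to an enumeration of A (the spectrum does not depend on it).\<close>
definition enum_set :: "'v set \<Rightarrow> nat \<Rightarrow> 'v" where
  "enum_set A = (SOME e. bij_betw e {..<card A} A)"

definition HA_mat :: "('v \<Rightarrow> 'v \<Rightarrow> bool) \<Rightarrow> ('v \<Rightarrow> 'v \<Rightarrow> real) \<Rightarrow> ('v \<Rightarrow> real) \<Rightarrow> 'v set \<Rightarrow> real mat" where
  "HA_mat adj \<mu> V A = mat (card A) (card A) (\<lambda>(i,j).
     (let x = enum_set A i; y = enum_set A j in
        (if x = y then real (gdeg adj x) + V x else 0) - (if adj x y then \<mu> x y else 0)))"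

definition IDS :: "('v \<Rightarrow> 'v \<Rightarrow> bool) \<Rightarrow> ('v \<Rightarrow> 'v \<Rightarrow> real) \<Rightarrow> ('v \<Rightarrow> real) \<Rightarrow> 'v set \<Rightarrow> real \<Rightarrow> real" where
  "IDS adj \<mu> V A E =
     (let p = char_poly (HA_mat adj \<mu> V A) in
        real (\<Sum>t\<in>{t. poly p t = 0 \<and> t \<le> E}. order t p) / real (card A))"

definition is_covering :: "('v \<Rightarrow> 'v \<Rightarrow> bool) \<Rightarrow> 'v set set \<Rightarrow> real \<Rightarrow> nat \<Rightarrow> bool" where
  "is_covering adj P R b \<longleftrightarrow>
     (\<forall>B\<in>P. \<exists>z. B = gball adj z R) \<and> \<Union>P = UNIV \<and>
     (\<forall>y. finite {B\<in>P. y \<in> B} \<and> card {B\<in>P. y \<in> B} \<le> b)"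

definition Nu :: "'v set set \<Rightarrow> 'v set \<Rightarrow> ('v \<Rightarrow> real) \<Rightarrow> real \<Rightarrow> real" where
  "Nu P A u E = real (card {B\<in>P. B \<inter> A \<noteq> {} \<and> Min ((\<lambda>x. 1 / u x) ` (B \<inter> A)) \<le> E}) / real (card A)"

end

theory Submission
  imports Defs
    "Jordan_Normal_Form.Schur_Decomposition"
    "HOL-Computational_Algebra.Fundamental_Theorem_Algebra"
begin

text \<open>
  Write \<open>Q\<close> for the quadratic form of \<open>H\<^sup>A\<close> and \<open>u\<close> for the landscape function.

  Upper bound: impose on \<open>f\<close> that its degree-weighted mean vanishes on each ball of the covering counted by
  \<open>N\<^sub>u\<close>. On these balls \<open>f\<close> is controlled by the Poincare inequality and \<open>4 Q(f)\<close>, which dominates the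
  Dirichlet form; off these balls it is controlled by \<open>Q(f) \<ge> \<Sum> f\<^sup>2 / u\<close>. Hence \<open>Q(f) > E \<Sum> f\<^sup>2\<close> on a space
  whose codimension is the number of counted balls.

  Lower bound: no Harnack or Moser inequality is needed. Near a point where \<open>u\<close> is large, maximising
  \<open>\<surd>u + ln u - d/2\<close> produces a point \<open>z\<close> with \<open>u \<le> 4 u(z)\<close> on a ball of radius \<open>2r\<close>, \<open>r = max 1 (\<surd>u(z))\<close>,
  unless \<open>u\<close> is extremely large nearby. The truncation \<open>v\<^sub>t = (u - 4 u(z) d(z, _) / r - t)\<^sub>+\<close> is then supported in
  the ball of radius \<open>r\<close> and satisfies \<open>Q(v\<^sub>t) \<le> 2 \<Sum> v\<^sub>t + C u(z) |supp v\<^sub>t|\<close>. Combined with the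
  Faber-Krahn inequality, a De Giorgi iteration in the level \<open>t\<close> bounds \<open>\<Sum> v\<^sub>0\<close> from below, so \<open>v\<^sub>0\<close> has
  Rayleigh quotient at most \<open>C / u(z)\<close>. Such functions around well-separated points span a space on which
  \<open>Q \<le> E\<close>. When \<open>E > c\<^sup>* / \<kappa>\<^sup>4\<close> all balls are single points and point masses serve as test functions.
\<close>

text \<open>Since \<open>\<mu>\<close> and \<open>V\<close> are arbitrary, \<open>u\<close> is
  controlled from one side only. The equation \<open>H u = 1\<close> makes \<open>u\<close> a
  subsolution, but a large \<open>V\<close> can make it collapse from one vertex to the next, so a
  large value at a point does not by itself give mass near that point. This is why the lower bound
  rests on truncation energies. The subtracted term of the lower bound pays for places where the
  maximisation could escape. Points with \<open>u\<close> at least \<open>R1^2\<close> that lie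
  within \<open>12 * R2\<close> of a point with \<open>u\<close> at least \<open>R2^2\<close>, where
  \<open>R2 = R1 / \<kappa>\<close>, get no test function and are charged to balls of radius
  \<open>R2\<close>. A ball of radius comparable to \<open>R2\<close> meets at most a constant times
  \<open>\<kappa> powr (-\<alpha>)\<close> balls of radius \<open>R1\<close>, hence the factor
  \<open>\<kappa> powr \<alpha>\<close>. The energy threshold separates
  \<open>R2^2 \<ge> 1 / \<kappa>\<close>, where the Poincare inequality applies and
  \<open>ln (1 / \<kappa>)\<close> is at most \<open>2 * R2\<close>, from the regime in which both
  radii are below 1.\<close>

section \<open>Orthogonal diagonalization of real symmetric matrices\<close>

lemma symmetric_real_eigenvector:
  fixes A :: "real mat"
  assumes A: "A \<in> carrier_mat n n" and sym: "A\<^sup>T = A" and n: "n > 0"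
  shows "\<exists>v e. eigenvector A v e"
proof -
  let ?C = "map_mat complex_of_real A"
  have C: "?C \<in> carrier_mat n n" using A by auto
  have "degree (char_poly ?C) = n" using degree_monic_char_poly[OF C] by auto
  then have "\<exists>z. poly (char_poly ?C) z = 0"
    using n by (intro fundamental_theorem_of_algebra) (simp add: constant_degree)
  then obtain z where "poly (char_poly ?C) z = 0" by blast
  then have "eigenvalue ?C z" using eigenvalue_root_char_poly[OF C] by simp
  then obtain v where v: "v \<in> carrier_vec n" "v \<noteq> 0\<^sub>v n" "?C *\<^sub>v v = z \<cdot>\<^sub>v v"
    unfolding eigenvalue_def eigenvector_def using C by auto
  have sym': "A $$ (i,j) = A $$ (j,i)" if "i < n" "j < n" for i j
    using arg_cong[OF sym, of "\<lambda>M. M $$ (i,j)"] A that by auto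
  have ev: "(\<Sum>j<n. complex_of_real (A $$ (i,j)) * v $ j) = z * v $ i" if "i < n" for i
    using arg_cong[OF v(3), of "\<lambda>w. w $ i"] that A v(1)
    by (auto simp: scalar_prod_def lessThan_atLeast0)
  define S where "S = (\<Sum>i<n. cnj (v $ i) * v $ i)"
  \<comment> \<open>The Hermitian form of \<open>A\<close> at \<open>v\<close>, computed in two
    ways: symmetry moves \<open>A\<close> to the conjugated factor. As \<open>S\<close> turns out
    positive, \<open>z\<close> must be real.\<close>
  have "z * S = (\<Sum>i<n. cnj (v $ i) * (\<Sum>j<n. complex_of_real (A $$ (i,j)) * v $ j))"
    unfolding S_def sum_distrib_left[of z] by (intro sum.cong) (auto simp: ev mult.left_commute)
  also have "\<dots> = (\<Sum>i<n. \<Sum>j<n. cnj (v $ i) * (complex_of_real (A $$ (i,j)) * v $ j))"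
    by (simp add: sum_distrib_left)
  also have "\<dots> = (\<Sum>j<n. \<Sum>i<n. cnj (v $ i) * (complex_of_real (A $$ (i,j)) * v $ j))"
    by (rule sum.swap)
  also have "\<dots> = (\<Sum>j<n. v $ j * cnj (\<Sum>i<n. complex_of_real (A $$ (j,i)) * v $ i))"
    by (intro sum.cong) (auto simp: sum_distrib_left sym' intro!: sum.cong)
  also have "\<dots> = (\<Sum>j<n. v $ j * cnj (z * v $ j))"
    by (intro sum.cong) (auto simp: ev)
  also have "\<dots> = cnj z * S"
    unfolding S_def sum_distrib_left by (intro sum.cong) auto
  finally have zS: "z * S = cnj z * S" .
  have S: "S = of_real (\<Sum>i<n. (cmod (v $ i))^2)"
    unfolding S_def of_real_sum complex_norm_square by (simp add: mult.commute)
  obtain k where k: "k < n" "v $ k \<noteq> 0"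
    using v(1,2) by (metis carrier_vecD eq_vecI index_zero_vec(1) index_zero_vec(2))
  have "(\<Sum>i<n. (cmod (v $ i))^2) > 0"
    using k by (intro sum_pos2[of _ k]) auto
  then have "S \<noteq> 0" unfolding S using of_real_eq_0_iff less_irrefl by metis
  then have "z = cnj z" using zS by simp
  then have "Im z = 0" by (metis Reals_cnj_iff complex_is_Real_iff)
  then have z: "z = of_real (Re z)" by (simp add: complex_eq_iff)
  \<comment> \<open>The complex characteristic polynomial is the image of the real one, so the real
    root is a root over the reals and has a real eigenvector.\<close>
  have "poly (map_poly of_real (char_poly A)) (complex_of_real (Re z)) = 0"
    using \<open>poly (char_poly ?C) z = 0\<close> z
    by (metis of_real_hom.char_poly_hom[OF A])
  then have "poly (char_poly A) (Re z) = 0" by simp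
  then have "eigenvalue A (Re z)" using eigenvalue_root_char_poly[OF A] by simp
  then show ?thesis unfolding eigenvalue_def by blast
qed

text \<open>Gram-Schmidt leaves the first vector of a basis unchanged, so a basis completion of
  \<open>v\<close> becomes an orthogonal family that still starts with \<open>v\<close>.\<close>

lemma corthogonal_completion:
  fixes v :: "real vec"
  assumes v: "v \<in> carrier_vec n" "v \<noteq> 0\<^sub>v n"
  shows "\<exists>ws. set ws \<subseteq> carrier_vec n \<and> corthogonal ws \<and> length ws = n \<and> ws ! 0 = v"
proof -
  have n: "n > 0" using v by (cases n) auto
  interpret cof_vec_space n "TYPE(real)" .
  define b where "b = basis_completion v"
  note b = basis_completion[OF v, folded b_def]
  obtain vs where bv: "b = v # vs" using b(6,7) n by (cases b) simp_all
  note ws = gram_schmidt_result[OF b(2,4,5) refl]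
  have hd: "hd (gram_schmidt n b) = v" unfolding bv by (rule gram_schmidt_hd[OF v(1)])
  have len: "length (gram_schmidt n b) = n" using ws(4) b(6) by (rule trans)
  then have "gram_schmidt n b \<noteq> []" using n by (metis length_greater_0_conv)
  from hd_conv_nth[OF this] hd have "gram_schmidt n b ! 0 = v" by (rule trans[OF sym])
  with ws(2,3) len show ?thesis by blast
qed

text \<open>Obtained by normalizing an orthogonal completion. Only the direction of the first column
  matters later, so the scale \<open>c\<close> stays unspecified.\<close>

lemma orthonormal_completion:
  fixes v :: "real vec"
  assumes v: "v \<in> carrier_vec n" "v \<noteq> 0\<^sub>v n"
  shows "\<exists>W c. W \<in> carrier_mat n n \<and> W\<^sup>T * W = 1\<^sub>m n \<and> W * W\<^sup>T = 1\<^sub>m n \<and> col W 0 = c \<cdot>\<^sub>v v"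
proof -
  have n: "n > 0" using v by (cases n) auto
  obtain ws where ws: "set ws \<subseteq> carrier_vec n" "corthogonal ws" "length ws = n" and hdws: "ws ! 0 = v"
    using corthogonal_completion[OF v] by blast
  have wsc: "ws ! i \<in> carrier_vec n" if "i < n" for i using ws that by auto
  have orth: "(ws ! i \<bullet> ws ! j = 0) = (i \<noteq> j)" if "i < n" "j < n" for i j
    using corthogonalD[OF ws(2), of i j] ws(3) that wsc by auto
  define s where "s i = 1 / sqrt (ws ! i \<bullet> ws ! i)" for i
  define W where "W = mat_of_cols n (map (\<lambda>i. s i \<cdot>\<^sub>v (ws ! i)) [0..<n])"
  have W: "W \<in> carrier_mat n n" unfolding W_def
    using mat_of_cols_carrier(1)[of n "map (\<lambda>i. s i \<cdot>\<^sub>v (ws ! i)) [0..<n]"] by simp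
  have colW: "col W i = s i \<cdot>\<^sub>v (ws ! i)" if "i < n" for i
    unfolding W_def using that wsc by (subst col_mat_of_cols) auto
  have WW: "W\<^sup>T * W = 1\<^sub>m n"
  proof (rule eq_matI)
    fix i j assume "i < dim_row (1\<^sub>m n :: real mat)" "j < dim_col (1\<^sub>m n :: real mat)"
    then have ij: "i < n" "j < n" by auto
    have "(W\<^sup>T * W) $$ (i,j) = col W i \<bullet> col W j" using ij W by auto
    also have "\<dots> = s i * s j * (ws ! i \<bullet> ws ! j)"
      using colW ij scalar_prod_smult_distrib[of "s i \<cdot>\<^sub>v ws ! i" n "ws ! j" "s j"]
        smult_scalar_prod_distrib[of "ws ! i" n "ws ! j" "s i"] wsc[of i] wsc[of j] by auto
    also have "\<dots> = 1\<^sub>m n $$ (i,j)"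
    proof (cases "i = j")
      case True
      have "ws ! i \<bullet> ws ! i \<ge> 0" by (simp add: scalar_prod_def sum_nonneg)
      then show ?thesis using True orth ij by (simp add: s_def)
    qed (use orth ij in auto)
    finally show "(W\<^sup>T * W) $$ (i,j) = 1\<^sub>m n $$ (i,j)" .
  qed (use W in auto)
  have "W * W\<^sup>T = 1\<^sub>m n"
    using mat_mult_left_right_inverse[OF _ _ WW] W by auto
  moreover have "col W 0 = s 0 \<cdot>\<^sub>v v" using colW n hdws by auto
  ultimately show ?thesis using W WW by blast
qed

text \<open>Deflation: in an orthonormal basis starting with an eigenvector the first column is
  \<open>e\<close> times the first unit vector, symmetry clears the first row as well, and the
  induction hypothesis treats the remaining symmetric block.\<close>

lemma symmetric_diagonalization:
  fixes A :: "real mat"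
  assumes "A \<in> carrier_mat n n" and "A\<^sup>T = A"
  shows "\<exists>P d. P \<in> carrier_mat n n \<and> P\<^sup>T * P = 1\<^sub>m n \<and> P * P\<^sup>T = 1\<^sub>m n \<and>
     P\<^sup>T * A * P = mat n n (\<lambda>(i,j). if i = j then d i else 0)"
  using assms
proof (induction n arbitrary: A)
  case 0
  then show ?case by (intro exI[of _ "1\<^sub>m 0"] exI[of _ "\<lambda>_. 0"] conjI eq_matI) auto
next
  case (Suc n A)
  let ?n = "Suc n"
  obtain v e where ev: "eigenvector A v e"
    using symmetric_real_eigenvector[OF Suc.prems] by auto
  then have v: "v \<in> carrier_vec ?n" "v \<noteq> 0\<^sub>v ?n" "A *\<^sub>v v = e \<cdot>\<^sub>v v"
    using Suc.prems unfolding eigenvector_def by auto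
  obtain W c where W: "W \<in> carrier_mat ?n ?n" "W\<^sup>T * W = 1\<^sub>m ?n" "W * W\<^sup>T = 1\<^sub>m ?n"
    and c: "col W 0 = c \<cdot>\<^sub>v v"
    using orthonormal_completion[OF v(1,2)] by blast
  define B where "B = W\<^sup>T * A * W"
  have B: "B \<in> carrier_mat ?n ?n" unfolding B_def using W Suc.prems by auto
  have BT: "B\<^sup>T = B"
  proof -
    have "B\<^sup>T = W\<^sup>T * (W\<^sup>T * A)\<^sup>T" unfolding B_def using W Suc.prems
      by (subst transpose_mult[of _ ?n ?n _ ?n]) auto
    also have "(W\<^sup>T * A)\<^sup>T = A\<^sup>T * W" using W Suc.prems
      by (subst transpose_mult[of _ ?n ?n _ ?n]) auto
    finally show ?thesis unfolding B_def using W Suc.prems by (simp add: assoc_mult_mat[of _ ?n ?n _ ?n _ ?n])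
  qed
  have B0: "B $$ (i, 0) = (if i = 0 then e else 0)" if "i < ?n" for i
  proof -
    have "B $$ (i,0) = col W i \<bullet> (A *\<^sub>v col W 0)"
    proof -
      have "B = W\<^sup>T * (A * W)" unfolding B_def using W Suc.prems by (simp add: assoc_mult_mat[of _ ?n ?n _ ?n _ ?n])
      then have "B $$ (i,0) = row (W\<^sup>T) i \<bullet> col (A * W) 0" using W Suc.prems that by auto
      also have "col (A * W) 0 = A *\<^sub>v col W 0" using W Suc.prems by (intro col_mult2) auto
      finally show ?thesis using W that by auto
    qed
    also have "A *\<^sub>v col W 0 = e \<cdot>\<^sub>v col W 0"
      unfolding c using v Suc.prems by (simp add: mult_mat_vec smult_smult_assoc mult.commute)
    also have "col W i \<bullet> (e \<cdot>\<^sub>v col W 0) = e * (col W i \<bullet> col W 0)"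
      using W that by auto
    also have "col W i \<bullet> col W 0 = (W\<^sup>T * W) $$ (i, 0)" using W(1) that by auto
    finally show ?thesis using W(2) that by auto
  qed
  have B0': "B $$ (0, i) = (if i = 0 then e else 0)" if "i < ?n" for i
    using arg_cong[OF BT, of "\<lambda>M. M $$ (0,i)"] B0[OF that] B that by auto
  define A3 where "A3 = mat n n (\<lambda>(i,j). B $$ (Suc i, Suc j))"
  have A3: "A3 \<in> carrier_mat n n" unfolding A3_def by auto
  have "A3\<^sup>T = A3"
  proof (rule eq_matI)
    fix i j assume ij: "i < dim_row A3" "j < dim_col A3"
    show "A3\<^sup>T $$ (i,j) = A3 $$ (i,j)"
      using arg_cong[OF BT, of "\<lambda>M. M $$ (Suc i,Suc j)"] ij B unfolding A3_def by auto
  qed (use A3 in auto)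
  from Suc.IH[OF A3 this] obtain P d where P: "P \<in> carrier_mat n n" "P\<^sup>T * P = 1\<^sub>m n" "P * P\<^sup>T = 1\<^sub>m n"
    and d: "P\<^sup>T * A3 * P = mat n n (\<lambda>(i,j). if i = j then d i else 0)" by blast
  let ?E = "e \<cdot>\<^sub>m 1\<^sub>m 1 :: real mat"
  have blk: "B = four_block_mat ?E (0\<^sub>m 1 n) (0\<^sub>m n 1) A3"
    by (rule eq_matI) (use B B0 B0' in \<open>auto simp: A3_def\<close>)
  define R where "R = four_block_mat (1\<^sub>m 1) (0\<^sub>m 1 n) (0\<^sub>m n 1) P"
  have R: "R \<in> carrier_mat ?n ?n" unfolding R_def using P by auto
  have RT: "R\<^sup>T = four_block_mat (1\<^sub>m 1) (0\<^sub>m 1 n) (0\<^sub>m n 1) (P\<^sup>T)" unfolding R_def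
    by (subst transpose_four_block_mat[of _ 1 1 _ n _ n]) (use P in auto)
  have id: "four_block_mat (1\<^sub>m 1) (0\<^sub>m 1 n) (0\<^sub>m n 1) (1\<^sub>m n) = (1\<^sub>m ?n :: real mat)"
    by (rule eq_matI) auto
  have RTR: "R\<^sup>T * R = 1\<^sub>m ?n"
    unfolding RT unfolding R_def
    by (subst mult_four_block_mat[of _ 1 1 _ n _ n _ _ 1 _ n]) (use P id in auto)
  have RRT: "R * R\<^sup>T = 1\<^sub>m ?n"
    unfolding RT unfolding R_def
    by (subst mult_four_block_mat[of _ 1 1 _ n _ n _ _ 1 _ n]) (use P id in auto)
  have "R\<^sup>T * B = four_block_mat ?E (0\<^sub>m 1 n) (0\<^sub>m n 1) (P\<^sup>T * A3)"
    unfolding RT blk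
    by (subst mult_four_block_mat[of _ 1 1 _ n _ n _ _ 1 _ n]) (use P A3 in auto)
  then have "R\<^sup>T * B * R = four_block_mat ?E (0\<^sub>m 1 n) (0\<^sub>m n 1) (P\<^sup>T * A3 * P)"
    unfolding R_def
    by (simp, subst mult_four_block_mat[of _ 1 1 _ n _ n _ _ 1 _ n]) (use P A3 in auto)
  also have "\<dots> = mat ?n ?n (\<lambda>(i,j). if i = j then (if i = 0 then e else d (i - 1)) else 0)"
    unfolding d by (rule eq_matI) auto
  finally have fin: "R\<^sup>T * B * R = mat ?n ?n (\<lambda>(i,j). if i = j then (if i = 0 then e else d (i - 1)) else 0)" .
  have T: "(W * R)\<^sup>T = R\<^sup>T * W\<^sup>T" using W R by (intro transpose_mult) auto
  note assoc = assoc_mult_mat[of _ ?n ?n _ ?n _ ?n]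
  have "(W * R)\<^sup>T * (W * R) = R\<^sup>T * ((W\<^sup>T * W) * R)" unfolding T using W(1) R by (simp add: assoc)
  then have 1: "(W * R)\<^sup>T * (W * R) = 1\<^sub>m ?n" using W(2) R RTR by simp
  have "(W * R) * (W * R)\<^sup>T = W * ((R * R\<^sup>T) * W\<^sup>T)" unfolding T using W(1) R by (simp add: assoc)
  then have 2: "(W * R) * (W * R)\<^sup>T = 1\<^sub>m ?n" using W R RRT by simp
  have "(W * R)\<^sup>T * A * (W * R) = R\<^sup>T * B * R" unfolding T B_def using W(1) R Suc.prems(1) by (simp add: assoc)
  then have "(W * R)\<^sup>T * A * (W * R) = mat ?n ?n (\<lambda>(i,j). if i = j then (if i = 0 then e else d (i - 1)) else 0)"
    using fin by simp
  then show ?case using 1 2 W(1) R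
    by (intro exI[of _ "W * R"] exI[of _ "\<lambda>i. if i = 0 then e else d (i - 1)"]) auto
qed

section \<open>Counting eigenvalues by dimension\<close>

text \<open>Gaussian elimination, one equation per induction step. It supplies the dimension count
  for both eigenvalue bounds and the existence of the landscape function.\<close>

lemma nontrivial_kernel:
  fixes a :: "'j \<Rightarrow> 'i \<Rightarrow> real"
  assumes "finite J" "finite I" "card J < card I"
  shows "\<exists>x. (\<exists>i\<in>I. x i \<noteq> 0) \<and> (\<forall>j\<in>J. (\<Sum>i\<in>I. a j i * x i) = 0)"
  using assms
proof (induction J arbitrary: I a rule: finite_induct)
  case empty
  then have "I \<noteq> {}" by auto
  then show ?case by (intro exI[of _ "\<lambda>_. 1"]) auto
next
  case (insert j J)
  show ?case
  proof (cases "\<forall>i\<in>I. a j i = 0")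
    case True
    have "card J < card I" using insert by simp
    from insert.IH[OF insert.prems(1) this, of a] show ?thesis using True by auto
  next
    case False
    then obtain p where p: "p \<in> I" "a j p \<noteq> 0" by auto
    define I' where "I' = I - {p}"
    have I: "I = insert p I'" "p \<notin> I'" "finite I'" using p insert.prems unfolding I'_def by auto
    have "card J < card I'" using insert I by simp
    \<comment> \<open>These are the coefficients left in equation \<open>k\<close> after equation
      \<open>j\<close> has been solved for the pivot unknown \<open>p\<close>.\<close>
    from insert.IH[OF I(3) this, of "\<lambda>k i. a k i - a k p * a j i / a j p"]
    obtain x where x: "\<exists>i\<in>I'. x i \<noteq> 0"
      "\<And>k. k \<in> J \<Longrightarrow> (\<Sum>i\<in>I'. (a k i - a k p * a j i / a j p) * x i) = 0" by blast
    define y where "y = x(p := - (\<Sum>i\<in>I'. a j i * x i) / a j p)"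
    have y: "(\<Sum>i\<in>I'. b i * y i) = (\<Sum>i\<in>I'. b i * x i)" for b
      using I(2) unfolding y_def by (intro sum.cong) auto
    have yp: "y p = - (\<Sum>i\<in>I'. a j i * x i) / a j p" unfolding y_def by simp
    have "(\<Sum>i\<in>I. a k i * y i) = 0" if "k \<in> insert j J" for k
    proof (cases "k = j")
      case True
      then show ?thesis unfolding I(1) using I p by (simp add: y yp)
    next
      case False
      then have "(\<Sum>i\<in>I'. (a k i - a k p * a j i / a j p) * x i) = 0" using x(2) that by simp
      moreover have "(\<Sum>i\<in>I'. (a k i - a k p * a j i / a j p) * x i)
        = (\<Sum>i\<in>I'. a k i * x i) - a k p / a j p * (\<Sum>i\<in>I'. a j i * x i)"
        unfolding sum_distrib_left sum_subtractf[symmetric]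
        by (intro sum.cong) (auto simp: algebra_simps)
      ultimately show ?thesis unfolding I(1) using I p by (simp add: y yp)
    qed
    moreover have "\<exists>i\<in>I. y i \<noteq> 0" using x(1) I by (auto simp: y_def)
    ultimately show ?thesis by blast
  qed
qed

lemma order_prod_linear:
  fixes d :: "nat \<Rightarrow> real"
  shows "Polynomial.order t (\<Prod>i<n. [:- d i, 1:]) = card {i. i < n \<and> d i = t}"
proof (induction n)
  case 0
  then show ?case by (simp add: order_0I)
next
  case (Suc n)
  have nz: "(\<Prod>i<Suc n. [:- d i, 1:]) \<noteq> 0" by (subst prod_zero_iff) auto
  have "Polynomial.order t [:- d n, 1:] = (if d n = t then 1 else 0)"
    using order_power_n_n[of t 1] by (auto intro!: order_0I)
  moreover have "{i. i < Suc n \<and> d i = t} = (if d n = t then insert n {i. i < n \<and> d i = t} else {i. i < n \<and> d i = t})"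
    by (auto simp: less_Suc_eq)
  ultimately show ?case using Suc order_mult[of "\<Prod>i<n. [:- d i, 1:]" "[:- d n, 1:]" t] nz
    by simp
qed

text \<open>Grouping the indices by the value of \<open>d\<close> turns the multiplicity count in
  \<open>IDS\<close> into a count of diagonal entries.\<close>

lemma sum_order_prod_linear:
  fixes d :: "nat \<Rightarrow> real" and n :: nat
  defines "p \<equiv> (\<Prod>i<n. [:- d i, 1:])"
  shows "(\<Sum>t\<in>{t. poly p t = 0 \<and> t \<le> E}. Polynomial.order t p) = card {i. i < n \<and> d i \<le> E}"
proof -
  have roots: "{t. poly p t = 0 \<and> t \<le> E} = d ` {i. i < n \<and> d i \<le> E}"
    unfolding p_def poly_prod by auto
  have "card {i. i < n \<and> d i \<le> E} = (\<Sum>t\<in>d ` {i. i < n \<and> d i \<le> E}. card {i \<in> {i. i < n \<and> d i \<le> E}. d i = t})"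
    using sum.image_gen[of "{i. i < n \<and> d i \<le> E}" "\<lambda>_. 1::nat" d] by simp
  also have "\<dots> = (\<Sum>t\<in>d ` {i. i < n \<and> d i \<le> E}. Polynomial.order t p)"
    unfolding p_def order_prod_linear by (intro sum.cong arg_cong[of _ _ card]) auto
  finally show ?thesis unfolding roots by simp
qed

definition qform :: "('v \<Rightarrow> 'v \<Rightarrow> bool) \<Rightarrow> ('v \<Rightarrow> 'v \<Rightarrow> real) \<Rightarrow> ('v \<Rightarrow> real) \<Rightarrow> 'v set \<Rightarrow> ('v \<Rightarrow> real) \<Rightarrow> real"
  where "qform adj \<mu> V A f = (\<Sum>x\<in>A. f x * HA adj \<mu> V A f x)"

text \<open>All that is used of the matrix: an orthonormal eigenbasis on \<open>A\<close> in which
  both the norm and the quadratic form are diagonal. Everything afterwards works with functions on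
  \<open>A\<close>.\<close>

lemma spectral_resolution:
  fixes adj :: "'v \<Rightarrow> 'v \<Rightarrow> bool"
  assumes A: "finite A" and symadj: "\<And>x y. adj x y \<Longrightarrow> adj y x"
    and adm: "admissible adj \<mu> V"
  shows "\<exists>(d :: nat \<Rightarrow> real) (\<phi> :: nat \<Rightarrow> 'v \<Rightarrow> real).
     (\<forall>E. IDS adj \<mu> V A E = real (card {i. i < card A \<and> d i \<le> E}) / real (card A)) \<and>
     (\<forall>i<card A. \<forall>j<card A. (\<Sum>x\<in>A. \<phi> i x * \<phi> j x) = (if i = j then 1 else 0)) \<and>
     (\<forall>f. (\<Sum>x\<in>A. (f x)^2) = (\<Sum>i<card A. (\<Sum>x\<in>A. \<phi> i x * f x)^2)) \<and>
     (\<forall>f. qform adj \<mu> V A f = (\<Sum>i<card A. d i * (\<Sum>x\<in>A. \<phi> i x * f x)^2))"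
proof -
  define n where "n = card A"
  define e where "e = enum_set A"
  have "\<exists>e. bij_betw e {..<card A} A"
    using ex_bij_betw_nat_finite[OF A] by (simp add: lessThan_atLeast0)
  then have e: "bij_betw e {..<n} A" unfolding e_def enum_set_def n_def by (rule someI_ex)
  define M where "M = HA_mat adj \<mu> V A"
  have M: "M \<in> carrier_mat n n" unfolding M_def HA_mat_def n_def by simp
  have Mij: "M $$ (i,j) = (if e i = e j then real (gdeg adj (e i)) + V (e i) else 0) - (if adj (e i) (e j) then \<mu> (e i) (e j) else 0)"
    if "i < n" "j < n" for i j
    using that unfolding M_def HA_mat_def n_def e_def by (simp add: Let_def)
  have "M\<^sup>T = M"
    by (rule eq_matI) (use M Mij symadj adm in \<open>auto simp: admissible_def\<close>)
  from symmetric_diagonalization[OF M this] obtain P d where P: "P \<in> carrier_mat n n"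
    "P\<^sup>T * P = 1\<^sub>m n" "P * P\<^sup>T = 1\<^sub>m n"
    and d: "P\<^sup>T * M * P = mat n n (\<lambda>(i,j). if i = j then d i else 0)" by blast
  define D where "D = mat n n (\<lambda>(i,j). if i = j then d i else (0::real))"
  have D: "D \<in> carrier_mat n n" unfolding D_def by simp
  note assoc = assoc_mult_mat[of _ n n _ n _ n]
  have MPDP: "M = P * D * P\<^sup>T"
  proof -
    have "P * D * P\<^sup>T = (P * P\<^sup>T) * M * (P * P\<^sup>T)"
      unfolding D_def d[symmetric] using P(1) M by (simp add: assoc)
    then show ?thesis using P M by simp
  qed
  have "similar_mat M D"
    unfolding similar_mat_def
    by (rule exI[of _ P], rule exI[of _ "P\<^sup>T"], rule similar_mat_witI[of _ _ n])
       (use P M D MPDP in auto)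
  then have "char_poly M = char_poly D" by (rule char_poly_similar)
  also have "\<dots> = (\<Prod>a\<leftarrow>diag_mat D. [:- a, 1:])"
    by (rule char_poly_upper_triangular[OF D]) (auto simp: D_def)
  also have "\<dots> = (\<Prod>i<n. [:- d i, 1:])"
  proof -
    have "diag_mat D = map d [0..<n]" unfolding diag_mat_def D_def by auto
    then show ?thesis
      using prod.distinct_set_conv_list[of "[0..<n]" "\<lambda>i. [:- d i, 1:]"]
      by (simp add: lessThan_atLeast0 comp_def)
  qed
  finally have cp: "char_poly M = (\<Prod>i<n. [:- d i, 1:])" .
  have 1: "IDS adj \<mu> V A E = real (card {i. i < n \<and> d i \<le> E}) / real n" for E
    unfolding IDS_def Let_def M_def[symmetric] cp sum_order_prod_linear n_def ..
  \<comment> \<open>The columns of \<open>P\<close>, carried from indices to vertices along the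
    enumeration of \<open>A\<close>.\<close>
  define \<phi> where "\<phi> i x = P $$ (inv_into {..<n} e x, i)" for i x
  have phi: "\<phi> i (e a) = P $$ (a,i)" if "a < n" for a i
    unfolding \<phi>_def using bij_betw_inv_into_left[OF e] that by simp
  have re: "(\<Sum>x\<in>A. g x) = (\<Sum>a<n. g (e a))" for g :: "'v \<Rightarrow> real"
    using sum.reindex_bij_betw[OF e, of g] by simp
  have 2: "(\<Sum>x\<in>A. \<phi> i x * \<phi> j x) = (if i = j then 1 else 0)" if "i < n" "j < n" for i j
  proof -
    have "(\<Sum>x\<in>A. \<phi> i x * \<phi> j x) = (P\<^sup>T * P) $$ (i,j)"
      unfolding re using that P(1) by (auto simp: phi scalar_prod_def lessThan_atLeast0 intro!: sum.cong)
    then show ?thesis using P(2) that by simp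
  qed
  \<comment> \<open>Stated for arbitrary weights so that it serves twice: \<open>w = 1\<close> gives
    Parseval, \<open>w = d\<close> gives the quadratic form.\<close>
  have key: "(\<Sum>x\<in>A. \<Sum>y\<in>A. f x * f y * (\<Sum>i<n. \<phi> i x * w i * \<phi> i y)) = (\<Sum>i<n. w i * (\<Sum>x\<in>A. \<phi> i x * f x)^2)"
    for w :: "nat \<Rightarrow> real" and f
  proof -
    have "(\<Sum>i<n. w i * (\<Sum>x\<in>A. \<phi> i x * f x)^2) = (\<Sum>i<n. \<Sum>x\<in>A. \<Sum>y\<in>A. f x * f y * (\<phi> i x * w i * \<phi> i y))"
      by (intro sum.cong refl)
         (simp add: power2_eq_square sum_product sum_distrib_left mult.assoc mult.left_commute mult.commute)
    also have "\<dots> = (\<Sum>x\<in>A. \<Sum>i<n. \<Sum>y\<in>A. f x * f y * (\<phi> i x * w i * \<phi> i y))" by (rule sum.swap)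
    also have "\<dots> = (\<Sum>x\<in>A. \<Sum>y\<in>A. \<Sum>i<n. f x * f y * (\<phi> i x * w i * \<phi> i y))"
      by (intro sum.cong refl sum.swap)
    finally show ?thesis by (simp add: sum_distrib_left)
  qed
  have PP: "(\<Sum>i<n. \<phi> i x * 1 * \<phi> i y) = (if x = y then 1 else 0)" if xy: "x \<in> A" "y \<in> A" for x y
  proof -
    obtain a b where ab: "a < n" "b < n" "x = e a" "y = e b" using xy e unfolding bij_betw_def by auto
    have "(\<Sum>i<n. \<phi> i x * 1 * \<phi> i y) = (P * P\<^sup>T) $$ (a,b)"
      using ab P(1) by (auto simp: phi scalar_prod_def lessThan_atLeast0)
    then show ?thesis using P(3) ab e unfolding bij_betw_def inj_on_def by auto
  qed
  have PDP: "(\<Sum>i<n. \<phi> i x * d i * \<phi> i y) = (if x = y then real (gdeg adj x) + V x else 0) - (if adj x y then \<mu> x y else 0)"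
    if xy: "x \<in> A" "y \<in> A" for x y
  proof -
    obtain a b where ab: "a < n" "b < n" "x = e a" "y = e b" using xy e unfolding bij_betw_def by auto
    have PD: "(P * D) $$ (a,i) = P $$ (a,i) * d i" if "i < n" for i
      using ab P(1) that unfolding D_def by (auto simp: scalar_prod_def if_distrib cong: if_cong)
    have "(P * D * P\<^sup>T) $$ (a,b) = row (P * D) a \<bullet> col (P\<^sup>T) b"
      using ab P(1) D by (intro index_mult_mat(1)) auto
    also have "\<dots> = (\<Sum>i<n. (P * D) $$ (a,i) * P $$ (b,i))"
      unfolding scalar_prod_def using ab P(1) D
      by (intro sum.cong) (auto simp: lessThan_atLeast0)
    also have "\<dots> = (\<Sum>i<n. \<phi> i x * d i * \<phi> i y)"
      using ab by (intro sum.cong refl) (simp add: PD phi)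
    finally have "(\<Sum>i<n. \<phi> i x * d i * \<phi> i y) = (P * D * P\<^sup>T) $$ (a,b)" ..
    then show ?thesis using MPDP ab Mij by simp
  qed
  have 3: "(\<Sum>x\<in>A. (f x)^2) = (\<Sum>i<n. (\<Sum>x\<in>A. \<phi> i x * f x)^2)" for f
  proof -
    have "(\<Sum>x\<in>A. (f x)^2) = (\<Sum>x\<in>A. \<Sum>y\<in>A. f x * f y * (if x = y then 1 else 0))"
      using A by (simp add: power2_eq_square if_distrib cong: if_cong)
    also have "\<dots> = (\<Sum>x\<in>A. \<Sum>y\<in>A. f x * f y * (\<Sum>i<n. \<phi> i x * 1 * \<phi> i y))"
      by (intro sum.cong refl) (simp only: PP)
    finally show ?thesis unfolding key by simp
  qed
  have 4: "qform adj \<mu> V A f = (\<Sum>i<n. d i * (\<Sum>x\<in>A. \<phi> i x * f x)^2)" for f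
  proof -
    have "HA adj \<mu> V A f x = (\<Sum>y\<in>A. f y * ((if x = y then real (gdeg adj x) + V x else 0) - (if adj x y then \<mu> x y else 0)))"
      if x: "x \<in> A" for x
    proof -
      have "(\<Sum>y\<in>{y\<in>A. adj y x}. \<mu> x y * f y) = (\<Sum>y\<in>A. f y * (if adj x y then \<mu> x y else 0))"
        using A symadj by (subst sum.inter_filter[OF A]) (auto intro!: sum.cong)
      moreover have "(\<Sum>y\<in>A. f y * (if x = y then real (gdeg adj x) + V x else 0)) = f x * (real (gdeg adj x) + V x)"
        using x A by (simp add: if_distrib cong: if_cong)
      ultimately show ?thesis
        unfolding HA_def right_diff_distrib sum_subtractf by (simp add: algebra_simps)
    qed
    then have "qform adj \<mu> V A f = (\<Sum>x\<in>A. \<Sum>y\<in>A. f x * f y * (\<Sum>i<n. \<phi> i x * d i * \<phi> i y))"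
      unfolding qform_def
      by (intro sum.cong refl) (simp, subst sum_distrib_left, intro sum.cong refl, simp add: PDP)
    then show ?thesis unfolding key .
  qed
  show ?thesis using 1 2 3 4 unfolding n_def by blast
qed

text \<open>Courant-Fischer from above: if there were more eigenvalues up to \<open>E\<close> than
  constraints, a nonzero combination of their eigenfunctions would satisfy all constraints while
  having Rayleigh quotient at most \<open>E\<close>. Strictness in the last hypothesis matters
  because eigenvalues equal to \<open>E\<close> are counted.\<close>

lemma IDS_le_card:
  fixes adj :: "'v \<Rightarrow> 'v \<Rightarrow> bool" and a :: "'j \<Rightarrow> 'v \<Rightarrow> real"
  assumes A: "finite A" "A \<noteq> {}" and symadj: "\<And>x y. adj x y \<Longrightarrow> adj y x"
    and adm: "admissible adj \<mu> V" and J: "finite J"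
    and pos: "\<And>f. \<exists>x\<in>A. f x \<noteq> 0 \<Longrightarrow> (\<And>x. x \<notin> A \<Longrightarrow> f x = 0) \<Longrightarrow>
       (\<And>j. j \<in> J \<Longrightarrow> (\<Sum>x\<in>A. a j x * f x) = 0) \<Longrightarrow> qform adj \<mu> V A f > E * (\<Sum>x\<in>A. (f x)^2)"
  shows "IDS adj \<mu> V A E \<le> real (card J) / real (card A)"
proof -
  obtain d \<phi> where 1: "\<And>E. IDS adj \<mu> V A E = real (card {i. i < card A \<and> d i \<le> E}) / real (card A)"
    and 2: "\<And>i j. i < card A \<Longrightarrow> j < card A \<Longrightarrow> (\<Sum>x\<in>A. \<phi> i x * \<phi> j x) = (if i = j then 1 else 0)"
    and 3: "\<And>f. (\<Sum>x\<in>A. (f x)^2) = (\<Sum>i<card A. (\<Sum>x\<in>A. \<phi> i x * f x)^2)"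
    and 4: "\<And>f. qform adj \<mu> V A f = (\<Sum>i<card A. d i * (\<Sum>x\<in>A. \<phi> i x * f x)^2)"
    using spectral_resolution[OF A(1) symadj adm] by blast
  define n where "n = card A"
  define L where "L = {i. i < n \<and> d i \<le> E}"
  have L: "finite L" "L \<subseteq> {..<n}" unfolding L_def by auto
  have "card L \<le> card J"
  proof (rule ccontr)
    assume "\<not> card L \<le> card J"
    then have "card J < card L" by simp
    from nontrivial_kernel[OF J L(1) this, of "\<lambda>j i. \<Sum>x\<in>A. a j x * \<phi> i x"]
    obtain s where s: "\<exists>i\<in>L. s i \<noteq> 0" "\<And>j. j \<in> J \<Longrightarrow> (\<Sum>i\<in>L. (\<Sum>x\<in>A. a j x * \<phi> i x) * s i) = 0" by blast
    define f where "f x = (if x \<in> A then \<Sum>i\<in>L. s i * \<phi> i x else 0)" for x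
    have lin: "(\<Sum>x\<in>A. b x * f x) = (\<Sum>i\<in>L. (\<Sum>x\<in>A. b x * \<phi> i x) * s i)" for b
    proof -
      have "(\<Sum>x\<in>A. b x * f x) = (\<Sum>x\<in>A. \<Sum>i\<in>L. b x * \<phi> i x * s i)"
        unfolding f_def by (intro sum.cong) (auto simp: sum_distrib_left intro!: sum.cong)
      also have "\<dots> = (\<Sum>i\<in>L. \<Sum>x\<in>A. b x * \<phi> i x * s i)" by (rule sum.swap)
      finally show ?thesis by (simp add: sum_distrib_right)
    qed
    have c: "(\<Sum>x\<in>A. \<phi> j x * f x) = (if j \<in> L then s j else 0)" if "j < n" for j
    proof -
      have "(\<Sum>x\<in>A. \<phi> j x * f x) = (\<Sum>i\<in>L. (if j = i then 1 else 0) * s i)"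
        unfolding lin using L that 2 unfolding n_def by (intro sum.cong) auto
      also have "\<dots> = (if j \<in> L then s j else 0)"
        using L(1) by (simp add: if_distrib if_distribR cong: if_cong)
      finally show ?thesis .
    qed
    have f2: "(\<Sum>x\<in>A. (f x)^2) = (\<Sum>i\<in>L. (s i)^2)"
      unfolding 3 n_def[symmetric]
      by (rule sum.mono_neutral_cong_right) (use L in \<open>auto simp: c\<close>)
    have "qform adj \<mu> V A f = (\<Sum>i\<in>L. d i * (s i)^2)"
      unfolding 4 n_def[symmetric]
      by (rule sum.mono_neutral_cong_right) (use L in \<open>auto simp: c\<close>)
    also have "\<dots> \<le> (\<Sum>i\<in>L. E * (s i)^2)"
      by (intro sum_mono mult_right_mono) (auto simp: L_def)
    finally have "qform adj \<mu> V A f \<le> E * (\<Sum>x\<in>A. (f x)^2)"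
      unfolding f2 by (simp add: sum_distrib_left)
    moreover have "(\<Sum>i\<in>L. (s i)^2) > 0"
    proof -
      obtain i where "i \<in> L" "s i \<noteq> 0" using s(1) by auto
      then show ?thesis using L(1) by (intro sum_pos2[of _ i]) auto
    qed
    then have "\<exists>x\<in>A. f x \<noteq> 0" using f2 by (metis (mono_tags, lifting) less_irrefl sum.neutral zero_power2)
    ultimately show False using pos[of f] s(2) lin f_def by force
  qed
  then show ?thesis using 1 unfolding L_def n_def by (simp add: divide_right_mono)
qed

text \<open>Courant-Fischer from below: with fewer low eigenfunctions than trial functions, some
  nonzero combination of trial functions is orthogonal to all of them and has Rayleigh quotient
  above \<open>E\<close>. The first part of \<open>le\<close> is linear independence on
  \<open>A\<close>.\<close>

lemma card_le_IDS:
  fixes adj :: "'v \<Rightarrow> 'v \<Rightarrow> bool" and \<psi> :: "'t \<Rightarrow> 'v \<Rightarrow> real"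
  assumes A: "finite A" "A \<noteq> {}" and symadj: "\<And>x y. adj x y \<Longrightarrow> adj y x"
    and adm: "admissible adj \<mu> V" and T: "finite T"
    and le: "\<And>s. \<exists>t\<in>T. s t \<noteq> 0 \<Longrightarrow> \<exists>x\<in>A. (\<Sum>t\<in>T. s t * \<psi> t x) \<noteq> 0"
      "\<And>s. \<exists>t\<in>T. s t \<noteq> 0 \<Longrightarrow>
       qform adj \<mu> V A (\<lambda>x. \<Sum>t\<in>T. s t * \<psi> t x) \<le> E * (\<Sum>x\<in>A. (\<Sum>t\<in>T. s t * \<psi> t x)^2)"
  shows "real (card T) / real (card A) \<le> IDS adj \<mu> V A E"
proof -
  obtain d \<phi> where 1: "\<And>E. IDS adj \<mu> V A E = real (card {i. i < card A \<and> d i \<le> E}) / real (card A)"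
    and 3: "\<And>f. (\<Sum>x\<in>A. (f x)^2) = (\<Sum>i<card A. (\<Sum>x\<in>A. \<phi> i x * f x)^2)"
    and 4: "\<And>f. qform adj \<mu> V A f = (\<Sum>i<card A. d i * (\<Sum>x\<in>A. \<phi> i x * f x)^2)"
    using spectral_resolution[OF A(1) symadj adm] by blast
  define n where "n = card A"
  define L where "L = {i. i < n \<and> d i \<le> E}"
  have L: "finite L" "L \<subseteq> {..<n}" unfolding L_def by auto
  have "card T \<le> card L"
  proof (rule ccontr)
    assume "\<not> card T \<le> card L"
    then have "card L < card T" by simp
    from nontrivial_kernel[OF L(1) T this, of "\<lambda>i t. \<Sum>x\<in>A. \<phi> i x * \<psi> t x"]
    obtain s where s: "\<exists>t\<in>T. s t \<noteq> 0" "\<And>i. i \<in> L \<Longrightarrow> (\<Sum>t\<in>T. (\<Sum>x\<in>A. \<phi> i x * \<psi> t x) * s t) = 0" by blast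
    define f where "f x = (\<Sum>t\<in>T. s t * \<psi> t x)" for x
    define c where "c i = (\<Sum>x\<in>A. \<phi> i x * f x)" for i
    have c0: "c i = 0" if "i \<in> L" for i
    proof -
      have "c i = (\<Sum>x\<in>A. \<Sum>t\<in>T. \<phi> i x * \<psi> t x * s t)"
        unfolding f_def c_def by (intro sum.cong) (auto simp: sum_distrib_left intro!: sum.cong)
      also have "\<dots> = (\<Sum>t\<in>T. \<Sum>x\<in>A. \<phi> i x * \<psi> t x * s t)" by (rule sum.swap)
      finally show ?thesis using s(2)[OF that] by (simp add: sum_distrib_right)
    qed
    have "\<exists>x\<in>A. f x \<noteq> 0" using le(1)[OF s(1)] unfolding f_def .
    then obtain x where x: "x \<in> A" "f x \<noteq> 0" by blast
    then have "(\<Sum>x\<in>A. (f x)^2) > 0" using A by (intro sum_pos2[of _ x]) auto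
    then have "\<exists>i<n. c i \<noteq> 0"
      unfolding 3 n_def c_def[symmetric] by (metis (mono_tags, lifting) lessThan_iff less_irrefl sum.neutral zero_power2)
    then obtain k where k: "k < n" "c k \<noteq> 0" by blast
    have "E * (\<Sum>x\<in>A. (f x)^2) = (\<Sum>i<n. E * (c i)^2)" unfolding 3 n_def c_def sum_distrib_left ..
    \<comment> \<open>On \<open>L\<close> the coefficients vanish and off \<open>L\<close> the
      eigenvalues exceed \<open>E\<close>; the nonzero coefficient \<open>c k\<close> makes the
      inequality strict.\<close>
    also have "\<dots> < (\<Sum>i<n. d i * (c i)^2)"
    proof (rule sum_strict_mono_ex1)
      show "\<forall>i\<in>{..<n}. E * (c i)^2 \<le> d i * (c i)^2"
      proof
        fix i assume "i \<in> {..<n}"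
        then show "E * (c i)^2 \<le> d i * (c i)^2"
          using c0[of i] by (cases "i \<in> L") (auto simp: L_def intro!: mult_right_mono)
      qed
      have "E * (c k)^2 < d k * (c k)^2" using c0[of k] k by (cases "k \<in> L") (auto simp: L_def)
      then show "\<exists>i\<in>{..<n}. E * (c i)^2 < d i * (c i)^2" using k by blast
    qed simp
    also have "\<dots> = qform adj \<mu> V A f" unfolding 4 n_def c_def ..
    finally show False using le(2)[OF s(1)] unfolding f_def by simp
  qed
  then show ?thesis using 1 unfolding L_def n_def by (simp add: divide_right_mono)
qed

section \<open>Balls, coverings and the Faber-Krahn inequality\<close>

lemma sum_squared_le_card:
  fixes f :: "'a \<Rightarrow> real"
  assumes "finite A"
  shows "(\<Sum>x\<in>A. f x)^2 \<le> card A * (\<Sum>x\<in>A. (f x)^2)"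
proof -
  define S where "S = (\<Sum>x\<in>A. f x)"
  have "0 \<le> (\<Sum>x\<in>A. (card A * f x - S)^2)" by (intro sum_nonneg) simp
  also have "\<dots> = (\<Sum>x\<in>A. (card A)^2 * (f x)^2 - 2 * card A * S * f x + S^2)"
    by (intro sum.cong refl) (simp add: power2_eq_square algebra_simps)
  also have "\<dots> = (card A)^2 * (\<Sum>x\<in>A. (f x)^2) - 2 * card A * S * S + card A * S^2"
    by (simp add: sum.distrib sum_subtractf sum_distrib_left[symmetric] S_def[symmetric])
  also have "\<dots> = card A * (card A * (\<Sum>x\<in>A. (f x)^2) - S^2)"
    by (simp add: power2_eq_square algebra_simps)
  finally have *: "0 \<le> card A * (card A * (\<Sum>x\<in>A. (f x)^2) - S^2)" .
  show ?thesis
  proof (cases "card A = 0")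
    case True
    then show ?thesis using assms by simp
  next
    case False
    then show ?thesis using * unfolding S_def by (simp add: zero_le_mult_iff)
  qed
qed

text \<open>Double counting of pairs of an index \<open>B\<close> and a point of \<open>S B\<close>.
  The map \<open>S\<close> allows the index to be a ball itself or a centre that carries a smaller
  ball.\<close>

lemma card_packing:
  fixes Z :: "'a set" and m :: real
  assumes F: "finite F" and Z: "finite Z" and ov: "\<And>y. y \<in> Z \<Longrightarrow> card {B\<in>F. y \<in> S B} \<le> b"
    and sub: "\<And>B. B \<in> F \<Longrightarrow> S B \<subseteq> Z" and m: "\<And>B. B \<in> F \<Longrightarrow> m \<le> card (S B)"
  shows "real (card F) * m \<le> real b * real (card Z)"
proof -
  have "real (card F) * m \<le> (\<Sum>B\<in>F. real (card (S B)))" using sum_bounded_below[of F m] m by simp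
  also have "\<dots> = (\<Sum>B\<in>F. \<Sum>y\<in>Z. if y \<in> S B then 1 else 0)"
  proof (intro sum.cong refl)
    fix B assume "B \<in> F"
    then have "Z \<inter> S B = S B" using sub by auto
    then show "real (card (S B)) = (\<Sum>y\<in>Z. if y \<in> S B then 1 else 0)"
      using Z by (simp add: sum.If_cases)
  qed
  also have "\<dots> = (\<Sum>y\<in>Z. \<Sum>B\<in>F. if y \<in> S B then 1 else 0)" by (rule sum.swap)
  also have "\<dots> = (\<Sum>y\<in>Z. real (card {B\<in>F. y \<in> S B}))"
    using F by (simp add: sum.inter_filter[symmetric])
  also have "\<dots> \<le> (\<Sum>y\<in>Z. real b)" using ov by (intro sum_mono) simp
  finally show ?thesis by (simp add: mult.commute)
qed

lemma sum_le_sum_cover: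
  fixes g :: "'a \<Rightarrow> real"
  assumes "finite F" "\<And>B. B \<in> F \<Longrightarrow> finite B" "\<Omega> \<subseteq> \<Union>F" and g: "\<And>x. g x \<ge> 0"
  shows "(\<Sum>x\<in>\<Omega>. g x) \<le> (\<Sum>B\<in>F. \<Sum>x\<in>B. g x)"
proof -
  have "(\<Sum>x\<in>\<Union>F. g x) \<le> (\<Sum>B\<in>F. \<Sum>x\<in>B. g x)"
    using assms(1,2)
  proof (induction F rule: finite_induct)
    case (insert B F)
    then have "(\<Sum>x\<in>\<Union>(insert B F). g x) \<le> (\<Sum>x\<in>B. g x) + (\<Sum>x\<in>\<Union>F. g x)"
      using sum_Un[of B "\<Union>F" g] sum_nonneg[of "B \<inter> \<Union>F" g] g by auto
    also have "(\<Sum>x\<in>\<Union>F. g x) \<le> (\<Sum>B\<in>F. \<Sum>x\<in>B. g x)" using insert by auto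
    finally show ?case using insert by simp
  qed simp
  moreover have "(\<Sum>x\<in>\<Omega>. g x) \<le> (\<Sum>x\<in>\<Union>F. g x)"
    using assms by (intro sum_mono2) auto
  ultimately show ?thesis by linarith
qed

section \<open>Metric geometry and coverings of Ahlfors regular graphs\<close>

locale ahlfors_graph =
  fixes adj :: "'v \<Rightarrow> 'v \<Rightarrow> bool" and \<alpha> CL CU :: real
  assumes graph: "infinite_connected_simple_graph adj"
    and vol: "volume_control adj \<alpha> CL CU"
begin

abbreviation dst :: "'v \<Rightarrow> 'v \<Rightarrow> nat" where "dst \<equiv> graph_dist adj"
abbreviation ball :: "'v \<Rightarrow> real \<Rightarrow> 'v set" where "ball \<equiv> gball adj"

lemma infinite_vertices: "infinite (UNIV :: 'v set)"
  and adj_sym: "adj x y \<Longrightarrow> adj y x"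
  and adj_irrefl: "\<not> adj x x"
  and connected: "\<exists>n. (adj ^^ n) x y"
  using graph unfolding infinite_connected_simple_graph_def by auto

lemma alpha_ge_1: "\<alpha> \<ge> 1" and CL_pos: "CL > 0" and CU_pos: "CU > 0"
  and card_ball_ge: "r \<ge> 1 \<Longrightarrow> CL * r powr \<alpha> \<le> card (ball x r)"
  and card_ball_le: "r \<ge> 1 \<Longrightarrow> card (ball x r) \<le> CU * r powr \<alpha>"
  using vol unfolding volume_control_def by auto

lemma dst_path: "(adj ^^ dst x y) x y"
  unfolding graph_dist_def using connected by (rule LeastI_ex)

lemma dst_le: "(adj ^^ n) x y \<Longrightarrow> dst x y \<le> n"
  unfolding graph_dist_def by (rule Least_le)

lemma dst_self [simp]: "dst x x = 0"
  using dst_le[OF relpowp_0_I] by simp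

lemma dst_eq_0: "dst x y = 0 \<longleftrightarrow> x = y"
  using dst_path[of x y] by (metis dst_self relpowp_0_E)

lemma dst_triangle: "dst x z \<le> dst x y + dst y z"
  by (rule dst_le[OF relpowp_trans[OF dst_path dst_path]])

lemma relpowp_adj_sym: "(adj ^^ n) x y \<Longrightarrow> (adj ^^ n) y x"
proof (induction n arbitrary: y)
  case (Suc n)
  then show ?case by (metis adj_sym relpowp_Suc_E relpowp_Suc_I2)
qed simp

lemma dst_sym: "dst x y = dst y x"
  by (meson dst_path dst_le relpowp_adj_sym le_antisym)

lemma dst_adj: "adj x y \<Longrightarrow> dst x y \<le> 1"
  by (rule dst_le) (simp only: relpowp_1)

lemma mem_ball: "y \<in> ball x r \<longleftrightarrow> real (dst x y) \<le> r"
  unfolding gball_def by simp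

lemma center_mem_ball: "r \<ge> 0 \<Longrightarrow> x \<in> ball x r"
  by (simp add: mem_ball)

text \<open>An infinite set has \<open>card\<close> 0, which the positive lower volume bound
  excludes at radius at least 1; smaller balls are subsets.\<close>

lemma finite_ball: "finite (ball x r)"
proof -
  have "card (ball x (max 1 r)) > 0"
    using card_ball_ge[of "max 1 r" x] CL_pos
    by (smt (verit) max.cobounded1 mult_pos_pos of_nat_0_less_iff powr_gt_zero)
  then have "finite (ball x (max 1 r))" using card_gt_0_iff by blast
  then show ?thesis by (rule rev_finite_subset) (auto simp: mem_ball)
qed

lemma ball_lt_1: "0 \<le> r \<Longrightarrow> r < 1 \<Longrightarrow> ball x r = {x}"
  by (auto simp: mem_ball) (metis dst_eq_0 less_one of_nat_1 of_nat_less_iff order.strict_trans1)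

lemma neighbors_subset_ball: "{y. adj x y} \<subseteq> ball x 1"
  using dst_adj by (auto simp: mem_ball simp del: One_nat_def)

lemma finite_neighbors: "finite {y. adj x y}"
  using neighbors_subset_ball finite_ball by (rule finite_subset)

lemma card_ball_1_le: "card (ball x 1) \<le> CU"
  using card_ball_le[of 1 x] by simp

lemma gdeg_le: "real (gdeg adj x) + 1 \<le> CU"
proof -
  have "insert x {y. adj x y} \<subseteq> ball x 1"
    using neighbors_subset_ball by (auto intro: center_mem_ball)
  then have "card (insert x {y. adj x y}) \<le> card (ball x 1)"
    by (intro card_mono finite_ball)
  then show ?thesis
    unfolding gdeg_def using card_ball_1_le[of x] finite_neighbors adj_irrefl by simp
qed

lemma gdeg_ge_1: "gdeg adj x \<ge> 1"
proof -
  have "finite {x}" by simp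
  then obtain y where "y \<noteq> x" using infinite_vertices by (metis ex_new_if_finite singletonI)
  then obtain n where n: "dst x y = Suc n" by (metis dst_eq_0 old.nat.exhaust)
  with dst_path[of x y] have "(adj ^^ Suc n) x y" by simp
  then obtain z where "adj x z" by (metis relpowp_Suc_E2)
  then have "{y. adj x y} \<noteq> {}" by auto
  then show ?thesis unfolding gdeg_def using finite_neighbors by (simp add: Suc_le_eq card_gt_0_iff)
qed

lemma CU_ge_1: "CU \<ge> 1"
  using gdeg_le[of undefined] by simp

text \<open>Capping at 1 extends the lower volume bound to radii below 1, where a ball has at least
  one point and \<open>r powr \<alpha>\<close> is at most 1.\<close>

definition c0 :: real where "c0 = min 1 CL"

lemma c0_pos: "c0 > 0" unfolding c0_def using CL_pos by simp

lemma card_ball_ge_min: "r > 0 \<Longrightarrow> c0 * r powr \<alpha> \<le> card (ball x r)"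
proof (cases "r \<ge> 1")
  case True
  then show ?thesis using card_ball_ge[OF True, of x] unfolding c0_def
    by (smt (verit, best) mult_right_mono powr_ge_zero)
next
  case False
  assume r: "r > 0"
  have "r powr \<alpha> \<le> 1" using False r alpha_ge_1 powr_mono2[of \<alpha> r 1] by simp
  then have "c0 * r powr \<alpha> \<le> 1" unfolding c0_def using CL_pos r
    by (metis min.cobounded1 mult_le_one powr_ge_zero)
  also have "1 \<le> real (card (ball x r))"
    using center_mem_ball[of r x] finite_ball[of x r] r by (simp add: Suc_le_eq card_gt_0_iff) blast
  finally show ?thesis .
qed

text \<open>A separated set that is maximal by Zorn also covers, since an uncovered point could be
  added. The \<open>max 0 R\<close> keeps each centre in its own ball when \<open>R\<close> is
  negative.\<close>

lemma maximal_separated_set: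
  fixes R :: real
  shows "\<exists>T\<subseteq>X. (\<forall>x\<in>T. \<forall>y\<in>T. x \<noteq> y \<longrightarrow> real (dst x y) > R) \<and> X \<subseteq> (\<Union>x\<in>T. ball x (max 0 R))"
proof -
  define \<A> where "\<A> = {T. T \<subseteq> X \<and> (\<forall>x\<in>T. \<forall>y\<in>T. x \<noteq> y \<longrightarrow> real (dst x y) > R)}"
  have "\<exists>M\<in>\<A>. \<forall>Y\<in>\<A>. M \<subseteq> Y \<longrightarrow> Y = M"
  proof (rule subset_Zorn')
    fix C assume C: "subset.chain \<A> C"
    have "real (dst x y) > R" if "T1 \<in> C" "T2 \<in> C" "x \<in> T1" "y \<in> T2" "x \<noteq> y" for T1 T2 x y
    proof -
      have "T1 \<subseteq> T2 \<or> T2 \<subseteq> T1" using C that by (auto simp: subset.chain_def)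
      moreover have "T1 \<in> \<A>" "T2 \<in> \<A>" using C that by (auto simp: subset.chain_def)
      ultimately show ?thesis using that unfolding \<A>_def by auto
    qed
    moreover have "\<Union>C \<subseteq> X" using C by (auto simp: subset.chain_def \<A>_def)
    ultimately show "\<Union>C \<in> \<A>" unfolding \<A>_def by auto
  qed
  then obtain M where M: "M \<in> \<A>" "\<And>Y. Y \<in> \<A> \<Longrightarrow> M \<subseteq> Y \<Longrightarrow> Y = M" by blast
  have "X \<subseteq> (\<Union>x\<in>M. ball x (max 0 R))"
  proof
    fix y assume y: "y \<in> X"
    show "y \<in> (\<Union>x\<in>M. ball x (max 0 R))"
    proof (rule ccontr)
      assume "y \<notin> (\<Union>x\<in>M. ball x (max 0 R))"
      then have far: "real (dst x y) > max 0 R" if "x \<in> M" for x using that by (auto simp: mem_ball)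
      then have "insert y M \<in> \<A>" using M(1) y dst_sym unfolding \<A>_def by auto
      then have "y \<in> M" using M(2)[of "insert y M"] by auto
      then show False using far[of y] by simp
    qed
  qed
  then show ?thesis using M(1) unfolding \<A>_def by blast
qed

text \<open>Balls around a maximal \<open>R\<close>-separated set cover. For centres within
  \<open>R\<close> of a point \<open>y\<close>, the balls of radius \<open>R/2\<close> are disjoint
  and contained in the ball of radius \<open>2*R\<close> around \<open>y\<close>, so volume bounds
  their number independently of \<open>R\<close>.\<close>

lemma covering_exists: "\<exists>b. \<forall>R>0. \<exists>P. is_covering adj P R b"
proof -
  \<comment> \<open>The ratio of the volume bounds at radii \<open>2*R\<close> and
    \<open>R/2\<close>. It is at least 1, which is what coverings by single points require.\<close>
  define b where "b = nat \<lceil>CU * 4 powr \<alpha> / c0\<rceil>"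
  have "CU * 4 powr \<alpha> / c0 \<ge> 1"
  proof -
    have "c0 * 1 \<le> CU * 4 powr \<alpha>"
      by (intro mult_mono) (use CU_ge_1 c0_pos alpha_ge_1 in \<open>auto simp: c0_def intro!: ge_one_powr_ge_zero\<close>)
    then show ?thesis using c0_pos by simp
  qed
  then have b: "real b \<ge> CU * 4 powr \<alpha> / c0" "b \<ge> 1" unfolding b_def by linarith+
  have "\<exists>P. is_covering adj P R b" if R: "R > 0" for R
  proof -
    obtain T where T: "\<And>x y. x \<in> T \<Longrightarrow> y \<in> T \<Longrightarrow> x \<noteq> y \<Longrightarrow> real (dst x y) > R"
      "UNIV \<subseteq> (\<Union>x\<in>T. ball x R)"
      using maximal_separated_set[of UNIV R] R by (auto simp: max_def)
    have "finite {B \<in> (\<lambda>z. ball z R) ` T. y \<in> B} \<and> card {B \<in> (\<lambda>z. ball z R) ` T. y \<in> B} \<le> b" for y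
    proof -
      define F where "F = {z\<in>T. y \<in> ball z R}"
      \<comment> \<open>Centres are counted in place of balls; distinct centres may give equal
        balls, which only lowers the overlap.\<close>
      have "F \<subseteq> ball y R" unfolding F_def by (auto simp: mem_ball dst_sym)
      then have finF: "finite F" using finite_ball finite_subset by blast
      have img: "{B \<in> (\<lambda>z. ball z R) ` T. y \<in> B} = (\<lambda>z. ball z R) ` F" unfolding F_def by auto
      have "card F \<le> b"
      proof (cases "R \<ge> 1")
        case True
        have "real (card F) * (c0 * (R/2) powr \<alpha>) \<le> real 1 * real (card (ball y (2*R)))"
        proof (rule card_packing[OF finF finite_ball, where S = "\<lambda>z. ball z (R/2)"])
          fix x
          have "z = z'" if z: "z \<in> T" "z' \<in> T" "x \<in> ball z (R/2)" "x \<in> ball z' (R/2)" for z z'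
            using T(1)[of z z'] dst_triangle[of z z' x] z by (auto simp: mem_ball dst_sym)
          then have "\<forall>z\<in>{z\<in>F. x \<in> ball z (R/2)}. \<forall>z'\<in>{z\<in>F. x \<in> ball z (R/2)}. z = z'"
            unfolding F_def by blast
          then show "card {z\<in>F. x \<in> ball z (R/2)} \<le> 1"
            using finF by (simp add: card_le_Suc0_iff_eq)
        next
          fix z assume "z \<in> F"
          then have "y \<in> ball z R" unfolding F_def by simp
          then show "ball z (R/2) \<subseteq> ball y (2*R)"
            using R dst_triangle[of y _ z] by (auto simp: mem_ball dst_sym) (smt (verit) field_sum_of_halves of_nat_add of_nat_mono)
          show "c0 * (R/2) powr \<alpha> \<le> card (ball z (R/2))" using R by (intro card_ball_ge_min) auto
        qed
        also have "\<dots> \<le> CU * (2*R) powr \<alpha>" using card_ball_le[of "2*R" y] True by simp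
        also have "(2*R) powr \<alpha> = 4 powr \<alpha> * (R/2) powr \<alpha>"
          using R by (subst powr_mult[symmetric]) auto
        finally have "real (card F) * c0 * (R/2) powr \<alpha> \<le> CU * 4 powr \<alpha> * (R/2) powr \<alpha>" by (simp add: mult_ac)
        moreover have "(R/2) powr \<alpha> > 0" using R by simp
        ultimately have "real (card F) * c0 \<le> CU * 4 powr \<alpha>" using mult_right_le_imp_le by blast
        then have "real (card F) \<le> CU * 4 powr \<alpha> / c0" using c0_pos by (simp add: pos_le_divide_eq)
        then show ?thesis using b by linarith
      next
        case False
        then have "F \<subseteq> {y}" using R unfolding F_def by (auto simp: ball_lt_1)
        then have "card F \<le> card {y}" by (intro card_mono) auto
        then show ?thesis using b by simp
      qed
      then show ?thesis unfolding img using finF card_image_le[OF finF, of "\<lambda>z. ball z R"] by auto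
    qed
    then have "is_covering adj ((\<lambda>z. ball z R) ` T) R b"
      unfolding is_covering_def using T(2) by auto
    then show ?thesis by blast
  qed
  then show ?thesis by blast
qed

lemma covering_locally_finite:
  assumes P: "is_covering adj P R b" and Z: "finite Z"
  shows "finite {B\<in>P. B \<inter> Z \<noteq> {}}"
proof -
  have "{B\<in>P. B \<inter> Z \<noteq> {}} = (\<Union>y\<in>Z. {B\<in>P. y \<in> B})" by auto
  then show ?thesis using P Z unfolding is_covering_def by auto
qed

text \<open>Each such ball lies in the ball of radius \<open>3 * \<rho>\<close> and contains at
  least \<open>c0 * R powr \<alpha>\<close> points, and at most \<open>b\<close> of them share a
  point.\<close>

lemma covering_card_meeting_ball:
  assumes P: "is_covering adj P R b" and R: "0 < R" "R \<le> \<rho>" "1 \<le> \<rho>"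
  shows "card {B\<in>P. B \<inter> ball x \<rho> \<noteq> {}} \<le> b * CU * 3 powr \<alpha> / c0 * (\<rho> / R) powr \<alpha>"
proof -
  let ?F = "{B\<in>P. B \<inter> ball x \<rho> \<noteq> {}}"
  have "real (card ?F) * (c0 * R powr \<alpha>) \<le> real b * real (card (ball x (3 * \<rho>)))"
  proof (rule card_packing[OF covering_locally_finite[OF P finite_ball] finite_ball, where S = "\<lambda>B. B"])
    fix y
    have "card {B\<in>?F. y \<in> B} \<le> card {B\<in>P. y \<in> B}"
      using P by (intro card_mono) (auto simp: is_covering_def)
    also have "\<dots> \<le> b" using P by (simp add: is_covering_def)
    finally show "card {B\<in>?F. y \<in> B} \<le> b" .
  next
    fix B assume B: "B \<in> ?F"
    then obtain z where z: "B = ball z R" using P unfolding is_covering_def by blast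
    show "c0 * R powr \<alpha> \<le> card B" unfolding z using R by (intro card_ball_ge_min)
    obtain w where w: "dst z w \<le> R" "dst x w \<le> \<rho>" using B z by (auto simp: mem_ball)
    show "B \<subseteq> ball x (3 * \<rho>)"
    proof
      fix y assume "y \<in> B"
      then have "dst z y \<le> R" unfolding z by (simp add: mem_ball)
      then show "y \<in> ball x (3 * \<rho>)"
        using w R dst_triangle[of x y w] dst_triangle[of w y z] by (simp add: mem_ball dst_sym[of w z])
    qed
  qed
  also have "\<dots> \<le> b * (CU * (3 * \<rho>) powr \<alpha>)"
    using card_ball_le[of "3 * \<rho>" x] R by (intro mult_left_mono) auto
  finally have "card ?F \<le> b * (CU * (3 * \<rho>) powr \<alpha>) / (c0 * R powr \<alpha>)"
    using c0_pos R by (simp add: pos_le_divide_eq)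
  also have "\<dots> = b * CU * 3 powr \<alpha> / c0 * (\<rho> / R) powr \<alpha>"
    using R by (simp add: powr_mult powr_divide)
  finally show ?thesis .
qed

text \<open>The sum runs over ordered pairs, so each edge inside \<open>U\<close> counts twice,
  matching the right-hand side of the Poincare inequality.\<close>

definition dir :: "'v set \<Rightarrow> ('v \<Rightarrow> real) \<Rightarrow> real" where
  "dir U f = (\<Sum>x\<in>U. \<Sum>y\<in>U. if adj x y then (f x - f y)^2 else 0)"

lemma sum_adjacent_pairs:
  fixes g :: "'v \<Rightarrow> 'v \<Rightarrow> real"
  assumes "finite U"
  shows "(\<Sum>(y,z)\<in>{(y,z). y \<in> U \<and> z \<in> U \<and> adj y z}. g y z) = (\<Sum>y\<in>U. \<Sum>z\<in>U. if adj y z then g y z else 0)"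
proof -
  have "(\<Sum>y\<in>U. \<Sum>z\<in>U. if adj y z then g y z else 0) = (\<Sum>p\<in>U\<times>U. if adj (fst p) (snd p) then g (fst p) (snd p) else 0)"
    by (simp add: sum.cartesian_product case_prod_unfold)
  also have "\<dots> = (\<Sum>p\<in>{p\<in>U\<times>U. adj (fst p) (snd p)}. g (fst p) (snd p))"
    using assms by (subst sum.inter_filter) auto
  also have "{p\<in>U\<times>U. adj (fst p) (snd p)} = {(y,z). y \<in> U \<and> z \<in> U \<and> adj y z}" by auto
  finally show ?thesis by (simp add: case_prod_unfold)
qed

text \<open>Dilated balls still overlap boundedly: if \<open>x\<close> lies in the dilation of
  \<open>B\<close>, then \<open>B\<close> meets the ball of radius \<open>lam * R\<close> around
  \<open>x\<close>, and such \<open>B\<close> have been counted. Summing local energies therefore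
  costs a constant factor.\<close>

lemma sum_dir_dilated_balls:
  assumes P: "is_covering adj P R b" and R: "R \<ge> 1" and lam: "lam \<ge> 1" and F: "finite F" "F \<subseteq> P"
    and ctr: "\<And>B. B \<in> F \<Longrightarrow> B = ball (ctr B) R" and D: "\<And>U. finite U \<Longrightarrow> dir U f \<le> D"
  shows "(\<Sum>B\<in>F. dir (ball (ctr B) (lam * R)) f) \<le> b * CU * 3 powr \<alpha> / c0 * lam powr \<alpha> * D"
proof -
  let ?K = "b * CU * 3 powr \<alpha> / c0 * lam powr \<alpha>"
  define Bs where "Bs B = ball (ctr B) (lam * R)" for B
  define U where "U = (\<Union>B\<in>F. Bs B)"
  have U: "finite U" unfolding U_def Bs_def using F finite_ball by auto
  define w where "w x y = (if adj x y then (f x - f y)^2 else 0)" for x y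
  have w0: "w x y \<ge> 0" for x y unfolding w_def by simp
  have ov: "real (card {B\<in>F. x \<in> Bs B}) \<le> ?K" for x
  proof -
    have "{B\<in>F. x \<in> Bs B} \<subseteq> {B\<in>P. B \<inter> ball x (lam * R) \<noteq> {}}"
    proof
      fix B assume B: "B \<in> {B\<in>F. x \<in> Bs B}"
      then have "ctr B \<in> B" using ctr[of B] center_mem_ball[of R "ctr B"] R by auto
      moreover have "ctr B \<in> ball x (lam * R)" using B by (simp add: Bs_def mem_ball dst_sym)
      ultimately show "B \<in> {B\<in>P. B \<inter> ball x (lam * R) \<noteq> {}}" using B F by auto
    qed
    then have "card {B\<in>F. x \<in> Bs B} \<le> card {B\<in>P. B \<inter> ball x (lam * R) \<noteq> {}}"
      by (intro card_mono covering_locally_finite[OF P finite_ball])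
    moreover have "R \<le> lam * R" using R lam mult_right_mono[of 1 lam R] by simp
    moreover from this have "1 \<le> lam * R" using R by linarith
    ultimately show ?thesis
      using covering_card_meeting_ball[OF P, of "lam * R" x] R by simp
  qed
  have "(\<Sum>B\<in>F. dir (Bs B) f) = (\<Sum>B\<in>F. \<Sum>x\<in>U. if x \<in> Bs B then (\<Sum>y\<in>U. if y \<in> Bs B then w x y else 0) else 0)"
  proof (intro sum.cong refl)
    fix B assume "B \<in> F"
    then have sub: "Bs B \<subseteq> U" unfolding U_def by auto
    then have eq: "(\<Sum>x\<in>U. if x \<in> Bs B then g x else 0) = (\<Sum>x\<in>Bs B. g x)" for g :: "'v \<Rightarrow> real"
      using U by (simp add: sum.If_cases Int_absorb1)
    show "dir (Bs B) f = (\<Sum>x\<in>U. if x \<in> Bs B then (\<Sum>y\<in>U. if y \<in> Bs B then w x y else 0) else 0)"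
      unfolding eq unfolding dir_def w_def ..
  qed
  also have "\<dots> \<le> (\<Sum>B\<in>F. \<Sum>x\<in>U. if x \<in> Bs B then (\<Sum>y\<in>U. w x y) else 0)"
    by (intro sum_mono) (auto intro!: sum_mono simp: w0)
  also have "\<dots> = (\<Sum>x\<in>U. \<Sum>B\<in>F. if x \<in> Bs B then (\<Sum>y\<in>U. w x y) else 0)" by (rule sum.swap)
  also have "\<dots> = (\<Sum>x\<in>U. real (card {B\<in>F. x \<in> Bs B}) * (\<Sum>y\<in>U. w x y))"
    using F by (simp add: sum.inter_filter[symmetric])
  also have "\<dots> \<le> (\<Sum>x\<in>U. ?K * (\<Sum>y\<in>U. w x y))"
    by (intro sum_mono mult_right_mono ov sum_nonneg w0)
  also have "\<dots> = ?K * dir U f" by (simp add: sum_distrib_left dir_def w_def)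
  also have "\<dots> \<le> ?K * D" using D[OF U] CU_pos c0_pos by (intro mult_left_mono) auto
  finally show ?thesis unfolding Bs_def .
qed

end

section \<open>Consequences of the weak Poincare inequality\<close>

locale poincare_graph = ahlfors_graph adj \<alpha> CL CU
  for adj :: "'v \<Rightarrow> 'v \<Rightarrow> bool" and \<alpha> CL CU :: real +
  fixes CP lam :: real
  assumes poinc: "weak_poincare adj CP lam"
begin

lemma CP_pos: "CP > 0" and lam_ge_1: "lam \<ge> 1"
  using poinc unfolding weak_poincare_def by auto

lemma poincare:
  assumes "r \<ge> 1"
  shows "(\<Sum>y\<in>ball x r. (f y - deg_mean adj (ball x r) f)^2) \<le> CP * r^2 * dir (ball x (lam * r)) f"
  using poinc assms unfolding weak_poincare_def Let_def dir_def
  by (simp add: sum_adjacent_pairs[OF finite_ball])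

text \<open>A function supported on a small fraction of the ball has a small mean \<open>m\<close>
  by Cauchy-Schwarz, so the mean can be absorbed and the Poincare inequality bounds \<open>f\<close>
  itself. The factor \<open>CU^2\<close> accounts for the degree weights, which lie between 1 and
  \<open>CU\<close>.\<close>

lemma poincare_small_support:
  assumes r: "r \<ge> 1" and \<Omega>: "finite \<Omega>" "\<And>x. x \<notin> \<Omega> \<Longrightarrow> f x = 0"
    and small: "4 * CU^2 * card \<Omega> \<le> card (ball x r)"
  shows "(\<Sum>y\<in>ball x r. (f y)^2) \<le> 4 * CP * r^2 * dir (ball x (lam * r)) f"
proof -
  let ?B = "ball x r"
  define S where "S = (\<Sum>y\<in>?B. (f y)^2)"
  define m where "m = deg_mean adj ?B f"
  define n where "n = real (card ?B)"
  have n: "n > 0" unfolding n_def using finite_ball[of x r] center_mem_ball[of r x] r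
    by (auto simp: card_gt_0_iff)
  have "n \<le> (\<Sum>y\<in>?B. real (gdeg adj y))"
    unfolding n_def using sum_bounded_below[of ?B "1::real" "\<lambda>y. real (gdeg adj y)"] gdeg_ge_1 by simp
  moreover have "\<bar>\<Sum>y\<in>?B. f y * real (gdeg adj y)\<bar> \<le> CU * (\<Sum>y\<in>?B \<inter> \<Omega>. \<bar>f y\<bar>)"
  proof -
    have "\<bar>\<Sum>y\<in>?B. f y * real (gdeg adj y)\<bar> \<le> (\<Sum>y\<in>?B. \<bar>f y\<bar> * CU)"
    proof (intro order.trans[OF sum_abs] sum_mono)
      fix y show "\<bar>f y * real (gdeg adj y)\<bar> \<le> \<bar>f y\<bar> * CU"
        using gdeg_le[of y] by (simp add: abs_mult mult_left_mono)
    qed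
    also have "\<dots> = CU * (\<Sum>y\<in>?B. \<bar>f y\<bar>)" by (simp add: sum_distrib_left mult.commute)
    also have "(\<Sum>y\<in>?B. \<bar>f y\<bar>) = (\<Sum>y\<in>?B \<inter> \<Omega>. \<bar>f y\<bar>)"
      using finite_ball \<Omega> by (intro sum.mono_neutral_right) auto
    finally show ?thesis .
  qed
  ultimately have "\<bar>m\<bar> \<le> CU * (\<Sum>y\<in>?B \<inter> \<Omega>. \<bar>f y\<bar>) / n"
    unfolding m_def deg_mean_def abs_divide using n by (intro frac_le) auto
  then have "m^2 \<le> (CU * (\<Sum>y\<in>?B \<inter> \<Omega>. \<bar>f y\<bar>) / n)^2" by (metis abs_ge_zero power2_abs power_mono)
  also have "\<dots> = CU^2 * (\<Sum>y\<in>?B \<inter> \<Omega>. \<bar>f y\<bar>)^2 / n^2" by (simp add: power_divide power_mult_distrib)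
  also have "(\<Sum>y\<in>?B \<inter> \<Omega>. \<bar>f y\<bar>)^2 \<le> card \<Omega> * S"
  proof -
    have "(\<Sum>y\<in>?B \<inter> \<Omega>. \<bar>f y\<bar>)^2 \<le> card (?B \<inter> \<Omega>) * (\<Sum>y\<in>?B \<inter> \<Omega>. \<bar>f y\<bar>^2)"
      using \<Omega> by (intro sum_squared_le_card) auto
    also have "\<dots> \<le> card \<Omega> * S"
      unfolding S_def power2_abs using \<Omega> finite_ball
      by (intro mult_mono sum_mono2) (auto intro!: card_mono sum_nonneg)
    finally show ?thesis .
  qed
  finally have "m^2 \<le> CU^2 * (card \<Omega> * S) / n^2"
    using n by (simp add: mult_left_mono divide_right_mono)
  then have "4 * (n * m^2) \<le> 4 * (n * (CU^2 * (card \<Omega> * S) / n^2))"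
    using n by (intro mult_left_mono) auto
  also have "\<dots> = 4 * CU^2 * card \<Omega> * S / n" using n by (simp add: power2_eq_square)
  also have "\<dots> \<le> S"
  proof -
    have "4 * CU^2 * card \<Omega> * S \<le> n * S"
      using small unfolding n_def S_def by (intro mult_right_mono sum_nonneg) auto
    then show ?thesis using n by (simp add: pos_divide_le_eq mult.commute)
  qed
  finally have m: "4 * (n * m^2) \<le> S" .
  have "S \<le> (\<Sum>y\<in>?B. 2 * (f y - m)^2 + 2 * m^2)"
    unfolding S_def
  proof (rule sum_mono)
    fix y
    have "0 \<le> (f y - 2 * m)^2" by simp
    then show "(f y)^2 \<le> 2 * (f y - m)^2 + 2 * m^2" by (simp add: power2_eq_square algebra_simps)
  qed
  also have "\<dots> = 2 * (\<Sum>y\<in>?B. (f y - m)^2) + 2 * (n * m^2)"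
    by (simp add: sum.distrib sum_distrib_left n_def)
  also have "\<dots> \<le> 2 * (CP * r^2 * dir (ball x (lam * r)) f) + S / 2"
    using m poincare[OF r, where f = f and x = x] unfolding m_def[symmetric] by linarith
  finally show ?thesis unfolding S_def[symmetric] by simp
qed

text \<open>Cover \<open>\<Omega>\<close> by balls so large that \<open>\<Omega>\<close> fills only
  a small part of each; the required radius is of order
  \<open>card \<Omega> powr (1/\<alpha>)\<close>. The bound \<open>D\<close> on all finite energies
  stands for the energy on the infinite graph without an infinite sum.\<close>

lemma faber_krahn:
  obtains CF where "CF > 0"
    "\<And>\<Omega> f D. finite \<Omega> \<Longrightarrow> \<Omega> \<noteq> {} \<Longrightarrow> (\<And>x. x \<notin> \<Omega> \<Longrightarrow> f x = 0) \<Longrightarrow>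
       (\<And>U. finite U \<Longrightarrow> dir U f \<le> D) \<Longrightarrow>
       (\<Sum>x\<in>\<Omega>. (f x)^2) \<le> CF * real (card \<Omega>) powr (2/\<alpha>) * D"
proof -
  obtain b where b: "\<And>R. R > 0 \<Longrightarrow> \<exists>P. is_covering adj P R b" using covering_exists by blast
  define K where "K = real b * CU * 3 powr \<alpha> / c0 * lam powr \<alpha>"
  \<comment> \<open>With \<open>s powr \<alpha> = k * n\<close> a ball of radius \<open>s\<close>
    has at least \<open>4 * CU^2 * n\<close> points, as the small-support estimate demands;
    \<open>k \<ge> 1\<close> ensures \<open>s \<ge> 1\<close>.\<close>
  define k where "k = max 1 (4 * CU^2 / CL)"
  define CF where "CF = 4 * CP * k powr (2/\<alpha>) * (K + 1)"
  have K: "K \<ge> 0" unfolding K_def using CU_pos c0_pos by simp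
  have k: "k \<ge> 1" "CL * k \<ge> 4 * CU^2" unfolding k_def using CL_pos
    by (auto simp: max_def field_simps)
  have \<alpha>: "\<alpha> > 0" using alpha_ge_1 by simp
  show ?thesis
  proof
    show "CF > 0" unfolding CF_def using CP_pos k K by simp
    fix \<Omega> f D
    assume \<Omega>: "finite \<Omega>" "\<Omega> \<noteq> {}" "\<And>x. x \<notin> \<Omega> \<Longrightarrow> f x = 0" and D: "\<And>U. finite U \<Longrightarrow> dir U f \<le> D"
    define n where "n = real (card \<Omega>)"
    have n: "n \<ge> 1" unfolding n_def using \<Omega> by (simp add: Suc_le_eq card_gt_0_iff)
    have D0: "D \<ge> 0" using D[of "{}"] by (simp add: dir_def)
    define s where "s = (k * n) powr (1/\<alpha>)"
    have kn: "k * n \<ge> 1" using k n mult_mono[of 1 k 1 n] by simp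
    have s: "s \<ge> 1" unfolding s_def using kn \<alpha> by (intro ge_one_powr_ge_zero) auto
    have s\<alpha>: "s powr \<alpha> = k * n" unfolding s_def powr_powr using \<alpha> kn by simp
    have s2: "s^2 = k powr (2/\<alpha>) * n powr (2/\<alpha>)"
    proof -
      have "s^2 = s powr 2" using s by (simp add: powr_numeral)
      also have "\<dots> = (k * n) powr (2/\<alpha>)" unfolding s_def powr_powr by simp
      finally show ?thesis using k n by (simp add: powr_mult)
    qed
    obtain P where P: "is_covering adj P s b" using b[of s] s by auto
    define F where "F = {B\<in>P. B \<inter> \<Omega> \<noteq> {}}"
    have F: "finite F" "F \<subseteq> P" unfolding F_def using covering_locally_finite[OF P \<Omega>(1)] by auto
    have "\<exists>c. \<forall>B\<in>P. B = ball (c B) s" using P unfolding is_covering_def by (intro bchoice) auto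
    then obtain ctr where ctr: "\<And>B. B \<in> F \<Longrightarrow> B = ball (ctr B) s" using F by blast
    have cov: "\<Omega> \<subseteq> \<Union>F" using P unfolding F_def is_covering_def by blast
    have "(\<Sum>x\<in>\<Omega>. (f x)^2) \<le> (\<Sum>B\<in>F. \<Sum>x\<in>B. (f x)^2)"
      by (rule sum_le_sum_cover[OF F(1) _ cov]) (use ctr finite_ball in \<open>metis, simp\<close>)
    also have "\<dots> \<le> (\<Sum>B\<in>F. 4 * CP * s^2 * dir (ball (ctr B) (lam * s)) f)"
    proof (rule sum_mono)
      fix B assume B: "B \<in> F"
      have "4 * CU^2 * real (card \<Omega>) \<le> CL * k * n" unfolding n_def using k by (intro mult_right_mono) auto
      also have "\<dots> \<le> card (ball (ctr B) s)" using card_ball_ge[OF s, of "ctr B"] s\<alpha> by (simp add: mult.assoc)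
      finally have "4 * CU^2 * real (card \<Omega>) \<le> card (ball (ctr B) s)" .
      from poincare_small_support[OF s \<Omega>(1,3) this]
      show "(\<Sum>x\<in>B. (f x)^2) \<le> 4 * CP * s^2 * dir (ball (ctr B) (lam * s)) f"
        unfolding ctr[OF B, symmetric] .
    qed
    also have "\<dots> \<le> 4 * CP * s^2 * (K * D)"
      unfolding sum_distrib_left[symmetric] K_def
      using sum_dir_dilated_balls[OF P s lam_ge_1 F ctr D] CP_pos
      by (intro mult_left_mono) auto
    also have "\<dots> \<le> 4 * CP * s^2 * ((K + 1) * D)"
      using CP_pos D0 by (intro mult_left_mono mult_right_mono) auto
    also have "\<dots> = CF * real (card \<Omega>) powr (2/\<alpha>) * D" unfolding s2 CF_def n_def by simp
    finally show "(\<Sum>x\<in>\<Omega>. (f x)^2) \<le> CF * real (card \<Omega>) powr (2/\<alpha>) * D" .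
  qed
qed

end

section \<open>The operator and its landscape function\<close>

locale landscape_graph = ahlfors_graph adj \<alpha> CL CU
  for adj :: "'v \<Rightarrow> 'v \<Rightarrow> bool" and \<alpha> CL CU :: real +
  fixes \<mu> :: "'v \<Rightarrow> 'v \<Rightarrow> real" and V :: "'v \<Rightarrow> real" and A :: "'v set"
  assumes finite_A: "finite A" and nonempty_A: "A \<noteq> {}" and adm: "admissible adj \<mu> V"
begin

abbreviation H :: "('v \<Rightarrow> real) \<Rightarrow> 'v \<Rightarrow> real" where "H \<equiv> HA adj \<mu> V A"
abbreviation Q :: "('v \<Rightarrow> real) \<Rightarrow> real" where "Q \<equiv> qform adj \<mu> V A"
abbreviation N :: "real \<Rightarrow> real" where "N \<equiv> IDS adj \<mu> V A"
abbreviation u :: "'v \<Rightarrow> real" where "u \<equiv> landscape adj \<mu> V A"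

abbreviation diag :: "'v \<Rightarrow> real" where "diag x \<equiv> real (gdeg adj x) + V x"

lemma mu_sym: "adj x y \<Longrightarrow> \<mu> x y = \<mu> y x"
  and mu_nonneg: "adj x y \<Longrightarrow> 0 \<le> \<mu> x y" and mu_le_1: "adj x y \<Longrightarrow> \<mu> x y \<le> 1"
  and V_nonneg: "V x \<ge> 0"
  using adm unfolding admissible_def by auto

lemma H_expand: "H f x = diag x * f x - (\<Sum>y\<in>A. if adj x y then \<mu> x y * f y else 0)"
proof -
  have "{y\<in>A. adj y x} = {y\<in>A. adj x y}" using adj_sym by blast
  then show ?thesis
    unfolding HA_def using finite_A by (simp add: sum.inter_filter distrib_right)
qed

lemma Q_expand: "Q f = (\<Sum>x\<in>A. diag x * (f x)^2) - (\<Sum>x\<in>A. \<Sum>y\<in>A. if adj x y then \<mu> x y * (f x * f y) else 0)"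
proof -
  have "f x * H f x = diag x * (f x)^2 - (\<Sum>y\<in>A. if adj x y then \<mu> x y * (f x * f y) else 0)" for x
    unfolding H_expand right_diff_distrib sum_distrib_left
    by (intro arg_cong2[of _ _ _ _ "(-)"] sum.cong) (auto simp: power2_eq_square)
  then show ?thesis unfolding qform_def by (simp add: sum_subtractf)
qed

lemma sum_adj_swap:
  fixes g :: "'v \<Rightarrow> 'v \<Rightarrow> real"
  shows "(\<Sum>x\<in>U. \<Sum>y\<in>U. if adj x y then g x y else 0) = (\<Sum>x\<in>U. \<Sum>y\<in>U. if adj x y then g y x else 0)"
proof -
  have "(\<Sum>x\<in>U. \<Sum>y\<in>U. if adj x y then g x y else 0) = (\<Sum>y\<in>U. \<Sum>x\<in>U. if adj x y then g x y else 0)"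
    by (rule sum.swap)
  also have "\<dots> = (\<Sum>x\<in>U. \<Sum>y\<in>U. if adj x y then g y x else 0)"
    by (intro sum.cong refl) (auto dest: adj_sym)
  finally show ?thesis .
qed

lemma sum_neighbors_le:
  fixes c :: real
  assumes "finite U" "c \<ge> 0"
  shows "(\<Sum>y\<in>U. if adj x y then c else 0) \<le> gdeg adj x * c"
proof -
  have "(\<Sum>y\<in>U. if adj x y then c else 0) = card {y\<in>U. adj x y} * c"
    using assms(1) by (simp add: sum.inter_filter[symmetric])
  also have "\<dots> \<le> gdeg adj x * c"
    unfolding gdeg_def using assms finite_neighbors
    by (intro mult_right_mono of_nat_mono card_mono) auto
  finally show ?thesis .
qed

text \<open>A finite set containing every edge that meets \<open>A\<close>. On it, full degrees of
  points of \<open>A\<close> become finite sums and the energy of a function supported in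
  \<open>A\<close> is complete.\<close>

definition nbhd :: "'v set" where "nbhd = A \<union> (\<Union>x\<in>A. {y. adj x y})"

lemma finite_nbhd: "finite nbhd" and A_subset_nbhd: "A \<subseteq> nbhd"
  unfolding nbhd_def using finite_A finite_neighbors by auto

lemma sum_neighbors_eq:
  assumes "nbhd \<subseteq> W" "finite W" "x \<in> A"
  shows "(\<Sum>y\<in>W. if adj x y then c else 0) = gdeg adj x * (c::real)"
proof -
  have "{y\<in>W. adj x y} = {y. adj x y}" using assms unfolding nbhd_def by auto
  then show ?thesis unfolding gdeg_def using assms by (simp add: sum.inter_filter[symmetric])
qed

lemma sum_sum_zero_off:
  fixes g :: "'v \<Rightarrow> 'v \<Rightarrow> real"
  assumes "A \<subseteq> W" "finite W" "\<And>x y. x \<notin> A \<or> y \<notin> A \<Longrightarrow> g x y = 0"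
  shows "(\<Sum>x\<in>W. \<Sum>y\<in>W. g x y) = (\<Sum>x\<in>A. \<Sum>y\<in>A. g x y)"
proof -
  have "(\<Sum>x\<in>W. \<Sum>y\<in>W. g x y) = (\<Sum>x\<in>A. \<Sum>y\<in>W. g x y)"
    using assms by (intro sum.mono_neutral_right) auto
  also have "\<dots> = (\<Sum>x\<in>A. \<Sum>y\<in>A. g x y)"
    using assms by (intro sum.cong refl sum.mono_neutral_right) auto
  finally show ?thesis .
qed

section \<open>Comparison of the Dirichlet energy with the form of the operator\<close>

lemma dir_mono: "U \<subseteq> W \<Longrightarrow> finite W \<Longrightarrow> dir U f \<le> dir W f"
  unfolding dir_def
  by (rule order.trans[OF sum_mono sum_mono2]) (auto intro!: sum_mono2 sum_nonneg finite_subset[of U W])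

text \<open>Edges leaving \<open>A\<close> contribute \<open>(f x)^2\<close>, since \<open>f\<close>
  vanishes outside; this is what restores the full degree of the ambient graph.\<close>

lemma dir_expand:
  fixes f :: "'v \<Rightarrow> real"
  assumes W: "nbhd \<subseteq> W" "finite W" and f: "\<And>x. x \<notin> A \<Longrightarrow> f x = 0"
  shows "dir W f = 2 * (\<Sum>x\<in>A. gdeg adj x * (f x)^2) - 2 * (\<Sum>x\<in>A. \<Sum>y\<in>A. if adj x y then f x * f y else 0)"
proof -
  have AW: "A \<subseteq> W" using W A_subset_nbhd by blast
  have "dir W f = (\<Sum>x\<in>W. \<Sum>y\<in>W. (if adj x y then (f x)^2 else 0) + (if adj x y then (f y)^2 else 0)
      - 2 * (if adj x y then f x * f y else 0))"
    unfolding dir_def by (intro sum.cong refl) (auto simp: power2_eq_square algebra_simps)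
  also have "\<dots> = (\<Sum>x\<in>W. \<Sum>y\<in>W. if adj x y then (f x)^2 else 0) + (\<Sum>x\<in>W. \<Sum>y\<in>W. if adj x y then (f y)^2 else 0)
      - 2 * (\<Sum>x\<in>W. \<Sum>y\<in>W. if adj x y then f x * f y else 0)"
    by (simp add: sum.distrib sum_subtractf sum_distrib_left)
  also have "(\<Sum>x\<in>W. \<Sum>y\<in>W. if adj x y then (f y)^2 else 0) = (\<Sum>x\<in>W. \<Sum>y\<in>W. if adj x y then (f x)^2 else 0)"
    by (rule sum_adj_swap)
  also have "(\<Sum>x\<in>W. \<Sum>y\<in>W. if adj x y then (f x)^2 else 0) = (\<Sum>x\<in>A. \<Sum>y\<in>W. if adj x y then (f x)^2 else 0)"
    using W AW f by (intro sum.mono_neutral_right) (auto intro!: sum.neutral)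
  also have "\<dots> = (\<Sum>x\<in>A. gdeg adj x * (f x)^2)"
    using W by (intro sum.cong refl sum_neighbors_eq)
  also have "(\<Sum>x\<in>W. \<Sum>y\<in>W. if adj x y then f x * f y else 0) = (\<Sum>x\<in>A. \<Sum>y\<in>A. if adj x y then f x * f y else 0)"
    using W AW f by (intro sum_sum_zero_off) auto
  finally show ?thesis by simp
qed

lemma sum_adj_squares_le:
  fixes f :: "'v \<Rightarrow> real"
  shows "(\<Sum>x\<in>A. \<Sum>y\<in>A. if adj x y then (f x)^2 + (f y)^2 else 0) \<le> 2 * (\<Sum>x\<in>A. gdeg adj x * (f x)^2)"
proof -
  have "(\<Sum>x\<in>A. \<Sum>y\<in>A. if adj x y then (f x)^2 + (f y)^2 else 0)
    = (\<Sum>x\<in>A. \<Sum>y\<in>A. if adj x y then (f x)^2 else 0) + (\<Sum>x\<in>A. \<Sum>y\<in>A. if adj x y then (f y)^2 else 0)"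
    unfolding sum.distrib[symmetric] by (intro sum.cong refl) auto
  also have "(\<Sum>x\<in>A. \<Sum>y\<in>A. if adj x y then (f y)^2 else 0) = (\<Sum>x\<in>A. \<Sum>y\<in>A. if adj x y then (f x)^2 else 0)"
    by (rule sum_adj_swap)
  also have "(\<Sum>x\<in>A. \<Sum>y\<in>A. if adj x y then (f x)^2 else 0) \<le> (\<Sum>x\<in>A. gdeg adj x * (f x)^2)"
    using finite_A by (intro sum_mono sum_neighbors_le) auto
  finally show ?thesis by simp
qed

text \<open>For \<open>f\<close> of arbitrary sign the cross terms combine to
  \<open>(4 * \<mu> x y - 2) * (f x * f y)\<close>, and
  \<open>\<bar>4 * \<mu> x y - 2\<bar> \<le> 2\<close> because bond strengths lie in [0,1]. The
  degree terms absorb the result.\<close>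

lemma dir_le_Q:
  assumes U: "finite U" and f: "\<And>x. x \<notin> A \<Longrightarrow> f x = 0"
  shows "dir U f \<le> 4 * Q f"
proof -
  let ?W = "U \<union> nbhd"
  have W: "finite ?W" using U finite_nbhd by simp
  have "dir U f \<le> dir ?W f" using W by (intro dir_mono) auto
  also have "dir ?W f = 2 * (\<Sum>x\<in>A. gdeg adj x * (f x)^2) - 2 * (\<Sum>x\<in>A. \<Sum>y\<in>A. if adj x y then f x * f y else 0)"
    using W f by (intro dir_expand) auto
  also have "\<dots> \<le> 4 * Q f"
  proof -
    have "4 * (\<Sum>x\<in>A. \<Sum>y\<in>A. if adj x y then \<mu> x y * (f x * f y) else 0) - 2 * (\<Sum>x\<in>A. \<Sum>y\<in>A. if adj x y then f x * f y else 0)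
      \<le> (\<Sum>x\<in>A. \<Sum>y\<in>A. if adj x y then (f x)^2 + (f y)^2 else 0)"
      unfolding sum_distrib_left sum_subtractf[symmetric]
    proof (intro sum_mono)
      fix x y
      show "4 * (if adj x y then \<mu> x y * (f x * f y) else 0) - 2 * (if adj x y then f x * f y else 0)
        \<le> (if adj x y then (f x)^2 + (f y)^2 else 0)"
      proof (cases "adj x y")
        case True
        have "(4 * \<mu> x y - 2) * (f x * f y) \<le> \<bar>4 * \<mu> x y - 2\<bar> * \<bar>f x * f y\<bar>" by (metis abs_ge_self abs_mult)
        also have "\<dots> \<le> 2 * \<bar>f x * f y\<bar>"
          using mu_nonneg[OF True] mu_le_1[OF True] by (intro mult_right_mono) auto
        also have "\<dots> \<le> (f x)^2 + (f y)^2"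
          using sum_squares_bound[of "\<bar>f x\<bar>" "\<bar>f y\<bar>"] by (simp add: abs_mult)
        finally show ?thesis using True by (simp add: algebra_simps)
      qed simp
    qed
    moreover have "(\<Sum>x\<in>A. diag x * (f x)^2) \<ge> (\<Sum>x\<in>A. gdeg adj x * (f x)^2)"
      using V_nonneg by (intro sum_mono mult_right_mono) auto
    ultimately show ?thesis unfolding Q_expand using sum_adj_squares_le[of f] by argo
  qed
  finally show ?thesis .
qed

text \<open>When \<open>f\<close> is nonnegative, replacing bond strengths by 1 only increases the
  cross terms; the remaining 2 is the double count of edges. The better constant is what lets the
  energy be absorbed in \<open>truncation_energy\<close>.\<close>

lemma dir_le_Q_nonneg:
  assumes U: "finite U" and f: "\<And>x. x \<notin> A \<Longrightarrow> f x = 0" "\<And>x. f x \<ge> 0"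
  shows "dir U f \<le> 2 * Q f"
proof -
  let ?W = "U \<union> nbhd"
  have W: "finite ?W" using U finite_nbhd by simp
  have "dir U f \<le> dir ?W f" using W by (intro dir_mono) auto
  also have "dir ?W f = 2 * (\<Sum>x\<in>A. gdeg adj x * (f x)^2) - 2 * (\<Sum>x\<in>A. \<Sum>y\<in>A. if adj x y then f x * f y else 0)"
    using W f by (intro dir_expand) auto
  also have "\<dots> \<le> 2 * Q f"
  proof -
    have "(\<Sum>x\<in>A. \<Sum>y\<in>A. if adj x y then \<mu> x y * (f x * f y) else 0) \<le> (\<Sum>x\<in>A. \<Sum>y\<in>A. if adj x y then f x * f y else 0)"
    proof (intro sum_mono)
      fix x y
      show "(if adj x y then \<mu> x y * (f x * f y) else 0) \<le> (if adj x y then f x * f y else 0)"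
        using f(2)[of x] f(2)[of y] mu_nonneg[of x y] mu_le_1[of x y]
        by (auto intro: mult_left_le_one_le)
    qed
    moreover have "(\<Sum>x\<in>A. diag x * (f x)^2) \<ge> (\<Sum>x\<in>A. gdeg adj x * (f x)^2)"
      using V_nonneg by (intro sum_mono mult_right_mono) auto
    ultimately show ?thesis unfolding Q_expand by argo
  qed
  finally show ?thesis .
qed

text \<open>The form vanishes at \<open>f\<close>, hence so does every edge difference. By
  connectedness \<open>f\<close> is constant, and the infinite graph has a vertex outside the finite
  set \<open>A\<close>, where \<open>f\<close> is 0.\<close>

lemma H_injective:
  assumes f: "\<And>x. x \<notin> A \<Longrightarrow> f x = 0" and H0: "\<And>x. x \<in> A \<Longrightarrow> H f x = 0"
  shows "f x = 0"
proof -
  have "Q f = 0" unfolding qform_def using H0 by simp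
  have step: "f x = f y" if "adj x y" for x y
  proof -
    have "x \<noteq> y" using that adj_irrefl by auto
    then have "(f x - f y)^2 \<le> dir {x,y} f"
      unfolding dir_def using that by (simp add: adj_irrefl)
    also have "\<dots> \<le> 4 * Q f" using f by (intro dir_le_Q) auto
    finally show ?thesis using \<open>Q f = 0\<close> by simp
  qed
  have "f x = f y" if "(adj ^^ n) x y" for n x y
    using that by (induction n arbitrary: y) (auto dest: step)
  then have const: "f x = f y" for x y using connected by metis
  obtain z where "z \<notin> A" using ex_new_if_finite[OF infinite_vertices finite_A] by blast
  then show ?thesis using const[of x z] f by simp
qed

text \<open>The system \<open>H f = c\<close> has one unknown more than equations when the constant
  \<open>c\<close> is treated as unknown (index \<open>None\<close>). A nontrivial solution has
  nonzero \<open>c\<close> by injectivity and can be divided by it.\<close>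

lemma landscape_exists: "\<exists>w. (\<forall>x\<in>A. H w x = 1) \<and> (\<forall>x. x \<notin> A \<longrightarrow> w x = 0)"
proof -
  define a where "a x i = (case i of None \<Rightarrow> - 1 | Some y \<Rightarrow>
     (if x = y then diag x else 0) - (if adj x y then \<mu> x y else 0))" for x i
  let ?I = "insert None (Some ` A)"
  have "card A < card ?I" using finite_A by (simp add: card_image)
  from nontrivial_kernel[OF finite_A _ this, of a] finite_A
  obtain c where c: "\<exists>i\<in>?I. c i \<noteq> 0" "\<And>x. x \<in> A \<Longrightarrow> (\<Sum>i\<in>?I. a x i * c i) = 0" by auto
  define f where "f x = (if x \<in> A then c (Some x) else 0)" for x
  have Hf: "H f x = c None" if x: "x \<in> A" for x
  proof -
    have "0 = - c None + (\<Sum>y\<in>A. a x (Some y) * c (Some y))"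
      using c(2)[OF x] finite_A by (simp add: sum.reindex a_def)
    also have "(\<Sum>y\<in>A. a x (Some y) * c (Some y))
      = (\<Sum>y\<in>A. (if x = y then diag x * f x else 0) - (if adj x y then \<mu> x y * f y else 0))"
      using x by (intro sum.cong refl) (auto simp: a_def f_def algebra_simps)
    also have "\<dots> = H f x" unfolding H_expand sum_subtractf using x finite_A by simp
    finally show ?thesis by simp
  qed
  have "c None \<noteq> 0"
  proof
    assume 0: "c None = 0"
    have "f x = 0" for x
      by (rule H_injective) (simp add: f_def, simp add: Hf 0)
    then have "c (Some x) = 0" if "x \<in> A" for x using that unfolding f_def by metis
    then show False using c(1) 0 by auto
  qed
  define w where "w x = f x / c None" for x
  have "H w x = H f x / c None" for x
    unfolding H_expand w_def
    by (simp add: diff_divide_distrib sum_divide_distrib if_distrib[of "\<lambda>t. t / c None"] cong: if_cong)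
  then have "H w x = 1" if "x \<in> A" for x using Hf[OF that] \<open>c None \<noteq> 0\<close> by simp
  moreover have "w x = 0" if "x \<notin> A" for x using that unfolding w_def f_def by simp
  ultimately show ?thesis by blast
qed

lemma landscape_unique:
  assumes "\<And>x. x \<in> A \<Longrightarrow> H w x = 1" "\<And>x. x \<notin> A \<Longrightarrow> w x = 0"
    and "\<And>x. x \<in> A \<Longrightarrow> H w' x = 1" "\<And>x. x \<notin> A \<Longrightarrow> w' x = 0"
  shows "w = w'"
proof
  fix x
  have diff: "H (\<lambda>x. w x - w' x) y = H w y - H w' y" for y
    unfolding H_expand by (simp add: algebra_simps sum_subtractf[symmetric] if_distrib cong: if_cong)
  have "w x - w' x = 0"
    by (rule H_injective[of "\<lambda>x. w x - w' x"]) (simp_all add: diff assms)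
  then show "w x = w' x" by simp
qed

lemma H_landscape: "x \<in> A \<Longrightarrow> H u x = 1" and landscape_off: "x \<notin> A \<Longrightarrow> u x = 0"
proof -
  have "\<exists>!w. (\<forall>x\<in>A. H w x = 1) \<and> (\<forall>x. x \<notin> A \<longrightarrow> w x = 0)"
    using landscape_exists landscape_unique by blast
  from theI'[OF this] show "x \<in> A \<Longrightarrow> H u x = 1" "x \<notin> A \<Longrightarrow> u x = 0"
    unfolding landscape_def by auto
qed

text \<open>Minimum principle: at a nonpositive minimum \<open>z\<close> the neighbours contribute
  at least \<open>gdeg adj z * u z\<close>, so the equation would give
  \<open>V z * u z \<ge> 1\<close> against \<open>V z \<ge> 0\<close>.\<close>

lemma landscape_pos:
  assumes x: "x \<in> A"
  shows "u x > 0"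
proof (rule ccontr)
  assume "\<not> u x > 0"
  obtain z where z: "z \<in> A" "\<And>y. y \<in> A \<Longrightarrow> u z \<le> u y"
    using finite_A nonempty_A by (metis arg_min_if_finite(1) arg_min_least)
  have uz: "u z \<le> 0" using z(2)[OF x] \<open>\<not> u x > 0\<close> by linarith
  have "diag z * u z = 1 + (\<Sum>y\<in>A. if adj z y then \<mu> z y * u y else 0)"
    using H_landscape[OF z(1)] unfolding H_expand by linarith
  moreover have "(\<Sum>y\<in>A. if adj z y then \<mu> z y * u y else 0) \<ge> (\<Sum>y\<in>A. - (if adj z y then - u z else 0))"
  proof (intro sum_mono)
    fix y assume y: "y \<in> A"
    show "- (if adj z y then - u z else 0) \<le> (if adj z y then \<mu> z y * u y else 0)"
    proof (cases "adj z y")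
      case True
      have "u z \<le> \<mu> z y * u z" using uz mu_nonneg[OF True] mu_le_1[OF True]
        by (metis mult_right_mono_neg mult_1)
      also have "\<dots> \<le> \<mu> z y * u y" using z(2)[OF y] mu_nonneg[OF True] by (rule mult_left_mono)
      finally show ?thesis using True by simp
    qed simp
  qed
  moreover have "(\<Sum>y\<in>A. if adj z y then - u z else 0) \<le> gdeg adj z * (- u z)"
    using finite_A uz by (intro sum_neighbors_le) auto
  ultimately have "diag z * u z \<ge> 1 + gdeg adj z * u z" by (simp add: sum_negf)
  then have "V z * u z \<ge> 1" by (simp add: algebra_simps)
  moreover have "V z * u z \<le> 0" using V_nonneg uz by (rule mult_nonneg_nonpos)
  ultimately show False by simp
qed

text \<open>Test the equation \<open>H u = 1\<close> with \<open>f^2 / u\<close>. The difference of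
  the two sides is a sum over edges of the nonnegative terms
  \<open>\<mu> x y * (f x * u y - f y * u x)^2 / (u x * u y)\<close>, up to a factor.\<close>

lemma Q_ge_landscape: "Q f \<ge> (\<Sum>x\<in>A. (f x)^2 / u x)"
proof -
  have "(\<Sum>x\<in>A. (f x)^2 / u x) = (\<Sum>x\<in>A. (f x)^2 / u x * H u x)"
    by (intro sum.cong refl) (simp add: H_landscape)
  also have "\<dots> = (\<Sum>x\<in>A. diag x * (f x)^2 - (\<Sum>y\<in>A. if adj x y then \<mu> x y * ((f x)^2 / u x * u y) else 0))"
  proof (intro sum.cong refl)
    fix x assume "x \<in> A"
    then show "(f x)^2 / u x * H u x = diag x * (f x)^2 - (\<Sum>y\<in>A. if adj x y then \<mu> x y * ((f x)^2 / u x * u y) else 0)"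
      using landscape_pos[of x] unfolding H_expand right_diff_distrib sum_distrib_left
      by (intro arg_cong2[of _ _ _ _ "(-)"] sum.cong) auto
  qed
  also have "\<dots> = (\<Sum>x\<in>A. diag x * (f x)^2) - (\<Sum>x\<in>A. \<Sum>y\<in>A. if adj x y then \<mu> x y * ((f x)^2 / u x * u y) else 0)"
    by (simp add: sum_subtractf)
  finally have eq: "(\<Sum>x\<in>A. (f x)^2 / u x) = \<dots>" .
  have "2 * (\<Sum>x\<in>A. \<Sum>y\<in>A. if adj x y then \<mu> x y * (f x * f y) else 0)
    \<le> (\<Sum>x\<in>A. \<Sum>y\<in>A. if adj x y then \<mu> x y * ((f x)^2 / u x * u y) else 0)
     + (\<Sum>x\<in>A. \<Sum>y\<in>A. if adj x y then \<mu> y x * ((f y)^2 / u y * u x) else 0)"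
    unfolding sum_distrib_left sum.distrib[symmetric]
  proof (intro sum_mono)
    fix x y assume xy: "x \<in> A" "y \<in> A"
    show "2 * (if adj x y then \<mu> x y * (f x * f y) else 0) \<le>
       (if adj x y then \<mu> x y * ((f x)^2 / u x * u y) else 0) + (if adj x y then \<mu> y x * ((f y)^2 / u y * u x) else 0)"
    proof (cases "adj x y")
      case True
      note pos = landscape_pos[OF xy(1)] landscape_pos[OF xy(2)]
      have "0 \<le> (f x * u y - f y * u x)^2 / (u x * u y)" using pos by simp
      also have "\<dots> = (f x)^2 / u x * u y + (f y)^2 / u y * u x - 2 * (f x * f y)"
        using pos by (simp add: field_simps power2_eq_square)
      finally have "\<mu> x y * (2 * (f x * f y)) \<le> \<mu> x y * ((f x)^2 / u x * u y + (f y)^2 / u y * u x)"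
        using mu_nonneg[OF True] by (intro mult_left_mono) auto
      then show ?thesis using True mu_sym[OF True] by (simp add: algebra_simps)
    qed simp
  qed
  also have "(\<Sum>x\<in>A. \<Sum>y\<in>A. if adj x y then \<mu> y x * ((f y)^2 / u y * u x) else 0) = (\<Sum>x\<in>A. \<Sum>y\<in>A. if adj x y then \<mu> x y * ((f x)^2 / u x * u y) else 0)"
    by (rule sum_adj_swap)
  finally show ?thesis unfolding eq Q_expand by linarith
qed

lemma truncation_energy:
  fixes \<psi> v :: "'v \<Rightarrow> real" and g :: real
  assumes v0: "\<And>x. x \<notin> A \<Longrightarrow> v x = 0" "\<And>x. v x \<ge> 0" and psi: "\<And>x. \<psi> x \<ge> 0"
    and v: "\<And>x. v x > 0 \<Longrightarrow> v x = u x - \<psi> x"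
      "\<And>x y. v x > 0 \<Longrightarrow> y \<in> A \<Longrightarrow> adj x y \<Longrightarrow> v y \<ge> u y - \<psi> y"
    and lip: "\<And>x y. adj x y \<Longrightarrow> \<bar>\<psi> x - \<psi> y\<bar> \<le> g"
  shows "Q v \<le> 2 * (\<Sum>x\<in>A. v x) + CU * g^2 * card {x. v x > 0}"
proof -
  define \<Omega> where "\<Omega> = {x. v x > 0}"
  have \<Omega>: "\<Omega> \<subseteq> A" "finite \<Omega>" unfolding \<Omega>_def using v0(1) finite_A
    by (auto intro: finite_subset[of _ A]) (metis less_irrefl, metis (mono_tags, lifting) finite_subset less_irrefl mem_Collect_eq subsetI)
  let ?W = nbhd
  have AW: "A \<subseteq> ?W" by (rule A_subset_nbhd)
  define T where "T = (\<Sum>x\<in>?W. \<Sum>y\<in>?W. if adj x y then v x * (\<psi> y - \<psi> x) else 0)"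
  have Hv: "H v x \<le> 1 + (\<Sum>y\<in>?W. if adj x y then \<psi> y - \<psi> x else 0)" if x: "x \<in> \<Omega>" for x
  proof -
    have xA: "x \<in> A" "v x > 0" using x \<Omega> unfolding \<Omega>_def by auto
    have "(\<Sum>y\<in>A. if adj x y then \<mu> x y * (u y - \<psi> y) else 0) \<le> (\<Sum>y\<in>A. if adj x y then \<mu> x y * v y else 0)"
      using v(2)[OF xA(2)] mu_nonneg by (intro sum_mono) (auto intro!: mult_left_mono)
    moreover have "(\<Sum>y\<in>A. if adj x y then \<mu> x y * (u y - \<psi> y) else 0)
      = (\<Sum>y\<in>A. if adj x y then \<mu> x y * u y else 0) - (\<Sum>y\<in>A. if adj x y then \<mu> x y * \<psi> y else 0)"
      unfolding sum_subtractf[symmetric] by (intro sum.cong refl) (auto simp: algebra_simps)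
    moreover have "(\<Sum>y\<in>A. if adj x y then \<mu> x y * \<psi> y else 0) \<le> (\<Sum>y\<in>?W. if adj x y then \<psi> y else 0)"
    proof -
      have "(\<Sum>y\<in>A. if adj x y then \<mu> x y * \<psi> y else 0) \<le> (\<Sum>y\<in>A. if adj x y then \<psi> y else 0)"
        using psi mu_nonneg mu_le_1 by (intro sum_mono) (auto intro: mult_left_le_one_le)
      also have "\<dots> \<le> (\<Sum>y\<in>?W. if adj x y then \<psi> y else 0)"
        using finite_nbhd AW psi by (intro sum_mono2) auto
      finally show ?thesis .
    qed
    moreover have "(\<Sum>y\<in>?W. if adj x y then \<psi> y else 0) - gdeg adj x * \<psi> x = (\<Sum>y\<in>?W. if adj x y then \<psi> y - \<psi> x else 0)"
      unfolding sum_neighbors_eq[OF order.refl finite_nbhd xA(1), symmetric] sum_subtractf[symmetric]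
      by (intro sum.cong refl) auto
    moreover have "1 = diag x * u x - (\<Sum>y\<in>A. if adj x y then \<mu> x y * u y else 0)"
      using H_landscape[OF xA(1)] unfolding H_expand by simp
    moreover have "diag x * v x = diag x * u x - gdeg adj x * \<psi> x - V x * \<psi> x"
      by (subst v(1)[OF xA(2)]) (simp add: algebra_simps)
    moreover have "V x * \<psi> x \<ge> 0" using V_nonneg psi by simp
    ultimately show ?thesis unfolding H_expand by linarith
  qed
  have "Q v = (\<Sum>x\<in>\<Omega>. v x * H v x)"
    unfolding qform_def using finite_A \<Omega> v0(2) unfolding \<Omega>_def
    by (intro sum.mono_neutral_right) (auto simp: not_less intro: antisym)
  also have "\<dots> \<le> (\<Sum>x\<in>\<Omega>. v x * (1 + (\<Sum>y\<in>?W. if adj x y then \<psi> y - \<psi> x else 0)))"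
    using Hv v0(2) by (intro sum_mono mult_left_mono) auto
  also have "\<dots> = (\<Sum>x\<in>?W. v x * (1 + (\<Sum>y\<in>?W. if adj x y then \<psi> y - \<psi> x else 0)))"
    using finite_nbhd \<Omega> AW v0(2) unfolding \<Omega>_def
    by (intro sum.mono_neutral_left) (auto simp: not_less intro: antisym)
  also have "\<dots> = (\<Sum>x\<in>?W. v x) + T"
    unfolding T_def distrib_left sum.distrib sum_distrib_left
    by (simp add: if_distrib cong: if_cong)
  also have "(\<Sum>x\<in>?W. v x) = (\<Sum>x\<in>A. v x)"
    using finite_nbhd AW v0(1) by (intro sum.mono_neutral_right) auto
  finally have 1: "Q v \<le> (\<Sum>x\<in>A. v x) + T" .
  \<comment> \<open>Symmetrizing turns the terms of \<open>T\<close> into products of a difference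
    of \<open>v\<close> and a difference of \<open>\<psi>\<close>. Young's inequality splits each,
    and only edges touching the support contribute.\<close>
  have "2 * T = T + (\<Sum>x\<in>?W. \<Sum>y\<in>?W. if adj x y then v y * (\<psi> x - \<psi> y) else 0)"
    unfolding T_def by (subst (2) sum_adj_swap) simp
  also have "\<dots> \<le> (\<Sum>x\<in>?W. \<Sum>y\<in>?W. (1/2) * (if adj x y then (v x - v y)^2 else 0)
      + ((if adj x y then (if x \<in> \<Omega> then g^2/2 else 0) else 0) + (if adj x y then (if y \<in> \<Omega> then g^2/2 else 0) else 0)))"
    unfolding T_def sum.distrib[symmetric]
  proof (intro sum_mono)
    fix x y
    show "(if adj x y then v x * (\<psi> y - \<psi> x) else 0) + (if adj x y then v y * (\<psi> x - \<psi> y) else 0)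
      \<le> (1/2) * (if adj x y then (v x - v y)^2 else 0) + ((if adj x y then (if x \<in> \<Omega> then g^2/2 else 0) else 0) + (if adj x y then (if y \<in> \<Omega> then g^2/2 else 0) else 0))"
    proof (cases "adj x y \<and> (x \<in> \<Omega> \<or> y \<in> \<Omega>)")
      case True
      have "v x * (\<psi> y - \<psi> x) + v y * (\<psi> x - \<psi> y) = (v x - v y) * (\<psi> y - \<psi> x)" by (simp add: algebra_simps)
      also have "\<dots> \<le> (v x - v y)^2 / 2 + (\<psi> y - \<psi> x)^2 / 2"
        using sum_squares_bound[of "v x - v y" "\<psi> y - \<psi> x", unfolded mult.assoc] by linarith
      also have "(\<psi> y - \<psi> x)^2 \<le> g^2"
        using lip[of x y] True by (metis abs_ge_zero abs_minus_commute power2_abs power_mono)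
      finally have "v x * (\<psi> y - \<psi> x) + v y * (\<psi> x - \<psi> y) \<le> (v x - v y)^2 / 2 + g^2 / 2" by simp
      moreover have "g^2 / 2 \<le> g^2" by simp
      ultimately show ?thesis using True by (auto intro: order.trans)
    next
      case False
      then have "adj x y \<Longrightarrow> v x = 0 \<and> v y = 0" using v0(2)[of x] v0(2)[of y] unfolding \<Omega>_def by auto
      then show ?thesis by auto
    qed
  qed
  also have "\<dots> = dir ?W v / 2 + ((\<Sum>x\<in>?W. \<Sum>y\<in>?W. if adj x y then (if x \<in> \<Omega> then g^2/2 else 0) else 0)
     + (\<Sum>x\<in>?W. \<Sum>y\<in>?W. if adj x y then (if y \<in> \<Omega> then g^2/2 else 0) else 0))"
    unfolding sum.distrib dir_def sum_distrib_left[symmetric] by simp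
  also have "(\<Sum>x\<in>?W. \<Sum>y\<in>?W. if adj x y then (if y \<in> \<Omega> then g^2/2 else 0) else 0)
     = (\<Sum>x\<in>?W. \<Sum>y\<in>?W. if adj x y then (if x \<in> \<Omega> then g^2/2 else 0) else 0)"
    by (rule sum_adj_swap)
  also have "(\<Sum>x\<in>?W. \<Sum>y\<in>?W. if adj x y then (if x \<in> \<Omega> then g^2/2 else 0) else 0)
     = (\<Sum>x\<in>\<Omega>. \<Sum>y\<in>?W. if adj x y then g^2/2 else 0)"
    using finite_nbhd \<Omega> AW by (intro sum.mono_neutral_cong_right) (auto intro!: sum.neutral)
  also have "\<dots> \<le> (\<Sum>x\<in>\<Omega>. CU * (g^2/2))"
  proof (intro sum_mono)
    fix x
    have "(\<Sum>y\<in>?W. if adj x y then g^2/2 else 0) \<le> gdeg adj x * (g^2/2)"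
      using finite_nbhd by (intro sum_neighbors_le) auto
    also have "\<dots> \<le> CU * (g^2/2)" using gdeg_le[of x] by (intro mult_right_mono) auto
    finally show "(\<Sum>y\<in>?W. if adj x y then g^2/2 else 0) \<le> CU * (g^2/2)" .
  qed
  \<comment> \<open>Half of this energy is \<open>Q v\<close>, so \<open>T\<close> contains only
    half of \<open>Q v\<close>, which moves to the left-hand side.\<close>
  also have "dir ?W v \<le> 2 * Q v" using finite_nbhd v0 by (intro dir_le_Q_nonneg)
  finally have "2 * T \<le> Q v + CU * g^2 * card \<Omega>" by (simp add: algebra_simps)
  then show ?thesis using 1 unfolding \<Omega>_def by linarith
qed

text \<open>The off-diagonal part of the form is at most the degree part, so \<open>Q f\<close> is
  at most twice the diagonal part for every \<open>f\<close>. Point masses therefore need no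
  separation.\<close>

lemma card_le_N_diag:
  assumes S: "S \<subseteq> A" and diag: "\<And>x. x \<in> S \<Longrightarrow> 2 * diag x \<le> E"
  shows "card S / card A \<le> N E"
proof (rule card_le_IDS[OF finite_A nonempty_A adj_sym adm, where \<psi> = "\<lambda>t x. if x = t then 1 else 0"])
  show S': "finite S" using S finite_A by (rule finite_subset)
  fix s :: "'v \<Rightarrow> real" assume s: "\<exists>t\<in>S. s t \<noteq> 0"
  define f where "f x = (\<Sum>t\<in>S. s t * (if x = t then 1 else 0))" for x
  have f: "f x = (if x \<in> S then s x else 0)" for x unfolding f_def using S' by (simp add: if_distrib cong: if_cong)
  show "\<exists>x\<in>A. (\<Sum>t\<in>S. s t * (if x = t then 1 else 0)) \<noteq> 0"
    unfolding f_def[symmetric] f using s S by auto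
  have "- (\<Sum>x\<in>A. \<Sum>y\<in>A. if adj x y then \<mu> x y * (f x * f y) else 0) \<le> (1/2) * (\<Sum>x\<in>A. \<Sum>y\<in>A. if adj x y then (f x)^2 + (f y)^2 else 0)"
    unfolding sum_negf[symmetric] sum_distrib_left
  proof (intro sum_mono)
    fix x y
    show "- (if adj x y then \<mu> x y * (f x * f y) else 0) \<le> (1/2) * (if adj x y then (f x)^2 + (f y)^2 else 0)"
    proof (cases "adj x y")
      case True
      have "- (\<mu> x y * (f x * f y)) \<le> \<mu> x y * \<bar>f x * f y\<bar>"
        using mu_nonneg[OF True] by (simp add: abs_mult_pos minus_le_iff flip: mult_minus_right) (intro mult_left_mono, auto)
      also have "\<dots> \<le> 1 * \<bar>f x * f y\<bar>" using mu_le_1[OF True] by (intro mult_right_mono) auto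
      also have "\<dots> \<le> (1/2) * ((f x)^2 + (f y)^2)"
        using sum_squares_bound[of "\<bar>f x\<bar>" "\<bar>f y\<bar>"] by (simp add: abs_mult)
      finally show ?thesis using True by simp
    qed simp
  qed
  also have "\<dots> \<le> (\<Sum>x\<in>A. gdeg adj x * (f x)^2)" using sum_adj_squares_le[of f] by simp
  also have "\<dots> \<le> (\<Sum>x\<in>A. diag x * (f x)^2)"
    using V_nonneg by (intro sum_mono mult_right_mono) auto
  finally have "Q f \<le> 2 * (\<Sum>x\<in>A. diag x * (f x)^2)" unfolding Q_expand by linarith
  also have "\<dots> = (\<Sum>x\<in>A. 2 * diag x * (f x)^2)" unfolding sum_distrib_left by (simp only: mult.assoc)
  also have "\<dots> \<le> (\<Sum>x\<in>A. E * (f x)^2)"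
    using diag by (intro sum_mono) (auto simp: f intro!: mult_right_mono)
  finally have "Q f \<le> E * (\<Sum>x\<in>A. (f x)^2)" by (simp only: sum_distrib_left)
  then show "Q (\<lambda>x. \<Sum>t\<in>S. s t * (if x = t then 1 else 0)) \<le> E * (\<Sum>x\<in>A. (\<Sum>t\<in>S. s t * (if x = t then 1 else 0))^2)"
    unfolding f_def .
qed

text \<open>Supports that are disjoint and not joined by an edge do not interact: norm and form of a
  combination are sums of the individual ones weighted by squared coefficients.\<close>

lemma card_le_N_separated:
  fixes \<phi> :: "'t \<Rightarrow> 'v \<Rightarrow> real"
  assumes T: "finite T" and sep: "\<And>s t x y. s \<in> T \<Longrightarrow> t \<in> T \<Longrightarrow> s \<noteq> t \<Longrightarrow> \<phi> s x \<noteq> 0 \<Longrightarrow> \<phi> t y \<noteq> 0 \<Longrightarrow> x \<noteq> y \<and> \<not> adj x y"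
    and pos: "\<And>t. t \<in> T \<Longrightarrow> (\<Sum>x\<in>A. (\<phi> t x)^2) > 0" and E: "\<And>t. t \<in> T \<Longrightarrow> Q (\<phi> t) \<le> E * (\<Sum>x\<in>A. (\<phi> t x)^2)"
  shows "card T / card A \<le> N E"
proof (rule card_le_IDS[OF finite_A nonempty_A adj_sym adm T, where \<psi> = \<phi>])
  fix s :: "'t \<Rightarrow> real" assume s: "\<exists>t\<in>T. s t \<noteq> 0"
  define f where "f x = (\<Sum>t\<in>T. s t * \<phi> t x)" for x
  have prod: "f x * f y = (\<Sum>t\<in>T. (s t)^2 * (\<phi> t x * \<phi> t y))" if "x = y \<or> adj x y" for x y
  proof -
    have "f x * f y = (\<Sum>t\<in>T. \<Sum>t'\<in>T. (s t * \<phi> t x) * (s t' * \<phi> t' y))"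
      unfolding f_def sum_product ..
    also have "\<dots> = (\<Sum>t\<in>T. \<Sum>t'\<in>T. if t' = t then (s t * \<phi> t x) * (s t * \<phi> t y) else 0)"
      using sep that by (intro sum.cong refl) auto
    also have "\<dots> = (\<Sum>t\<in>T. (s t)^2 * (\<phi> t x * \<phi> t y))"
      using T by (simp add: power2_eq_square mult_ac)
    finally show ?thesis .
  qed
  have f2: "(f x)^2 = (\<Sum>t\<in>T. (s t)^2 * (\<phi> t x)^2)" for x
    using prod[of x x] by (simp add: power2_eq_square)
  have sum2: "(\<Sum>x\<in>A. (f x)^2) = (\<Sum>t\<in>T. (s t)^2 * (\<Sum>x\<in>A. (\<phi> t x)^2))"
    unfolding f2 sum_distrib_left by (rule sum.swap)
  have Qf: "Q f = (\<Sum>t\<in>T. (s t)^2 * Q (\<phi> t))"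
  proof -
    have "(\<Sum>x\<in>A. diag x * (f x)^2) = (\<Sum>t\<in>T. (s t)^2 * (\<Sum>x\<in>A. diag x * (\<phi> t x)^2))"
      unfolding f2 sum_distrib_left by (subst sum.swap) (simp add: mult.left_commute)
    moreover have "(\<Sum>x\<in>A. \<Sum>y\<in>A. if adj x y then \<mu> x y * (f x * f y) else 0)
       = (\<Sum>t\<in>T. (s t)^2 * (\<Sum>x\<in>A. \<Sum>y\<in>A. if adj x y then \<mu> x y * (\<phi> t x * \<phi> t y) else 0))"
    proof -
      have "(\<Sum>x\<in>A. \<Sum>y\<in>A. if adj x y then \<mu> x y * (f x * f y) else 0)
        = (\<Sum>x\<in>A. \<Sum>y\<in>A. \<Sum>t\<in>T. (s t)^2 * (if adj x y then \<mu> x y * (\<phi> t x * \<phi> t y) else 0))"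
        by (intro sum.cong refl) (auto simp: prod sum_distrib_left mult_ac)
      also have "\<dots> = (\<Sum>x\<in>A. \<Sum>t\<in>T. \<Sum>y\<in>A. (s t)^2 * (if adj x y then \<mu> x y * (\<phi> t x * \<phi> t y) else 0))"
        by (intro sum.cong refl sum.swap)
      also have "\<dots> = (\<Sum>t\<in>T. \<Sum>x\<in>A. \<Sum>y\<in>A. (s t)^2 * (if adj x y then \<mu> x y * (\<phi> t x * \<phi> t y) else 0))"
        by (rule sum.swap)
      finally show ?thesis by (simp add: sum_distrib_left)
    qed
    ultimately show ?thesis unfolding Q_expand by (simp add: right_diff_distrib sum_subtractf)
  qed
  have "Q f \<le> (\<Sum>t\<in>T. (s t)^2 * (E * (\<Sum>x\<in>A. (\<phi> t x)^2)))"
    unfolding Qf using E by (intro sum_mono mult_left_mono) auto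
  also have "\<dots> = E * (\<Sum>x\<in>A. (f x)^2)" unfolding sum2 sum_distrib_left by (simp add: mult_ac)
  finally show "Q (\<lambda>x. \<Sum>t\<in>T. s t * \<phi> t x) \<le> E * (\<Sum>x\<in>A. (\<Sum>t\<in>T. s t * \<phi> t x)^2)"
    unfolding f_def .
  obtain t where t: "t \<in> T" "s t \<noteq> 0" using s by blast
  have "0 < (\<Sum>t\<in>T. (s t)^2 * (\<Sum>x\<in>A. (\<phi> t x)^2))"
    using t T pos by (intro sum_pos2[of _ t]) (auto intro!: mult_nonneg_nonneg sum_nonneg)
  then have "(\<Sum>x\<in>A. (f x)^2) \<noteq> 0" unfolding sum2 by simp
  then obtain x where "x \<in> A" "(f x)^2 \<noteq> 0" by (meson sum.not_neutral_contains_not_neutral)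
  then show "\<exists>x\<in>A. (\<Sum>t\<in>T. s t * \<phi> t x) \<noteq> 0" unfolding f_def by auto
qed

end

section \<open>Localized test functions\<close>

text \<open>The fast geometric convergence of De Giorgi: an exponent above 1 beats the growth
  \<open>2^(k+3)\<close> once the start is small. The value of \<open>q\<close> solves
  \<open>(2 * q) powr (1+1/\<alpha>) = q\<close>, and \<open>\<epsilon>\<close> is chosen so that
  \<open>K * 8 powr (1+1/\<alpha>) * \<epsilon> powr (1/\<alpha>) = q\<close>; then the induction
  closes exactly.\<close>

lemma superlinear_recursion_decay:
  fixes a :: "nat \<Rightarrow> real" and \<alpha> K :: real
  defines "q \<equiv> 2 powr (-(\<alpha>+1))"
  defines "\<epsilon> \<equiv> (q / (K * 8 powr (1+1/\<alpha>))) powr \<alpha>"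
  assumes \<alpha>: "\<alpha> > 0" and K: "K > 0" and a: "\<And>k. a k \<ge> 0"
    and rec: "\<And>k. a (Suc k) \<le> K * (2^(k+3) * a k) powr (1+1/\<alpha>)" and init: "a 0 \<le> \<epsilon>"
  shows "a k \<le> \<epsilon> * q ^ k"
proof (induction k)
  case 0
  then show ?case using init by simp
next
  case (Suc k)
  have q: "q > 0" unfolding q_def by simp
  have \<epsilon>: "\<epsilon> > 0" unfolding \<epsilon>_def using q K by simp
  have p: "(2 * q) powr (1+1/\<alpha>) = q"
  proof -
    have "2 * q = 2 powr (-\<alpha>)" unfolding q_def powr_minus powr_add by simp
    then have "(2 * q) powr (1+1/\<alpha>) = 2 powr (-\<alpha> * (1+1/\<alpha>))" by (simp add: powr_powr)
    also have "-\<alpha> * (1+1/\<alpha>) = -(\<alpha>+1)" using \<alpha> by (simp add: field_simps)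
    finally show ?thesis unfolding q_def .
  qed
  have "a (Suc k) \<le> K * (2^(k+3) * (\<epsilon> * q ^ k)) powr (1+1/\<alpha>)"
    using rec[of k] Suc a[of k] \<alpha> K
    by (intro order.trans[OF rec] mult_left_mono powr_mono2) auto
  also have "2^(k+3) * (\<epsilon> * q ^ k) = 8 * \<epsilon> * (2 * q)^k" by (simp add: power_add power_mult_distrib)
  also have "(8 * \<epsilon> * (2 * q)^k) powr (1+1/\<alpha>) = 8 powr (1+1/\<alpha>) * (\<epsilon> powr (1+1/\<alpha>)) * ((2 * q)^k) powr (1+1/\<alpha>)"
    using \<epsilon> q by (simp add: powr_mult)
  also have "((2 * q)^k) powr (1+1/\<alpha>) = ((2 * q) powr (1+1/\<alpha>))^k"
  proof -
    have "((2 * q)^k) powr (1+1/\<alpha>) = ((2 * q) powr real k) powr (1+1/\<alpha>)"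
      using q by (subst powr_realpow) auto
    also have "\<dots> = ((2 * q) powr (1+1/\<alpha>)) powr real k" by (simp only: powr_powr mult.commute)
    also have "\<dots> = ((2 * q) powr (1+1/\<alpha>))^k" using q by (subst powr_realpow) auto
    finally show ?thesis .
  qed
  also have "\<epsilon> powr (1+1/\<alpha>) = \<epsilon> * (q / (K * 8 powr (1+1/\<alpha>)))"
  proof -
    have "\<epsilon> powr (1/\<alpha>) = q / (K * 8 powr (1+1/\<alpha>))"
      unfolding \<epsilon>_def powr_powr using \<alpha> q K by simp
    then show ?thesis using \<epsilon> by (simp add: powr_add)
  qed
  also have "K * (8 powr (1+1/\<alpha>) * (\<epsilon> * (q / (K * 8 powr (1+1/\<alpha>)))) * ((2 * q) powr (1+1/\<alpha>))^k) = \<epsilon> * q ^ Suc k"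
    unfolding p using K by simp
  finally show ?case .
qed

context poincare_graph
begin

text \<open>The constants are fixed here, before \<open>\<mu>\<close>, \<open>V\<close> and \<open>A\<close> enter, so that they depend on the graph only.\<close>

definition fk_const :: real where
  "fk_const = (SOME CF. CF > 0 \<and> (\<forall>\<Omega> f D. finite \<Omega> \<longrightarrow> \<Omega> \<noteq> {} \<longrightarrow> (\<forall>x. x \<notin> \<Omega> \<longrightarrow> f x = 0) \<longrightarrow>
       (\<forall>U. finite U \<longrightarrow> dir U f \<le> D) \<longrightarrow>
       (\<Sum>x\<in>\<Omega>. (f x)^2) \<le> CF * real (card \<Omega>) powr (2/\<alpha>) * D))"

lemma fk_const_pos: "fk_const > 0"
  and fk_ineq: "\<lbrakk>finite \<Omega>; \<Omega> \<noteq> {}; \<And>x. x \<notin> \<Omega> \<Longrightarrow> f x = 0; \<And>U. finite U \<Longrightarrow> dir U f \<le> D\<rbrakk> \<Longrightarrow>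
       (\<Sum>x\<in>\<Omega>. (f x)^2) \<le> fk_const * real (card \<Omega>) powr (2/\<alpha>) * D"
proof -
  obtain CF where CF: "CF > 0"
    "\<And>\<Omega> f D. finite \<Omega> \<Longrightarrow> \<Omega> \<noteq> {} \<Longrightarrow> (\<And>x. x \<notin> \<Omega> \<Longrightarrow> f x = 0) \<Longrightarrow>
       (\<And>U. finite U \<Longrightarrow> dir U f \<le> D) \<Longrightarrow>
       (\<Sum>x\<in>\<Omega>. (f x)^2) \<le> CF * real (card \<Omega>) powr (2/\<alpha>) * D" using faber_krahn by blast
  then have "\<exists>CF. CF > 0 \<and> (\<forall>\<Omega> f D. finite \<Omega> \<longrightarrow> \<Omega> \<noteq> {} \<longrightarrow> (\<forall>x. x \<notin> \<Omega> \<longrightarrow> f x = 0) \<longrightarrow>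
       (\<forall>U. finite U \<longrightarrow> dir U f \<le> D) \<longrightarrow>
       (\<Sum>x\<in>\<Omega>. (f x)^2) \<le> CF * real (card \<Omega>) powr (2/\<alpha>) * D)"
    by (intro exI[of _ CF]) simp
  from someI_ex[OF this, folded fk_const_def]
  show "fk_const > 0" "\<lbrakk>finite \<Omega>; \<Omega> \<noteq> {}; \<And>x. x \<notin> \<Omega> \<Longrightarrow> f x = 0; \<And>U. finite U \<Longrightarrow> dir U f \<le> D\<rbrakk> \<Longrightarrow>
       (\<Sum>x\<in>\<Omega>. (f x)^2) \<le> fk_const * real (card \<Omega>) powr (2/\<alpha>) * D" by simp_all
qed

text \<open>The threshold of \<open>superlinear_recursion_decay\<close> for
  \<open>K = sqrt (32 * fk_const * CU)\<close>, the constant of the recursion in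
  \<open>cone_mass_lower_bound\<close>.\<close>

definition mass_const :: real where
  "mass_const = (2 powr (-(\<alpha>+1)) / (sqrt (32 * fk_const * CU) * 8 powr (1+1/\<alpha>))) powr \<alpha>"

text \<open>The sum of the bounds that \<open>cone_test_function\<close> meets for
  \<open>u z \<ge> 1\<close> and for \<open>u z < 1\<close>.\<close>

definition test_const :: real where
  "test_const = 24 * CU^3 / mass_const^2 + 18 * CU"

lemma mass_const_pos: "mass_const > 0"
  unfolding mass_const_def using fk_const_pos CU_pos by simp

lemma test_const_pos: "test_const > 0"
  unfolding test_const_def using mass_const_pos CU_pos by (intro add_pos_pos) auto

end

section \<open>Truncations of the landscape function by cones\<close>

locale poincare_landscape = poincare_graph adj \<alpha> CL CU CP lam + landscape_graph adj \<alpha> CL CU \<mu> V A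
  for adj :: "'v \<Rightarrow> 'v \<Rightarrow> bool" and \<alpha> CL CU CP lam :: real and \<mu> V A
begin

text \<open>The slope \<open>4 * u z / r\<close> brings the truncation to 0 within distance
  \<open>r\<close> wherever \<open>u \<le> 4 * u z\<close>. That bound is available only up to
  distance \<open>2 * r\<close>, hence the cutoff.\<close>

definition cone :: "'v \<Rightarrow> real \<Rightarrow> real \<Rightarrow> 'v \<Rightarrow> real" where
  "cone z r t x = (if x \<in> A \<and> real (dst z x) \<le> 2 * r then max 0 (u x - 4 * u z * dst z x / r - t) else 0)"

lemma cone_nonneg: "cone z r t x \<ge> 0" and cone_off: "x \<notin> A \<Longrightarrow> cone z r t x = 0"
  unfolding cone_def by auto

lemma finite_cone_support: "finite {x. cone z r t x > 0}"
  by (rule finite_subset[OF _ finite_A]) (auto simp: cone_def split: if_splits)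

lemma sum_cone_support: "(\<Sum>x\<in>A. cone z r t x ^ Suc k) = (\<Sum>x\<in>{x. cone z r t x > 0}. cone z r t x ^ Suc k)"
proof (rule sum.mono_neutral_right[OF finite_A])
  show "{x. cone z r t x > 0} \<subseteq> A" by (auto simp: cone_def split: if_splits)
  show "\<forall>x\<in>A - {x. cone z r t x > 0}. cone z r t x ^ Suc k = 0"
    using cone_nonneg[of z r t] by (auto simp: not_less intro!: antisym)
qed

lemma cone_center: "z \<in> A \<Longrightarrow> r \<ge> 0 \<Longrightarrow> cone z r t z = max 0 (u z - t)"
  unfolding cone_def by simp

lemma cone_antimono: "s \<le> t \<Longrightarrow> cone z r t x \<le> cone z r s x"
  unfolding cone_def by auto

lemma cone_shift: "cone z r t x > 0 \<Longrightarrow> cone z r s x \<ge> t - s"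
  unfolding cone_def by (auto split: if_splits)

context
  fixes z :: 'v and r :: real
  assumes z: "z \<in> A" and r: "r \<ge> 1"
    and bound: "\<And>y. y \<in> A \<Longrightarrow> real (dst z y) \<le> 2 * r \<Longrightarrow> u y \<le> 4 * u z"
begin

lemma uz: "u z > 0" using landscape_pos[OF z] .

lemma cone_support:
  assumes "t \<ge> 0" "cone z r t x > 0"
  shows "x \<in> A" "real (dst z x) < r"
proof -
  have x: "x \<in> A" "real (dst z x) \<le> 2 * r" "u x - 4 * u z * dst z x / r - t > 0"
    using assms(2) unfolding cone_def by (auto split: if_splits)
  then have "4 * u z * dst z x / r < 4 * u z" using bound[of x] assms(1) by linarith
  then have "4 * u z * dst z x < 4 * u z * r" using r by (simp add: pos_divide_less_eq)
  then show "real (dst z x) < r" using uz by simp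
  show "x \<in> A" by fact
qed

lemma cone_le: "t \<ge> 0 \<Longrightarrow> cone z r t x \<le> 4 * u z"
proof -
  assume t: "t \<ge> 0"
  have "4 * u z * dst z x / r \<ge> 0" using uz r by simp
  then have "u x - 4 * u z * dst z x / r - t \<le> u x" using t by linarith
  then show ?thesis unfolding cone_def using bound[of x] uz by (auto intro: order.trans)
qed

lemma cone_energy:
  assumes t: "t \<ge> 0"
  shows "Q (cone z r t) \<le> 2 * (\<Sum>x\<in>A. cone z r t x) + CU * (4 * u z / r)^2 * card {x. cone z r t x > 0}"
proof (rule truncation_energy[where \<psi> = "\<lambda>x. 4 * u z * dst z x / r + t"])
  fix x y
  show "4 * u z * dst z x / r + t \<ge> 0" using uz r t by simp
  show "cone z r t x = u x - (4 * u z * dst z x / r + t)" if "cone z r t x > 0"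
    using that unfolding cone_def by (auto split: if_splits)
  show "cone z r t y \<ge> u y - (4 * u z * dst z y / r + t)" if xy: "cone z r t x > 0" "y \<in> A" "adj x y"
  proof -
    \<comment> \<open>A neighbour of the support is within \<open>r + 1\<close>, and
      \<open>r \<ge> 1\<close>: the cutoff at \<open>2 * r\<close> does not touch the neighbours
      that enter the energy estimate.\<close>
    have "real (dst z y) \<le> 2 * r"
      using cone_support(2)[OF t xy(1)] dst_triangle[of z y x] dst_adj[OF xy(3)] r by linarith
    then show ?thesis using xy unfolding cone_def by simp
  qed
  show "\<bar>4 * u z * dst z x / r + t - (4 * u z * dst z y / r + t)\<bar> \<le> 4 * u z / r" if xy: "adj x y"
  proof -
    have "4 * u z * dst z x / r + t - (4 * u z * dst z y / r + t) = 4 * u z / r * (real (dst z x) - real (dst z y))"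
      by (simp add: algebra_simps diff_divide_distrib)
    moreover have "\<bar>real (dst z x) - real (dst z y)\<bar> \<le> 1"
      using dst_triangle[of z y x] dst_triangle[of z x y] dst_adj[OF xy] dst_sym[of x y] by linarith
    moreover have "4 * u z / r \<ge> 0" using uz r by simp
    ultimately show ?thesis
      using mult_left_mono[of "\<bar>real (dst z x) - real (dst z y)\<bar>" 1 "4 * u z / r"] uz r
      by (simp add: abs_mult)
  qed
qed (use cone_nonneg cone_off in auto)

lemma cone_energy_simplified:
  assumes t: "t \<ge> 0" and ur: "u z \<le> r^2"
  shows "Q (cone z r t) \<le> 2 * (\<Sum>x\<in>A. cone z r t x) + 16 * CU * u z * card {x. cone z r t x > 0}"
proof -
  have "(4 * u z / r)^2 = 16 * u z * (u z / r^2)" by (simp add: power2_eq_square)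
  also have "\<dots> \<le> 16 * u z * 1" using uz ur r by (intro mult_left_mono) auto
  finally have "CU * (4 * u z / r)^2 * card {x. cone z r t x > 0} \<le> CU * (16 * u z) * card {x. cone z r t x > 0}"
    using CU_pos by (intro mult_right_mono mult_left_mono) auto
  then show ?thesis using cone_energy[OF t] by (simp add: mult_ac)
qed

text \<open>Cauchy-Schwarz passes from the sum to the sum of squares, Faber-Krahn to the energy, and
  the truncation estimate back to mass and support size. The condition \<open>t < u z\<close> keeps
  \<open>z\<close> in the support.\<close>

lemma cone_mass_ineq:
  assumes t: "t \<ge> 0" "t < u z" and ur: "u z \<le> r^2"
  defines "g \<equiv> \<Sum>x\<in>A. cone z r t x" and "n \<equiv> real (card {x. cone z r t x > 0})"
  shows "g^2 \<le> 32 * fk_const * CU * n powr (1 + 2/\<alpha>) * (g + u z * n)"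
proof -
  let ?\<Omega> = "{x. cone z r t x > 0}"
  have "cone z r t z > 0" using cone_center[OF z, of r t] r t by simp
  then have ne: "?\<Omega> \<noteq> {}" by blast
  then have n: "n > 0" unfolding n_def using finite_cone_support by (simp add: card_gt_0_iff)
  have g0: "g \<ge> 0" unfolding g_def using cone_nonneg by (intro sum_nonneg) auto
  have "Q (cone z r t) \<le> 2 * g + 16 * CU * u z * n"
    using cone_energy_simplified[OF t(1) ur] unfolding g_def n_def .
  also have "\<dots> \<le> 16 * CU * g + 16 * CU * u z * n"
    using mult_right_mono[of 2 "16 * CU" g] g0 CU_ge_1 by simp
  finally have Q: "2 * Q (cone z r t) \<le> 32 * CU * (g + u z * n)" by (simp add: algebra_simps)
  have "g^2 = (\<Sum>x\<in>?\<Omega>. cone z r t x)^2" unfolding g_def using sum_cone_support[of z r t 0] by simp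
  also have "\<dots> \<le> n * (\<Sum>x\<in>?\<Omega>. (cone z r t x)^2)"
    unfolding n_def by (rule sum_squared_le_card[OF finite_cone_support])
  also have "\<dots> \<le> n * (fk_const * n powr (2/\<alpha>) * (32 * CU * (g + u z * n)))"
  proof -
    have "(\<Sum>x\<in>?\<Omega>. (cone z r t x)^2) \<le> fk_const * real (card ?\<Omega>) powr (2/\<alpha>) * (32 * CU * (g + u z * n))"
    proof (rule fk_ineq[OF finite_cone_support ne])
      fix x assume "x \<notin> ?\<Omega>"
      then show "cone z r t x = 0" using cone_nonneg[of z r t x] by simp
    next
      fix U :: "'v set" assume "finite U"
      then show "dir U (cone z r t) \<le> 32 * CU * (g + u z * n)"
        using dir_le_Q_nonneg[of U "cone z r t"] cone_off cone_nonneg Q by force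
    qed
    then show ?thesis using n unfolding n_def[symmetric] by (intro mult_left_mono) auto
  qed
  also have "\<dots> = 32 * fk_const * CU * n powr (1 + 2/\<alpha>) * (g + u z * n)"
    using n by (simp add: powr_add)
  finally show ?thesis .
qed

text \<open>If the mass were below the threshold, the masses at rising levels would tend to 0. The
  levels never exceed \<open>u z / 2\<close>, however, so the value at the centre keeps every mass
  at least \<open>u z / 2\<close>.\<close>

lemma cone_mass_lower_bound:
  assumes ur: "u z = r^2"
  shows "(\<Sum>x\<in>A. cone z r 0 x) \<ge> mass_const * r powr (\<alpha> + 2)"
proof (rule ccontr)
  assume small: "\<not> (\<Sum>x\<in>A. cone z r 0 x) \<ge> mass_const * r powr (\<alpha> + 2)"
  define t where "t k = u z / 2 * (1 - 1 / 2^k)" for k :: nat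
  define g where "g k = (\<Sum>x\<in>A. cone z r (t k) x)" for k
  \<comment> \<open>Division by \<open>r powr (\<alpha> + 2)\<close>, the size of \<open>u z\<close>
    times the volume of the ball, frees the recursion of \<open>r\<close> and
    \<open>u z\<close>.\<close>
  define a where "a k = g k / r powr (\<alpha> + 2)" for k
  define K where "K = sqrt (32 * fk_const * CU)"
  have K: "K > 0" unfolding K_def using fk_const_pos CU_pos by simp
  have \<alpha>: "\<alpha> > 0" using alpha_ge_1 by simp
  have r0: "r > 0" using r by simp
  have t: "t k \<ge> 0" "t k \<le> u z / 2" for k
    unfolding t_def using uz by (auto simp: field_simps)
  have t_step: "t (Suc k) - t k = u z / 2^(k+2)" for k unfolding t_def by (simp add: field_simps)
  have g0: "g k \<ge> 0" for k unfolding g_def using cone_nonneg by (intro sum_nonneg) auto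
  have rec: "a (Suc k) \<le> K * (2^(k+3) * a k) powr (1+1/\<alpha>)" for k
  proof -
    define n where "n = real (card {x. cone z r (t (Suc k)) x > 0})"
    define y where "y = 2^(k+3) * g k"
    have y0: "y \<ge> 0" unfolding y_def using g0 by simp
    \<comment> \<open>Chebyshev: a point surviving at the next level exceeds the present level by at
      least the gap between the two.\<close>
    have "n * (u z / 2^(k+2)) = (\<Sum>x\<in>{x. cone z r (t (Suc k)) x > 0}. u z / 2^(k+2))" unfolding n_def by simp
    also have "\<dots> \<le> (\<Sum>x\<in>{x. cone z r (t (Suc k)) x > 0}. cone z r (t k) x)"
      using cone_shift[of z r "t (Suc k)" _ "t k"] t_step[of k] by (intro sum_mono) auto
    also have "\<dots> \<le> g k"
      unfolding g_def using cone_support(1)[OF t(1)] cone_nonneg by (intro sum_mono2 finite_A) auto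
    finally have n1: "u z * n \<le> 2^(k+2) * g k" by (simp add: field_simps)
    have n2: "n \<le> y / u z"
    proof -
      have "2^(k+2) * g k \<le> y" unfolding y_def using g0[of k] by (simp add: power_add)
      then show ?thesis using n1 uz by (simp add: pos_le_divide_eq mult.commute)
    qed
    have "g (Suc k) \<le> g k"
      unfolding g_def using t_step[of k] uz by (intro sum_mono cone_antimono) (smt (verit) divide_pos_pos zero_less_power)
    also have "g k \<le> 2^(k+2) * g k" using g0[of k] mult_right_mono[of 1 "2^(k+2)" "g k"] one_le_power[of "2::real" "k+2"] by simp
    finally have n3: "g (Suc k) + u z * n \<le> y" using n1 unfolding y_def by (simp add: power_add)
    have "t (Suc k) < u z" using t(2)[of "Suc k"] uz by linarith
    then have "(g (Suc k))^2 \<le> 32 * fk_const * CU * n powr (1 + 2/\<alpha>) * (g (Suc k) + u z * n)"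
      unfolding g_def n_def using t(1) ur by (intro cone_mass_ineq) auto
    also have "\<dots> \<le> K^2 * (y / u z) powr (1 + 2/\<alpha>) * y"
    proof -
      have "n powr (1 + 2/\<alpha>) \<le> (y / u z) powr (1 + 2/\<alpha>)" using n2 \<alpha> by (intro powr_mono2) (auto simp: n_def)
      moreover have "K^2 = 32 * fk_const * CU" unfolding K_def using fk_const_pos CU_pos by simp
      ultimately show ?thesis using n3 y0 g0[of "Suc k"] uz fk_const_pos CU_pos
        by (intro mult_mono) (auto simp: n_def less_imp_le intro!: add_nonneg_nonneg mult_nonneg_nonneg)
    qed
    \<comment> \<open>Here \<open>u z = r^2\<close> is used: it lets a factor \<open>y\<close> be
      written as \<open>r^2 * (y / u z)\<close>, which completes the square.\<close>
    also have "\<dots> = (K * r * (y / u z) powr (1 + 1/\<alpha>))^2"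
    proof (cases "y = 0")
      case False
      then have y: "y / u z > 0" using y0 uz by simp
      have "((y / u z) powr (1 + 1/\<alpha>))^2 = (y / u z) powr ((1 + 2/\<alpha>) + 1)"
        using y by (simp add: powr_numeral[symmetric] powr_powr algebra_simps)
      also have "\<dots> = (y / u z) powr (1 + 2/\<alpha>) * (y / u z)" using y y0 uz by (subst powr_add) simp
      finally have "(K * r * (y / u z) powr (1 + 1/\<alpha>))^2 = K^2 * r^2 * ((y / u z) powr (1 + 2/\<alpha>) * (y / u z))"
        by (simp add: power_mult_distrib)
      then show ?thesis using ur uz by simp
    qed simp
    finally have "g (Suc k) \<le> K * r * (y / u z) powr (1 + 1/\<alpha>)"
      by (rule power2_le_imp_le) (use K r0 in simp)
    also have "y / u z = (2^(k+3) * a k) * r powr \<alpha>"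
    proof -
      have "r powr (\<alpha> + 2) = r powr \<alpha> * r^2" using r0 by (simp add: powr_add powr_numeral)
      then show ?thesis unfolding y_def a_def ur using r0 by (simp add: field_simps)
    qed
    also have "((2^(k+3) * a k) * r powr \<alpha>) powr (1 + 1/\<alpha>) = (2^(k+3) * a k) powr (1 + 1/\<alpha>) * r powr (\<alpha> + 1)"
    proof -
      have "(r powr \<alpha>) powr (1 + 1/\<alpha>) = r powr (\<alpha> + 1)" unfolding powr_powr using \<alpha> by (simp add: distrib_left)
      moreover have "a k \<ge> 0" unfolding a_def using g0 by simp
      ultimately show ?thesis by (subst powr_mult) auto
    qed
    finally have "g (Suc k) \<le> K * (2^(k+3) * a k) powr (1 + 1/\<alpha>) * (r * r powr (\<alpha> + 1))" by (simp add: mult_ac)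
    also have "r * r powr (\<alpha> + 1) = r powr (\<alpha> + 2)"
      using r0 powr_add[of r "\<alpha> + 1" 1] by (simp add: mult.commute add.assoc)
    finally show ?thesis unfolding a_def[of "Suc k"] using r0 by (simp add: pos_divide_le_eq)
  qed
  define q where "q = 2 powr (-(\<alpha>+1))"
  have init: "a 0 \<le> mass_const"
    using small r0 unfolding a_def g_def t_def by (simp add: pos_divide_le_eq)
  have decay: "a k \<le> mass_const * q^k" for k
    using superlinear_recursion_decay[OF \<alpha> K _ rec] init g0
    unfolding mass_const_def q_def K_def a_def by simp
  have lower: "a k \<ge> u z / 2 / r powr (\<alpha> + 2)" for k
  proof -
    have "u z / 2 \<le> cone z r (t k) z" using cone_center[OF z, of r "t k"] r t[of k] by simp
    also have "\<dots> \<le> g k" unfolding g_def using z finite_A cone_nonneg by (intro member_le_sum) auto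
    finally show ?thesis unfolding a_def by (intro divide_right_mono) auto
  qed
  have "q < 1" unfolding q_def using \<alpha> powr_less_one[of 2 "-(\<alpha>+1)"] by simp
  moreover define c where "c = u z / 2 / r powr (\<alpha> + 2)"
  moreover have "c / mass_const > 0" unfolding c_def using uz r0 mass_const_pos by simp
  ultimately obtain k where "q ^ k < c / mass_const" using real_arch_pow_inv by blast
  then have "mass_const * q ^ k < c" using mass_const_pos by (simp add: pos_less_divide_eq mult.commute)
  then show False using decay[of k] lower[of k] unfolding c_def by linarith
qed

end

text \<open>For \<open>u z \<ge> 1\<close> the energy is at most of order
  \<open>u z * r powr \<alpha>\<close>, while the mass bound and Cauchy-Schwarz force the squared
  norm to be at least of order \<open>(u z)^2 * r powr \<alpha>\<close>. For \<open>u z < 1\<close>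
  the radius is 1 and the cone is a point mass at \<open>z\<close>.\<close>

lemma cone_test_function:
  assumes z: "z \<in> A" and r: "r = max 1 (sqrt (u z))"
    and bound: "\<And>y. y \<in> A \<Longrightarrow> real (dst z y) \<le> 2 * r \<Longrightarrow> u y \<le> 4 * u z"
  shows "u z * Q (cone z r 0) \<le> test_const * (\<Sum>x\<in>A. (cone z r 0 x)^2)"
proof -
  define M where "M = u z"
  let ?\<Omega> = "{x. cone z r 0 x > 0}"
  define n where "n = real (card ?\<Omega>)"
  define g where "g = (\<Sum>x\<in>A. cone z r 0 x)"
  define S where "S = (\<Sum>x\<in>A. (cone z r 0 x)^2)"
  have M: "M > 0" unfolding M_def using landscape_pos[OF z] .
  have r1: "r \<ge> 1" unfolding r by simp
  have Mr: "M \<le> r^2"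
  proof -
    have "M = (sqrt M)^2" using M by simp
    also have "\<dots> \<le> r^2" unfolding r M_def[symmetric] by (intro power_mono) (use M in auto)
    finally show ?thesis .
  qed
  have S0: "S \<ge> 0" unfolding S_def by (intro sum_nonneg) simp
  have energy: "Q (cone z r 0) \<le> 2 * g + 16 * CU * M * n"
    using cone_energy_simplified[OF z r1 bound _ Mr[unfolded M_def]] unfolding g_def n_def M_def by simp
  have supp: "real (dst z x) < r" "x \<in> A" if "cone z r 0 x > 0" for x
    using cone_support[OF z r1 bound _ that] by auto
  show ?thesis unfolding M_def[symmetric] S_def[symmetric]
  proof (cases "M \<ge> 1")
    case True
    then have rM: "M = r^2" unfolding r M_def[symmetric] using M by (simp add: max_def)
    have "g = (\<Sum>x\<in>?\<Omega>. cone z r 0 x)" unfolding g_def using sum_cone_support[of z r 0 0] by simp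
    also have "\<dots> \<le> n * (4 * M)"
      unfolding n_def M_def using cone_le[OF z r1 bound] by (intro sum_bounded_above) auto
    finally have g_le: "g \<le> 4 * M * n" by (simp add: mult.commute)
    have "n \<le> card (ball z r)"
      unfolding n_def using supp by (intro of_nat_mono card_mono finite_ball) (auto simp: mem_ball less_imp_le)
    also have "\<dots> \<le> CU * r powr \<alpha>" by (rule card_ball_le[OF r1])
    finally have n_le: "n \<le> CU * r powr \<alpha>" .
    have "mass_const * r powr (\<alpha> + 2) \<le> g"
      using cone_mass_lower_bound[OF z r1 bound rM[unfolded M_def]] unfolding g_def by simp
    then have g_ge: "mass_const * (r powr \<alpha> * M) \<le> g"
      unfolding rM using r1 by (simp add: powr_add powr_numeral)
    have rp: "r powr \<alpha> > 0" using r1 by simp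
    have "(mass_const * (r powr \<alpha> * M))^2 \<le> g^2"
      using g_ge mass_const_pos rp M by (intro power_mono) auto
    also have "g^2 \<le> n * S"
    proof -
      have "g^2 = (\<Sum>x\<in>?\<Omega>. cone z r 0 x)^2" unfolding g_def using sum_cone_support[of z r 0 0] by simp
      also have "\<dots> \<le> n * (\<Sum>x\<in>?\<Omega>. (cone z r 0 x)^2)"
        unfolding n_def by (rule sum_squared_le_card[OF finite_cone_support])
      finally show ?thesis unfolding S_def using sum_cone_support[of z r 0 1] by (simp add: numeral_2_eq_2)
    qed
    also have "\<dots> \<le> CU * r powr \<alpha> * S" using n_le S0 by (rule mult_right_mono)
    finally have "mass_const^2 * M^2 * r powr \<alpha> * r powr \<alpha> \<le> CU * S * r powr \<alpha>"
      by (simp add: power2_eq_square mult_ac)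
    then have "mass_const^2 * M^2 * r powr \<alpha> \<le> CU * S" using rp by (simp add: mult_le_cancel_right)
    then have low: "M^2 * r powr \<alpha> \<le> CU * S / mass_const^2"
      using mass_const_pos by (simp add: pos_le_divide_eq mult_ac)
    have "Q (cone z r 0) \<le> 8 * (M * n) + 16 * CU * (M * n)" using energy g_le by (simp add: mult_ac)
    also have "\<dots> \<le> 24 * CU * (M * n)"
      using mult_right_mono[of 1 CU "M * n"] CU_ge_1 M by (simp add: n_def algebra_simps)
    also have "\<dots> \<le> 24 * CU * (M * (CU * r powr \<alpha>))"
      using n_le M CU_pos by (intro mult_left_mono) auto
    finally have "M * Q (cone z r 0) \<le> M * (24 * CU * (M * (CU * r powr \<alpha>)))" using M by (intro mult_left_mono) auto
    also have "\<dots> = 24 * CU^2 * (M^2 * r powr \<alpha>)" by (simp add: power2_eq_square)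
    also have "\<dots> \<le> 24 * CU^2 * (CU * S / mass_const^2)" using low by (intro mult_left_mono) auto
    also have "\<dots> = 24 * CU^3 / mass_const^2 * S" by (simp add: power2_eq_square power3_eq_cube)
    also have "\<dots> \<le> test_const * S"
      unfolding test_const_def using CU_pos S0 by (intro mult_right_mono) auto
    finally show "M * Q (cone z r 0) \<le> test_const * S" .
  next
    case False
    then have rM: "r = 1" unfolding r M_def[symmetric] using M by (simp add: max_def)
    have cz: "cone z r 0 z = M" using cone_center[OF z, of r 0] r1 M unfolding M_def by simp
    have \<Omega>: "?\<Omega> = {z}"
    proof
      show "?\<Omega> \<subseteq> {z}" using supp(1) unfolding rM by (auto simp: dst_eq_0)
    qed (use cz M in simp)
    have "g = M" unfolding g_def using sum_cone_support[of z r 0 0] \<Omega> cz by simp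
    moreover have "n = 1" unfolding n_def \<Omega> by simp
    ultimately have "M * Q (cone z r 0) \<le> M * (2 * M + 16 * CU * M)"
      using energy M by (auto intro!: mult_left_mono)
    also have "\<dots> \<le> 18 * CU * M^2"
      using mult_right_mono[of 1 CU "M^2"] CU_ge_1 by (simp add: power2_eq_square algebra_simps)
    also have "M^2 = S" unfolding S_def using sum_cone_support[of z r 0 1] \<Omega> cz by (simp add: numeral_2_eq_2)
    also have "18 * CU * S \<le> test_const * S"
      unfolding test_const_def using CU_pos S0 by (intro mult_right_mono) auto
    finally show "M * Q (cone z r 0) \<le> test_const * S" .
  qed
qed

text \<open>The radii add up as follows: the maximiser \<open>z\<close> is within
  \<open>10 * R\<close> of \<open>z0\<close>, the control region of radius \<open>2 * r\<close>
  around it stays within \<open>12 * R\<close>, and the support of radius \<open>r\<close> within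
  \<open>11 * R\<close>.\<close>

lemma local_test_function:
  fixes R R' :: real
  assumes z0: "z0 \<in> A" "R'^2 \<le> u z0" and R: "0 < R'" "1 \<le> R" "ln (R / R') \<le> 2 * R"
    and below: "\<And>y. y \<in> A \<Longrightarrow> real (dst z0 y) \<le> 12 * R \<Longrightarrow> u y < R^2"
  shows "\<exists>v. (\<forall>x. v x \<noteq> 0 \<longrightarrow> real (dst z0 x) \<le> 11 * R) \<and> (\<Sum>x\<in>A. (v x)^2) > 0 \<and>
     R'^2 * Q v \<le> test_const * (\<Sum>x\<in>A. (v x)^2)"
proof -
  \<comment> \<open>Replacing \<open>s\<close> by \<open>4 * s\<close> raises \<open>F\<close> by
    \<open>sqrt s + ln 4\<close>. Moving by \<open>2 * r\<close> with
    \<open>r = max 1 (sqrt s)\<close> costs \<open>r\<close> through \<open>d/2\<close>, which is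
    less: \<open>sqrt s\<close> pays when \<open>r = sqrt s\<close>, and \<open>ln 4 \<ge> 1\<close>
    pays when \<open>r = 1\<close>. So quadrupling \<open>u\<close> within \<open>2 * r\<close> of
    the maximiser is impossible.\<close>
  define F where "F s = sqrt s + ln s" for s :: real
  have F_less: "F s < F t" if "0 < s" "s < t" for s t
    unfolding F_def using that by (intro add_strict_mono) auto
  have F_le: "F s \<le> F t" if "0 < s" "s \<le> t" for s t
    using F_less[of s t] that by (cases "s = t") auto
  \<comment> \<open>Capping at \<open>R^2\<close> bounds the gain in \<open>F\<close>, so larger
    values of \<open>u\<close> farther away cannot attract the maximiser.\<close>
  define w where "w y = min (u y) (R^2)" for y
  have w_pos: "w y > 0" if "y \<in> A" for y unfolding w_def using landscape_pos[OF that] R by simp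
  obtain z where z: "z \<in> A" "\<And>y. y \<in> A \<Longrightarrow> F (w y) - dst z0 y / 2 \<le> F (w z) - dst z0 z / 2"
  proof -
    obtain z where "is_arg_min (\<lambda>y. - (F (w y) - dst z0 y / 2)) (\<lambda>y. y \<in> A) z"
      using ex_is_arg_min_if_finite[OF finite_A nonempty_A] by blast
    then have zA: "z \<in> A" and zm: "\<And>y. y \<in> A \<Longrightarrow> - (F (w z) - dst z0 z / 2) \<le> - (F (w y) - dst z0 y / 2)"
      unfolding is_arg_min_linorder by blast+
    show ?thesis by (rule that[OF zA]) (use zm in force)
  qed
  have z0_below: "u z0 < R^2" using below[OF z0(1)] R by simp
  then have wz0: "w z0 = u z0" unfolding w_def by simp
  have Fz0: "F (w z0) \<ge> 2 * ln R'"
  proof -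
    have "F (R'^2) \<le> F (w z0)" unfolding wz0 using R z0 by (intro F_le) auto
    moreover have "F (R'^2) = R' + 2 * ln R'" unfolding F_def using R by (simp add: ln_realpow)
    ultimately show ?thesis using R by simp
  qed
  have "F (w z) \<le> F (R^2)" using w_pos[OF z(1)] by (intro F_le) (auto simp: w_def)
  also have "F (R^2) = R + 2 * ln R" unfolding F_def using R by (simp add: ln_realpow)
  finally have "dst z0 z / 2 \<le> R + 2 * ln R - 2 * ln R'" using z(2)[OF z0(1)] Fz0 by simp
  also have "\<dots> = R + 2 * ln (R / R')" using R by (simp add: ln_div)
  \<comment> \<open>The gain in \<open>F\<close> is at most \<open>R + 2 * ln (R / R')\<close>,
    hence at most \<open>5 * R\<close> by the assumption on the logarithm, and distance enters with
    weight one half.\<close>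
  finally have dz: "real (dst z0 z) \<le> 10 * R" using R by simp
  then have uzR: "u z < R^2" using below[OF z(1)] R by simp
  then have wz: "w z = u z" unfolding w_def by simp
  have uz0: "u z > 0" using landscape_pos[OF z(1)] .
  have uz: "u z \<ge> u z0"
  proof (rule ccontr)
    assume "\<not> u z \<ge> u z0"
    then have "F (u z) < F (u z0)" using uz0 by (intro F_less) auto
    then show False using z(2)[OF z0(1)] wz wz0 by simp
  qed
  define r where "r = max 1 (sqrt (u z))"
  have r: "r \<le> R" unfolding r_def using R uzR real_sqrt_le_mono[of "u z" "R^2"] by simp
  have bound: "u y \<le> 4 * u z" if y: "y \<in> A" "real (dst z y) \<le> 2 * r" for y
  proof (rule ccontr)
    assume neg: "\<not> u y \<le> 4 * u z"
    have dy: "dst z0 y \<le> dst z0 z + dst z y" by (rule dst_triangle)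
    then have "u y < R^2" using below[OF y(1)] y(2) dz r by linarith
    then have "w y = u y" unfolding w_def by simp
    then have "F (u y) \<le> F (u z) + r" using z(2)[OF y(1)] wz dy y(2) by simp
    moreover have "F (4 * u z) < F (u y)" using neg uz0 by (intro F_less) auto
    moreover have "F (4 * u z) = 2 * sqrt (u z) + ln 4 + ln (u z)"
      unfolding F_def using uz0 by (simp add: real_sqrt_mult ln_mult)
    moreover have "ln (4::real) \<ge> 1" using exp_le by (subst ln_ge_iff) auto
    ultimately have "sqrt (u z) + 1 < r" unfolding F_def by simp
    then show False unfolding r_def using uz0 by (simp add: max_def split: if_splits)
  qed
  define v where "v = cone z r 0"
  have r1: "r \<ge> 1" unfolding r_def by simp
  have "\<forall>x. v x \<noteq> 0 \<longrightarrow> real (dst z0 x) \<le> 11 * R"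
  proof (intro allI impI)
    fix x assume "v x \<noteq> 0"
    then have "cone z r 0 x > 0" unfolding v_def using cone_nonneg[of z r 0 x] by simp
    then have "real (dst z x) < r" using bound by (intro cone_support(2)[OF z(1) r1, of 0 x]) auto
    then show "real (dst z0 x) \<le> 11 * R" using dst_triangle[of z0 x z] dz r by linarith
  qed
  moreover have pos: "(\<Sum>x\<in>A. (v x)^2) > 0"
    using z(1) finite_A cone_center[OF z(1), of r 0] r1 uz0 unfolding v_def by (intro sum_pos2[of _ z]) auto
  moreover have "R'^2 * Q v \<le> test_const * (\<Sum>x\<in>A. (v x)^2)"
  proof (cases "Q v \<ge> 0")
    case True
    then have "R'^2 * Q v \<le> u z * Q v" using uz z0(2) by (intro mult_right_mono) auto
    then show ?thesis using cone_test_function[OF z(1) r_def bound] unfolding v_def by linarith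
  next
    case False
    then have "R'^2 * Q v \<le> 0" by (intro mult_nonneg_nonpos) auto
    also have "0 \<le> test_const * (\<Sum>x\<in>A. (v x)^2)" using pos test_const_pos by simp
    finally show ?thesis .
  qed
  ultimately show ?thesis by blast
qed

end

section \<open>Comparison of counting functions\<close>

lemma powr_minus_half_square: "t > 0 \<Longrightarrow> (t powr (-1/2))^2 = 1 / (t::real)"
  unfolding power2_eq_square powr_add[symmetric] by (simp add: powr_minus_divide)

text \<open>Below radius 1 a ball is its centre, so the covering is the family of all singletons and
  counting balls is counting points.\<close>

lemma (in ahlfors_graph) covering_by_points:
  assumes P: "is_covering adj P R b" and R: "0 < R" "R < 1"
  shows "{B\<in>P. B \<inter> S \<noteq> {}} = (\<lambda>x. {x}) ` S"
proof -
  have sing: "\<exists>z. B = {z}" if "B \<in> P" for B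
    using P that R ball_lt_1 unfolding is_covering_def by (metis less_imp_le)
  have "{x} \<in> P" for x
  proof -
    obtain B where B: "B \<in> P" "x \<in> B" using P unfolding is_covering_def by blast
    then show ?thesis using sing[OF B(1)] by auto
  qed
  then show ?thesis using sing by fastforce
qed

context landscape_graph
begin

text \<open>Rewrites the minimum condition as meeting a sublevel set of \<open>1 / u\<close>, the
  form that covering and packing arguments use.\<close>

lemma Nu_eq: "Nu P A u E = card {B\<in>P. B \<inter> {x\<in>A. 1 / u x \<le> E} \<noteq> {}} / card A"
proof -
  have "(B \<inter> A \<noteq> {} \<and> Min ((\<lambda>x. 1 / u x) ` (B \<inter> A)) \<le> E) \<longleftrightarrow> B \<inter> {x\<in>A. 1 / u x \<le> E} \<noteq> {}" for B
  proof (cases "B \<inter> A = {}")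
    case False
    then have "Min ((\<lambda>x. 1 / u x) ` (B \<inter> A)) \<le> E \<longleftrightarrow> (\<exists>x\<in>B \<inter> A. 1 / u x \<le> E)"
      using finite_A by (subst Min_le_iff) auto
    then show ?thesis using False by blast
  qed auto
  then show ?thesis unfolding Nu_def by simp
qed

end

context poincare_landscape
begin

text \<open>The radius satisfies \<open>R^2 * (C * E) = 1\<close>, cancelling the \<open>R^2\<close>
  of the Poincare inequality. In \<open>C\<close>, 1 comes from the points off the counted balls,
  the product from the balls, and the other 1 makes the final inequality strict.\<close>

lemma upper_bound:
  assumes P: "is_covering adj P R b" and R: "R = (C * E) powr (-1/2)" and E: "E > 0"
    and C: "C = 2 + 4 * CP * (b * CU * 3 powr \<alpha> / c0 * lam powr \<alpha>)"
  shows "N E \<le> Nu P A u (C * E)"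
proof -
  define K where "K = b * CU * 3 powr \<alpha> / c0 * lam powr \<alpha>"
  have K: "K \<ge> 0" unfolding K_def using CU_pos c0_pos by simp
  have C0: "C > 0" unfolding C K_def[symmetric] using K CP_pos by (simp add: add_pos_nonneg)
  define e where "e = C * E"
  have e: "e > 0" unfolding e_def using C0 E by simp
  have R0: "R > 0" unfolding R using C0 E by simp
  have R2: "R^2 = 1 / e"
    unfolding R e_def[symmetric] by (rule powr_minus_half_square[OF e])
  define S where "S = {x\<in>A. 1 / u x \<le> e}"
  have S: "finite S" unfolding S_def using finite_A by simp
  define F where "F = {B\<in>P. B \<inter> S \<noteq> {}}"
  have F: "finite F" "F \<subseteq> P" unfolding F_def using covering_locally_finite[OF P S] by auto
  have cov: "S \<subseteq> \<Union>F" using P unfolding F_def is_covering_def by blast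
  have "\<exists>c. \<forall>B\<in>P. B = ball (c B) R" using P unfolding is_covering_def by (intro bchoice) auto
  then obtain ctr where ctr: "\<And>B. B \<in> F \<Longrightarrow> B = ball (ctr B) R" using F by blast
  have finB: "finite B" if "B \<in> F" for B by (subst ctr[OF that]) (rule finite_ball)
  \<comment> \<open>Weighting the constraint by degrees makes it say exactly that
    \<open>deg_mean\<close> vanishes on the ball.\<close>
  have "N E \<le> card F / card A"
  proof (rule IDS_le_card[OF finite_A nonempty_A adj_sym adm F(1), where a = "\<lambda>B x. if x \<in> B then real (gdeg adj x) else 0"])
    fix f :: "'v \<Rightarrow> real"
    assume nz: "\<exists>x\<in>A. f x \<noteq> 0" and off: "\<And>x. x \<notin> A \<Longrightarrow> f x = 0"
      and orth: "\<And>B. B \<in> F \<Longrightarrow> (\<Sum>x\<in>A. (if x \<in> B then real (gdeg adj x) else 0) * f x) = 0"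
    have mean: "(\<Sum>y\<in>B. f y * real (gdeg adj y)) = 0" if B: "B \<in> F" for B
    proof -
      have "(\<Sum>y\<in>B. f y * real (gdeg adj y)) = (\<Sum>y\<in>A \<inter> B. f y * real (gdeg adj y))"
        using finB[OF B] off by (intro sum.mono_neutral_right) auto
      also have "\<dots> = (\<Sum>x\<in>A. (if x \<in> B then real (gdeg adj x) else 0) * f x)"
        using finite_A by (intro sum.mono_neutral_cong_left) auto
      finally show ?thesis using orth[OF B] by simp
    qed
    define W where "W = (\<Sum>x\<in>A. (f x)^2 / u x)"
    have W_nonneg: "(f x)^2 / u x \<ge> 0" if "x \<in> A" for x using landscape_pos[OF that] by simp
    have "W > 0"
    proof -
      obtain x where "x \<in> A" "f x \<noteq> 0" using nz by blast
      then show ?thesis unfolding W_def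
        using finite_A landscape_pos by (intro sum_pos2[of _ x]) (auto simp: W_nonneg)
    qed
    then have Q0: "Q f > 0" using Q_ge_landscape[of f] unfolding W_def by linarith
    have small: "e * (\<Sum>x\<in>A - S. (f x)^2) \<le> Q f"
    proof -
      have "e * (\<Sum>x\<in>A - S. (f x)^2) \<le> (\<Sum>x\<in>A - S. (f x)^2 / u x)"
        unfolding sum_distrib_left
      proof (rule sum_mono)
        fix x assume "x \<in> A - S"
        then have "e \<le> 1 / u x" unfolding S_def by auto
        then show "e * (f x)^2 \<le> (f x)^2 / u x" using mult_right_mono[of e "1 / u x" "(f x)^2"] by simp
      qed
      also have "\<dots> \<le> W" unfolding W_def using finite_A W_nonneg by (intro sum_mono2) auto
      finally show ?thesis using Q_ge_landscape[of f] unfolding W_def by linarith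
    qed
    have bad: "e * (\<Sum>x\<in>S. (f x)^2) \<le> 4 * CP * K * Q f"
    proof (cases "R \<ge> 1")
      case True
      have "(\<Sum>x\<in>S. (f x)^2) \<le> (\<Sum>B\<in>F. \<Sum>x\<in>B. (f x)^2)"
        by (rule sum_le_sum_cover[OF F(1) finB cov]) auto
      also have "\<dots> \<le> (\<Sum>B\<in>F. CP * R^2 * dir (ball (ctr B) (lam * R)) f)"
      proof (rule sum_mono)
        fix B assume B: "B \<in> F"
        have "deg_mean adj B f = 0" unfolding deg_mean_def using mean[OF B] by simp
        then show "(\<Sum>x\<in>B. (f x)^2) \<le> CP * R^2 * dir (ball (ctr B) (lam * R)) f"
          using poincare[OF True, of f "ctr B"] unfolding ctr[OF B, symmetric] by simp
      qed
      also have "\<dots> = CP * R^2 * (\<Sum>B\<in>F. dir (ball (ctr B) (lam * R)) f)" by (simp add: sum_distrib_left)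
      also have "\<dots> \<le> CP * R^2 * (K * (4 * Q f))"
        unfolding K_def using CP_pos sum_dir_dilated_balls[OF P True lam_ge_1 F ctr dir_le_Q[OF _ off]]
        by (intro mult_left_mono) auto
      finally have "e * (\<Sum>x\<in>S. (f x)^2) \<le> e * (CP * R^2 * (K * (4 * Q f)))" using e by (intro mult_left_mono) auto
      then show ?thesis unfolding R2 using e by (simp add: mult_ac)
    next
      case False
      \<comment> \<open>The Poincare inequality starts at radius 1; below it the counted balls are
        single points, where the constraint itself forces \<open>f\<close> to vanish.\<close>
      have "f x = 0" if x: "x \<in> S" for x
      proof -
        have "{x} \<in> F" unfolding F_def using covering_by_points[OF P R0, of S] False x by auto
        from mean[OF this] show ?thesis using gdeg_ge_1[of x] by auto
      qed
      then show ?thesis using CP_pos K Q0 by simp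
    qed
    have "(\<Sum>x\<in>A. (f x)^2) = (\<Sum>x\<in>A - S. (f x)^2) + (\<Sum>x\<in>S. (f x)^2)"
      using finite_A by (intro sum.subset_diff) (auto simp: S_def)
    then have "e * (\<Sum>x\<in>A. (f x)^2) \<le> (1 + 4 * CP * K) * Q f"
      using small bad by (simp add: algebra_simps)
    also have "\<dots> < C * Q f" using Q0 unfolding C K_def[symmetric] by simp
    finally show "E * (\<Sum>x\<in>A. (f x)^2) < Q f" unfolding e_def using C0 by (simp add: mult.assoc)
  qed
  then show ?thesis unfolding Nu_eq F_def S_def e_def .
qed

text \<open>Times \<open>\<kappa> powr (-\<alpha>)\<close> it bounds the number of balls of the fine
  covering that meet a ball of radius \<open>24 * R2\<close>; the summand 1 keeps it
  positive.\<close>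

definition pack_const :: "nat \<Rightarrow> real" where
  "pack_const b = 1 + b * CU * 3 powr \<alpha> / c0 * 24 powr \<alpha>"

text \<open>Every fine ball counted at level \<open>e1\<close> is near either the centre of a test
  function or a coarse ball counted at level \<open>e2\<close>. Packing limits how many fine balls
  each of these accounts for.\<close>

lemma lower_bound_large_radius:
  fixes R1 R2 \<kappa> E e1 e2 :: real
  assumes P1: "is_covering adj P1 R1 b" and P2: "is_covering adj P2 R2 b"
    and \<kappa>: "0 < \<kappa>" "\<kappa> < 1" and R: "R1 > 0" "R2 \<ge> 1" "R2 = R1 / \<kappa>" "ln (1 / \<kappa>) \<le> 2 * R2"
    and E: "test_const \<le> E * R1^2" and e: "e1 = 1 / R1^2" "e2 = 1 / R2^2"
  shows "N E \<ge> \<kappa> powr \<alpha> / pack_const b * Nu P1 A u e1 - Nu P2 A u e2"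
proof -
  let ?K = "b * CU * 3 powr \<alpha> / c0 * 24 powr \<alpha>"
  have K: "?K \<ge> 0" using CU_pos c0_pos by simp
  define S1 where "S1 = {x\<in>A. 1 / u x \<le> e1}"
  define S2 where "S2 = {x\<in>A. 1 / u x \<le> e2}"
  have S: "finite S1" "finite S2" unfolding S1_def S2_def using finite_A by auto
  have S1: "x \<in> S1 \<longleftrightarrow> x \<in> A \<and> R1^2 \<le> u x" for x
    unfolding S1_def e using landscape_pos[of x] R by (auto simp: field_simps)
  have S2: "x \<in> S2 \<longleftrightarrow> x \<in> A \<and> R2^2 \<le> u x" for x
  proof -
    have "R2 > 0" using R by simp
    then show ?thesis unfolding S2_def e using landscape_pos[of x] by (auto simp: field_simps)
  qed
  \<comment> \<open>The points whose surroundings satisfy the hypothesis of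
    \<open>local_test_function\<close> with \<open>R = R2\<close>.\<close>
  define X where "X = {x\<in>S1. \<forall>y\<in>S2. real (dst x y) > 12 * R2}"
  obtain T where T: "T \<subseteq> X" "\<And>x y. x \<in> T \<Longrightarrow> y \<in> T \<Longrightarrow> x \<noteq> y \<Longrightarrow> real (dst x y) > 24 * R2"
    "X \<subseteq> (\<Union>x\<in>T. ball x (24 * R2))"
    using maximal_separated_set[of X "24 * R2"] R by (auto simp: max_def)
  have finT: "finite T" using T(1) S unfolding X_def by (auto intro: finite_subset)
  have RR: "ln (R2 / R1) \<le> 2 * R2" using R \<kappa> by simp
  have "\<exists>v. (\<forall>x. v x \<noteq> 0 \<longrightarrow> real (dst t x) \<le> 11 * R2) \<and> (\<Sum>x\<in>A. (v x)^2) > 0 \<and>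
     R1^2 * Q v \<le> test_const * (\<Sum>x\<in>A. (v x)^2)" if t: "t \<in> T" for t
  proof (rule local_test_function[OF _ _ R(1,2) RR])
    show "t \<in> A" "R1^2 \<le> u t" using t T(1) S1 unfolding X_def by auto
    fix y assume "y \<in> A" "real (dst t y) \<le> 12 * R2"
    then show "u y < R2^2" using t T(1) S2[of y] unfolding X_def by force
  qed
  then obtain v where v: "\<And>t x. t \<in> T \<Longrightarrow> v t x \<noteq> 0 \<Longrightarrow> real (dst t x) \<le> 11 * R2"
    "\<And>t. t \<in> T \<Longrightarrow> (\<Sum>x\<in>A. (v t x)^2) > 0"
    "\<And>t. t \<in> T \<Longrightarrow> R1^2 * Q (v t) \<le> test_const * (\<Sum>x\<in>A. (v t x)^2)" by metis
  have NT: "card T / card A \<le> N E"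
  proof (rule card_le_N_separated[OF finT, of v])
    fix s t x y assume st: "s \<in> T" "t \<in> T" "s \<noteq> t" "v s x \<noteq> 0" "v t y \<noteq> 0"
    \<comment> \<open>Centres are more than \<open>24 * R2\<close> apart and supports reach at most
      \<open>11 * R2\<close>, which leaves a gap above \<open>2 * R2\<close>.\<close>
    have "real (dst x y) > 1"
      using T(2)[OF st(1-3)] v(1)[OF st(1,4)] v(1)[OF st(2,5)] dst_triangle[of s t x] dst_triangle[of x t y] R(2)
      by (simp add: dst_sym[of y t])
    then show "x \<noteq> y \<and> \<not> adj x y" using dst_adj[of x y] by auto
  next
    fix t assume t: "t \<in> T"
    show "(\<Sum>x\<in>A. (v t x)^2) > 0" by (rule v(2)[OF t])
    have "R1^2 * Q (v t) \<le> E * R1^2 * (\<Sum>x\<in>A. (v t x)^2)"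
      using v(3)[OF t] mult_right_mono[OF E less_imp_le[OF v(2)[OF t]]] by linarith
    then show "Q (v t) \<le> E * (\<Sum>x\<in>A. (v t x)^2)" using R(1) by (simp add: mult.assoc mult.left_commute)
  qed
  define F1 where "F1 = {B\<in>P1. B \<inter> S1 \<noteq> {}}"
  define F2 where "F2 = {B\<in>P2. B \<inter> S2 \<noteq> {}}"
  have F2: "finite F2" unfolding F2_def using covering_locally_finite[OF P2 S(2)] .
  have "\<exists>c. \<forall>B\<in>P2. B = ball (c B) R2" using P2 unfolding is_covering_def by (intro bchoice) auto
  then obtain ctr where ctr: "\<And>B. B \<in> P2 \<Longrightarrow> B = ball (ctr B) R2" by blast
  define G where "G z = {B\<in>P1. B \<inter> ball z (24 * R2) \<noteq> {}}" for z
  have finG: "finite (G z)" for z unfolding G_def by (rule covering_locally_finite[OF P1 finite_ball])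
  have cardG: "card (G z) \<le> ?K * \<kappa> powr (-\<alpha>)" for z
  proof -
    have "R1 = \<kappa> * R2" using R(3) \<kappa> by simp
    then have "R1 \<le> 24 * R2" using \<kappa> R(2) mult_right_mono[of \<kappa> 24 R2] by simp
    then have "card (G z) \<le> b * CU * 3 powr \<alpha> / c0 * (24 * R2 / R1) powr \<alpha>"
      unfolding G_def using covering_card_meeting_ball[OF P1, of "24 * R2" z] R by simp
    also have "24 * R2 / R1 = 24 * (1 / \<kappa>)" using R \<kappa> by simp
    also have "(24 * (1 / \<kappa>)) powr \<alpha> = 24 powr \<alpha> * \<kappa> powr (-\<alpha>)"
      using \<kappa> by (subst powr_mult) (auto simp: powr_divide powr_minus_divide)
    finally show ?thesis by (simp add: mult.assoc)
  qed
  have cover: "F1 \<subseteq> (\<Union>z\<in>T. G z) \<union> (\<Union>B\<in>F2. G (ctr B))"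
  proof
    fix B assume B: "B \<in> F1"
    then obtain x where x: "x \<in> B" "x \<in> S1" "B \<in> P1" unfolding F1_def by blast
    show "B \<in> (\<Union>z\<in>T. G z) \<union> (\<Union>B\<in>F2. G (ctr B))"
    proof (cases "x \<in> X")
      case True
      then obtain t where "t \<in> T" "x \<in> ball t (24 * R2)" using T(3) by blast
      then show ?thesis using x unfolding G_def by blast
    next
      case False
      then obtain y where y: "y \<in> S2" "real (dst x y) \<le> 12 * R2" using x unfolding X_def by force
      obtain B' where B': "B' \<in> P2" "y \<in> B'" using P2 unfolding is_covering_def by blast
      then have "real (dst (ctr B') y) \<le> R2" using ctr[OF B'(1)] mem_ball by blast
      \<comment> \<open>The distance is at most \<open>12 * R2 + R2\<close>; using the larger radius
        lets the same count \<open>G\<close> serve for centres in \<open>T\<close> and for coarse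
        balls.\<close>
      then have "x \<in> ball (ctr B') (24 * R2)"
        using y dst_triangle[of "ctr B'" x y] R(2) by (simp add: mem_ball dst_sym[of y x])
      then have "B \<in> G (ctr B')" using x unfolding G_def by blast
      moreover have "B' \<in> F2" using B' y unfolding F2_def by blast
      ultimately show ?thesis by blast
    qed
  qed
  have "card F1 \<le> card ((\<Union>z\<in>T. G z) \<union> (\<Union>B\<in>F2. G (ctr B)))"
    using cover finT F2 finG by (intro card_mono) auto
  also have "\<dots> \<le> card (\<Union>z\<in>T. G z) + card (\<Union>B\<in>F2. G (ctr B))" by (rule card_Un_le)
  also have "\<dots> \<le> (\<Sum>z\<in>T. card (G z)) + (\<Sum>B\<in>F2. card (G (ctr B)))"
    using finT F2 by (intro add_mono card_UN_le)
  finally have "real (card F1) \<le> (\<Sum>z\<in>T. real (card (G z))) + (\<Sum>B\<in>F2. real (card (G (ctr B))))"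
    by (metis of_nat_add of_nat_le_iff of_nat_sum)
  also have "\<dots> \<le> card T * (?K * \<kappa> powr (-\<alpha>)) + card F2 * (?K * \<kappa> powr (-\<alpha>))"
    using cardG by (intro add_mono sum_bounded_above)
  also have "\<dots> = (real (card T) + real (card F2)) * (?K * \<kappa> powr (-\<alpha>))"
    by (rule distrib_right[symmetric])
  also have "\<dots> \<le> (real (card T) + real (card F2)) * (pack_const b * \<kappa> powr (-\<alpha>))"
    unfolding pack_const_def by (intro mult_left_mono mult_right_mono) auto
  finally have "\<kappa> powr \<alpha> / pack_const b * card F1 \<le> \<kappa> powr \<alpha> / pack_const b * ((real (card T) + real (card F2)) * (pack_const b * \<kappa> powr (-\<alpha>)))"
    using K unfolding pack_const_def by (intro mult_left_mono) auto
  also have "\<dots> = card T + card F2"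
  proof -
    have "\<kappa> powr \<alpha> * \<kappa> powr (-\<alpha>) = 1" using \<kappa> by (simp add: powr_minus)
    moreover have "pack_const b > 0" using K unfolding pack_const_def by linarith
    ultimately show ?thesis by (simp add: mult_ac)
  qed
  finally have main: "\<kappa> powr \<alpha> / pack_const b * card F1 - card F2 \<le> card T" by simp
  have "\<kappa> powr \<alpha> / pack_const b * Nu P1 A u e1 - Nu P2 A u e2 = (\<kappa> powr \<alpha> / pack_const b * card F1 - card F2) / card A"
    unfolding Nu_eq F1_def F2_def S1_def S2_def by (simp add: diff_divide_distrib)
  also have "\<dots> \<le> card T / card A" using main by (intro divide_right_mono) auto
  finally show ?thesis using NT by linarith
qed

text \<open>If \<open>u \<le> 1\<close> at all neighbours of \<open>x\<close> in \<open>A\<close>,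
  the equation gives \<open>diag x * u x \<le> CU\<close>, so the point mass at \<open>x\<close> has
  low energy when \<open>u x\<close> is large. Any other point of \<open>S1\<close> is adjacent to a
  point of \<open>S2\<close>, and each of those has fewer than \<open>CU + 1\<close> points in its
  unit ball.\<close>

lemma lower_bound_small_radius:
  fixes R1 R2 E e1 e2 :: real
  assumes P1: "is_covering adj P1 R1 b" and P2: "is_covering adj P2 R2 b"
    and R: "0 < R1" "R1 < 1" "0 < R2" "R2 < 1" and e: "e2 \<ge> 1" "2 * CU * e1 \<le> E"
  shows "N E \<ge> Nu P1 A u e1 - CU * Nu P2 A u e2"
proof -
  define S1 where "S1 = {x\<in>A. 1 / u x \<le> e1}"
  define S2 where "S2 = {x\<in>A. 1 / u x \<le> e2}"
  have S: "finite S1" "finite S2" unfolding S1_def S2_def using finite_A by auto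
  define X where "X = {x\<in>S1. \<forall>y\<in>S2. \<not> adj y x}"
  have NX: "card X / card A \<le> N E"
  proof (rule card_le_N_diag)
    show "X \<subseteq> A" unfolding X_def S1_def by auto
    fix x assume x: "x \<in> X"
    then have xA: "x \<in> A" "1 / u x \<le> e1" unfolding X_def S1_def by auto
    have ux: "u x > 0" by (rule landscape_pos[OF xA(1)])
    have "diag x * u x = 1 + (\<Sum>y\<in>A. if adj x y then \<mu> x y * u y else 0)"
      using H_landscape[OF xA(1)] unfolding H_expand by linarith
    also have "(\<Sum>y\<in>A. if adj x y then \<mu> x y * u y else 0) \<le> (\<Sum>y\<in>A. if adj x y then 1 else 0)"
    proof (rule sum_mono)
      fix y assume y: "y \<in> A"
      show "(if adj x y then \<mu> x y * u y else 0) \<le> (if adj x y then 1 else 0)"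
      proof (cases "adj x y")
        case True
        then have "y \<notin> S2" using x adj_sym unfolding X_def by blast
        then have "1 \<le> 1 / u y" using y e(1) unfolding S2_def by auto
        then have "u y \<le> 1" using landscape_pos[OF y] by (simp add: pos_le_divide_eq)
        then show ?thesis using True mu_nonneg[OF True] mu_le_1[OF True] landscape_pos[OF y]
          by (simp add: mult_le_one)
      qed simp
    qed
    also have "\<dots> \<le> real (gdeg adj x) * 1" using finite_A by (intro sum_neighbors_le) auto
    finally have "diag x * u x \<le> CU" using gdeg_le[of x] by simp
    then have "diag x \<le> CU * (1 / u x)" using ux by (simp add: pos_le_divide_eq)
    also have "\<dots> \<le> CU * e1" using xA(2) CU_pos by (intro mult_left_mono) auto
    finally have "2 * diag x \<le> 2 * (CU * e1)" by simp
    also have "\<dots> \<le> E" using e(2) by (simp only: mult.assoc)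
    finally show "2 * diag x \<le> E" .
  qed
  have "S1 \<subseteq> X \<union> (\<Union>y\<in>S2. ball y 1)"
    unfolding X_def using neighbors_subset_ball by blast
  then have "card S1 \<le> card (X \<union> (\<Union>y\<in>S2. ball y 1))"
    using S finite_ball unfolding X_def by (intro card_mono) auto
  also have "\<dots> \<le> card X + card (\<Union>y\<in>S2. ball y 1)" by (rule card_Un_le)
  also have "\<dots> \<le> card X + (\<Sum>y\<in>S2. card (ball y 1))"
    using S by (intro add_mono card_UN_le) auto
  finally have "real (card S1) \<le> card X + (\<Sum>y\<in>S2. real (card (ball y 1)))"
    by (metis of_nat_add of_nat_le_iff of_nat_sum)
  also have "(\<Sum>y\<in>S2. real (card (ball y 1))) \<le> card S2 * CU"
    using card_ball_1_le by (intro sum_bounded_above)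
  finally have main: "real (card S1) - CU * card S2 \<le> card X" by (simp add: mult.commute)
  have n: "card ((\<lambda>x. {x}) ` S) = card S" for S :: "'v set" by (intro card_image) auto
  have "Nu P1 A u e1 - CU * Nu P2 A u e2 = (real (card S1) - CU * card S2) / card A"
    unfolding Nu_eq covering_by_points[OF P1 R(1,2)] covering_by_points[OF P2 R(3,4)] n S1_def S2_def
    by (simp add: diff_divide_distrib)
  also have "\<dots> \<le> card X / card A" using main by (intro divide_right_mono) auto
  finally show ?thesis using NX by linarith
qed

end

theorem theorem1p1:
  fixes adj :: "'v \<Rightarrow> 'v \<Rightarrow> bool" and \<alpha> CL CU CP lam :: real
  assumes graph: "infinite_connected_simple_graph adj"
    and vol: "volume_control adj \<alpha> CL CU"
    and poinc: "weak_poincare adj CP lam"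
  shows "\<exists>b::nat. (\<forall>R>0. \<exists>P. is_covering adj P R b) \<and>
    (\<exists>C>0. \<forall>(A::'v set) \<mu> V E P.
        finite A \<and> A \<noteq> {} \<and> admissible adj \<mu> V \<and> E > 0 \<and>
        is_covering adj P ((C * E) powr (-1/2)) b \<longrightarrow>
        IDS adj \<mu> V A E \<le> Nu P A (landscape adj \<mu> V A) (C * E)) \<and>
    (\<exists>c1 c2 c3 c4 c1' c2' c3' c4' cs :: real.
        c1 > 0 \<and> c2 > 0 \<and> c3 > 0 \<and> c4 > 0 \<and> c1' > 0 \<and> c2' > 0 \<and> c3' > 0 \<and> c4' > 0 \<and> cs > 0 \<and>
        (\<forall>(A::'v set) \<mu> V \<kappa> E P1 P2.
           finite A \<and> A \<noteq> {} \<and> admissible adj \<mu> V \<and> 0 < \<kappa> \<and> \<kappa> < 1/4 \<and> E > 0 \<longrightarrow>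
           (E \<le> cs * \<kappa> powr (-4) \<and>
              is_covering adj P1 ((c3 * \<kappa> powr (\<alpha>+2) * E) powr (-1/2)) b \<and>
              is_covering adj P2 ((c4 * \<kappa> powr (\<alpha>+4) * E) powr (-1/2)) b \<longrightarrow>
              IDS adj \<mu> V A E \<ge>
                c1 * \<kappa> powr \<alpha> * Nu P1 A (landscape adj \<mu> V A) (c3 * \<kappa> powr (\<alpha>+2) * E)
                - c2 * Nu P2 A (landscape adj \<mu> V A) (c4 * \<kappa> powr (\<alpha>+4) * E)) \<and>
           (E > cs * \<kappa> powr (-4) \<and>
              is_covering adj P1 ((c3' * \<kappa>^2 * E) powr (-1/2)) b \<and>
              is_covering adj P2 ((c4' * \<kappa>^4 * E) powr (-1/2)) b \<longrightarrow>
              IDS adj \<mu> V A E \<ge>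
                c1' * Nu P1 A (landscape adj \<mu> V A) (c3' * \<kappa>^2 * E)
                - c2' * Nu P2 A (landscape adj \<mu> V A) (c4' * \<kappa>^4 * E))))"
proof -
  interpret G: poincare_graph adj \<alpha> CL CU CP lam by unfold_locales (use assms in auto)
  obtain b where b: "\<forall>R>0. \<exists>P. is_covering adj P R b" using G.covering_exists by blast
  define C where "C = 2 + 4 * CP * (b * CU * 3 powr \<alpha> / G.c0 * lam powr \<alpha>)"
  have C: "C > 0" unfolding C_def using G.CU_pos G.c0_pos G.CP_pos by (intro add_pos_nonneg) auto
  have upper: "IDS adj \<mu> V A E \<le> Nu P A (landscape adj \<mu> V A) (C * E)"
    if "finite A" "A \<noteq> {}" "admissible adj \<mu> V" "E > 0" "is_covering adj P ((C * E) powr (-1/2)) b" for A \<mu> V E P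
  proof -
    interpret poincare_landscape adj \<alpha> CL CU CP lam \<mu> V A by unfold_locales (use that in auto)
    show ?thesis by (rule upper_bound[OF that(5) refl that(4) C_def])
  qed
  \<comment> \<open>One constant for both regimes: the first bound makes the Rayleigh quotients of
    the cones at most \<open>E\<close>, the second does so for point masses.\<close>
  define c where "c = min (1 / G.test_const) (1 / (2 * CU))"
  define K where "K = 1 + b * CU * 3 powr \<alpha> / G.c0 * 24 powr \<alpha>"
  have K: "K > 0" unfolding K_def using G.CU_pos G.c0_pos by (intro add_pos_nonneg) auto
  have c: "c > 0" "c * G.test_const \<le> 1" "2 * CU * c \<le> 1"
  proof -
    show "c > 0" unfolding c_def using G.test_const_pos G.CU_pos by simp
    have "c \<le> 1 / G.test_const" "c \<le> 1 / (2 * CU)" unfolding c_def by auto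
    then show "c * G.test_const \<le> 1" "2 * CU * c \<le> 1"
      using G.test_const_pos G.CU_pos by (simp_all add: pos_le_divide_eq mult_ac)
  qed
  have lower1: "IDS adj \<mu> V A E \<ge> (1 / K) * \<kappa> powr \<alpha> * Nu P1 A (landscape adj \<mu> V A) (c * \<kappa> powr (\<alpha>+2) * E)
      - 1 * Nu P2 A (landscape adj \<mu> V A) (c * \<kappa> powr (\<alpha>+4) * E)"
    if A: "finite A" "A \<noteq> {}" "admissible adj \<mu> V" and \<kappa>: "0 < \<kappa>" "\<kappa> < 1/4" and E: "E > 0" "E \<le> (1 / c) * \<kappa> powr (-4)"
      and P1: "is_covering adj P1 ((c * \<kappa> powr (\<alpha>+2) * E) powr (-1/2)) b"
      and P2: "is_covering adj P2 ((c * \<kappa> powr (\<alpha>+4) * E) powr (-1/2)) b"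
    for A \<mu> V \<kappa> E P1 P2
  proof -
    interpret poincare_landscape adj \<alpha> CL CU CP lam \<mu> V A by unfold_locales (use A in auto)
    define e1 where "e1 = c * \<kappa> powr (\<alpha>+2) * E"
    define e2 where "e2 = c * \<kappa> powr (\<alpha>+4) * E"
    have e1: "e1 > 0" unfolding e1_def using c E \<kappa> by simp
    have e2: "e2 = \<kappa>^2 * e1"
    proof -
      have "\<kappa> powr (\<alpha>+4) = \<kappa> powr (\<alpha>+2) * \<kappa> powr 2" by (simp add: powr_add[symmetric] add.commute)
      then show ?thesis unfolding e1_def e2_def using \<kappa> by (simp add: powr_numeral)
    qed
    have e2_pos: "e2 > 0" unfolding e2 using e1 \<kappa> by simp
    \<comment> \<open>The threshold \<open>1 / c\<close> is chosen for this: it gives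
      \<open>e2 \<le> \<kappa> powr \<alpha>\<close>, hence \<open>e2 \<le> \<kappa>\<close> as
      \<open>\<alpha> \<ge> 1\<close>. From \<open>R2^2 \<ge> 1 / \<kappa>\<close> follow both
      \<open>R2 \<ge> 1\<close> and the bound on the logarithm.\<close>
    have "c * E \<le> \<kappa> powr (-4)" using E(2) c(1) by (simp add: pos_le_divide_eq mult.commute)
    then have "\<kappa> powr (\<alpha>+4) * (c * E) \<le> \<kappa> powr (\<alpha>+4) * \<kappa> powr (-4)" by (intro mult_left_mono) auto
    also have "\<dots> = \<kappa> powr \<alpha>" by (simp add: powr_add[symmetric])
    finally have e2_le: "e2 \<le> \<kappa> powr \<alpha>" unfolding e2_def by (simp add: mult_ac)
    also have "\<kappa> powr \<alpha> \<le> \<kappa> powr 1" using \<kappa> G.alpha_ge_1 by (intro powr_mono') auto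
    finally have e2_le: "e2 \<le> \<kappa>" using \<kappa> by simp
    define R1 where "R1 = e1 powr (-1/2)"
    define R2 where "R2 = e2 powr (-1/2)"
    have R1: "R1 > 0" "R1^2 = 1 / e1" and R2: "R2 > 0" "R2^2 = 1 / e2"
      unfolding R1_def R2_def using powr_minus_half_square e1 e2_pos by simp_all
    have R2_ge: "R2^2 \<ge> 1 / \<kappa>" unfolding R2 using e2_le e2_pos \<kappa> by (intro divide_left_mono) auto
    have "R2 \<ge> 1"
    proof -
      have "1 \<le> 1 / \<kappa>" using \<kappa> by simp
      then have "1^2 \<le> R2^2" using R2_ge by simp
      then show ?thesis using R2(1) by (intro power2_le_imp_le[of 1 R2]) simp_all
    qed
    moreover have "R2 = R1 / \<kappa>"
    proof -
      have "(R1 / \<kappa>)^2 = R2^2" unfolding power_divide R1 R2 e2 by simp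
      then show ?thesis using R1(1) R2(1) \<kappa>(1) by (intro power2_eq_imp_eq[of R2 "R1 / \<kappa>"]) simp_all
    qed
    moreover have "ln (1 / \<kappa>) \<le> 2 * R2"
    proof -
      have "ln (1 / \<kappa>) \<le> ln (R2^2)" using R2_ge \<kappa> R2(1) by (subst ln_le_cancel_iff) auto
      also have "\<dots> = 2 * ln R2" using R2(1) by (simp add: ln_realpow)
      also have "ln R2 \<le> R2" using R2(1) ln_le_minus_one[of R2] by simp
      finally show ?thesis by simp
    qed
    moreover have "G.test_const \<le> E * R1^2"
    proof -
      have "\<kappa> powr (\<alpha>+2) \<le> 1" using \<kappa> G.alpha_ge_1 by (intro powr_le1) auto
      then have "(c * G.test_const) * \<kappa> powr (\<alpha>+2) \<le> 1"
        using c(2) by (intro mult_le_one[of "c * G.test_const"]) simp_all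
      then have "(c * G.test_const) * \<kappa> powr (\<alpha>+2) * E \<le> 1 * E" using E by (intro mult_right_mono) auto
      then have "G.test_const * e1 \<le> E" unfolding e1_def by (simp add: mult_ac)
      then show ?thesis unfolding R1 using e1 by (simp add: pos_le_divide_eq)
    qed
    ultimately have "IDS adj \<mu> V A E \<ge> \<kappa> powr \<alpha> / pack_const b * Nu P1 A (landscape adj \<mu> V A) e1 - Nu P2 A (landscape adj \<mu> V A) e2"
      using \<kappa> R1 R2 P1 P2 e1 e2_pos
      by (intro lower_bound_large_radius[of P1 R1 b P2 R2]) (auto simp: R1_def R2_def e1_def e2_def)
    then show ?thesis unfolding pack_const_def K_def e1_def e2_def by simp
  qed
  have lower2: "IDS adj \<mu> V A E \<ge> 1 * Nu P1 A (landscape adj \<mu> V A) (c * \<kappa>^2 * E)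
      - CU * Nu P2 A (landscape adj \<mu> V A) (c * \<kappa>^4 * E)"
    if A: "finite A" "A \<noteq> {}" "admissible adj \<mu> V" and \<kappa>: "0 < \<kappa>" "\<kappa> < 1/4" and E: "E > 0" "E > (1 / c) * \<kappa> powr (-4)"
      and P1: "is_covering adj P1 ((c * \<kappa>^2 * E) powr (-1/2)) b"
      and P2: "is_covering adj P2 ((c * \<kappa>^4 * E) powr (-1/2)) b"
    for A \<mu> V \<kappa> E P1 P2
  proof -
    interpret poincare_landscape adj \<alpha> CL CU CP lam \<mu> V A by unfold_locales (use A in auto)
    define e1 where "e1 = c * \<kappa>^2 * E"
    define e2 where "e2 = c * \<kappa>^4 * E"
    \<comment> \<open>Beyond the threshold \<open>e2\<close> exceeds 1, and so does the larger
      \<open>e1\<close>; both covering radii are then below 1.\<close>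
    have "\<kappa> powr (-4) < c * E" using E(2) c(1) by (simp add: pos_divide_less_eq mult.commute)
    then have "\<kappa>^4 * \<kappa> powr (-4) < \<kappa>^4 * (c * E)" using \<kappa> by (intro mult_strict_left_mono) auto
    moreover have "\<kappa>^4 * \<kappa> powr (-4) = 1" using \<kappa> by (simp add: powr_minus_divide powr_numeral)
    ultimately have e2: "e2 > 1" unfolding e2_def by (simp add: mult_ac)
    have \<kappa>2: "\<kappa>^2 \<le> 1" using \<kappa> by (intro power_le_one) auto
    have "e2 = \<kappa>^2 * e1" unfolding e1_def e2_def by (simp add: power4_eq_xxxx power2_eq_square)
    also have "\<dots> \<le> 1 * e1" unfolding e1_def using \<kappa>2 c E by (intro mult_right_mono) auto
    finally have e1: "e1 > 1" using e2 by simp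
    have lt: "t powr (-1/2) < 1" if "t > 1" for t :: real
      using that powr_less_mono[of "-1/2" 0 t] by simp
    have "2 * CU * e1 \<le> E"
    proof -
      have "(2 * CU * c) * \<kappa>^2 \<le> 1" using c(3) \<kappa>2 by (intro mult_le_one[of "2 * CU * c"]) simp_all
      then have "(2 * CU * c) * \<kappa>^2 * E \<le> 1 * E" using E by (intro mult_right_mono) auto
      then show ?thesis unfolding e1_def by (simp add: mult_ac)
    qed
    then have "IDS adj \<mu> V A E \<ge> Nu P1 A (landscape adj \<mu> V A) e1 - CU * Nu P2 A (landscape adj \<mu> V A) e2"
      using P1 P2 e1 e2 lt
      by (intro lower_bound_small_radius[of P1 "e1 powr (-1/2)" b P2 "e2 powr (-1/2)"]) (auto simp: e1_def e2_def)
    then show ?thesis unfolding e1_def e2_def by simp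
  qed
  show ?thesis
  proof (intro exI[of _ b] conjI, goal_cases)
    case 1
    show ?case by (rule b)
  next
    case 2
    show ?case using C upper by (intro exI[of _ C]) simp
  next
    case 3
    show ?case
    proof (rule exI[of _ "1 / K"], rule exI[of _ 1], rule exI[of _ c], rule exI[of _ c],
        rule exI[of _ 1], rule exI[of _ CU], rule exI[of _ c], rule exI[of _ c], rule exI[of _ "1 / c"],
        intro conjI allI impI, goal_cases)
      case (10 A \<mu> V \<kappa> E P1 P2)
      then show ?case using lower1[of A \<mu> V \<kappa> E P1 P2] by blast
    next
      case (11 A \<mu> V \<kappa> E P1 P2)
      then show ?case using lower2[of A \<mu> V \<kappa> E P1 P2] by blast
    qed (use c(1) K G.CU_pos in simp_all)
  qed
qed

end
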